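(* For every $q\ge 2$, there is a constant $\sigma_q$ such that, for every $\varepsilon>0$, if an algorithm solves in time $(q-\varepsilon)^p\cdot n^{\mathcal{O}(1)}$ every $n$-vertex instance of List Edge Deletion to $q$-Coloring that is given with a $(\sigma_q,3)$-hub of size $p$, then the M3SH fails.
   Context: For a graph $G$, a set $Q\subseteq V(G)$ is a $(\sigma,\delta)$-hub if every connected component of $G-Q$ has at most $\sigma$ vertices and is adjacent to at most $\delta$ vertices of $Q$. List Edge Deletion to $q$-Coloring: given a graph $G$ and lists $L:V(G)\to 2^{\{1,\dots,q\}}$, find a minimum-size set $X$ of edges such that $G\setminus X$ has a proper coloring $\phi$ with $\phi(v)\in L(v)$ for all $v$. Max 3-Sat: given a CNF formula with at most three literals per clause, find an assignment violating the fewest clauses. M3SH: there is no $\epsilon>0$ such that every $n$-variable Max 3-Sat instance can be solved in time $(2-\epsilon)^n n^{\mathcal{O}(1)}$. *)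

theory Defs
  imports Complex_Main
begin

section \<open>Graphs, hubs and edge deletion to list colouring\<close>

definition simple_graph :: "'a set \<Rightarrow> 'a set set \<Rightarrow> bool" where
  "simple_graph V E \<longleftrightarrow> finite V \<and> E \<subseteq> {{u, v} | u v. u \<in> V \<and> v \<in> V \<and> u \<noteq> v}"

text \<open>Adjacency within \<open>V\<close>; for \<open>V\<close> smaller than the vertex set this is adjacency in the
  induced subgraph.\<close>

definition adj_on :: "'a set \<Rightarrow> 'a set set \<Rightarrow> ('a \<times> 'a) set" where
  "adj_on V E = {(u, v). u \<in> V \<and> v \<in> V \<and> {u, v} \<in> E}"

definition components :: "'a set \<Rightarrow> 'a set set \<Rightarrow> 'a set set" where
  "components V E = V // (adj_on V E)\<^sup>*"

definition is_hub :: "nat \<Rightarrow> nat \<Rightarrow> 'a set \<Rightarrow> 'a set set \<Rightarrow> 'a set \<Rightarrow> bool" where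
  "is_hub \<sigma> \<delta> V E Q \<longleftrightarrow> Q \<subseteq> V \<and>
     (\<forall>C \<in> components (V - Q) E.
        card C \<le> \<sigma> \<and> card {v \<in> Q. \<exists>u \<in> C. {u, v} \<in> E} \<le> \<delta>)"

definition proper_list_coloring ::
    "'a set \<Rightarrow> 'a set set \<Rightarrow> ('a \<Rightarrow> nat set) \<Rightarrow> ('a \<Rightarrow> nat) \<Rightarrow> bool" where
  "proper_list_coloring V E L \<phi> \<longleftrightarrow>
     (\<forall>v \<in> V. \<phi> v \<in> L v) \<and> (\<forall>u v. {u, v} \<in> E \<longrightarrow> \<phi> u \<noteq> \<phi> v)"

definition LED_feasible ::
    "'a set \<Rightarrow> 'a set set \<Rightarrow> ('a \<Rightarrow> nat set) \<Rightarrow> 'a set set \<Rightarrow> bool" where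
  "LED_feasible V E L X \<longleftrightarrow> X \<subseteq> E \<and> (\<exists>\<phi>. proper_list_coloring V (E - X) L \<phi>)"

definition LED_optimal ::
    "'a set \<Rightarrow> 'a set set \<Rightarrow> ('a \<Rightarrow> nat set) \<Rightarrow> 'a set set \<Rightarrow> bool" where
  "LED_optimal V E L X \<longleftrightarrow> is_arg_min card (LED_feasible V E L) X"


section \<open>Max 3-Sat\<close>

text \<open>The literal \<open>(i, b)\<close> is satisfied iff variable \<open>i\<close> has value \<open>b\<close>. A formula is a set of
  clauses, so an \<open>n\<close>-variable formula has only \<open>O(n\<^sup>3)\<close> clauses.\<close>

type_synonym literal = "nat \<times> bool"

definition is_3cnf :: "nat \<Rightarrow> literal set set \<Rightarrow> bool" where
  "is_3cnf n F \<longleftrightarrow> (\<forall>C \<in> F. C \<subseteq> {..<n} \<times> UNIV \<and> card C \<le> 3)"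

definition violated :: "literal set set \<Rightarrow> (nat \<Rightarrow> bool) \<Rightarrow> literal set set" where
  "violated F \<alpha> = {C \<in> F. \<forall>(i, b) \<in> C. \<alpha> i \<noteq> b}"

definition max_sat_optimal :: "literal set set \<Rightarrow> (nat \<Rightarrow> bool) \<Rightarrow> bool" where
  "max_sat_optimal F \<alpha> \<longleftrightarrow> is_arg_min (\<lambda>\<beta>. card (violated F \<beta>)) (\<lambda>_. True) \<alpha>"


section \<open>Model of computation\<close>

text \<open>Jones's WHILE language over binary trees, with unit cost per elementary operation. Trees are
  understood as shared pointer structures, and the only test is emptiness, so every operation is a
  constant-time pointer operation. A computation of \<open>T\<close> steps is simulated by a word RAM, and
  conversely (keeping the memory in a binary trie), with overhead polynomial in \<open>log T\<close>. For
  \<open>T = b\<^sup>p \<cdot> n\<^bsup>O(1)\<^esup>\<close> with \<open>p \<le> n\<close> this overhead is polynomial in \<open>n\<close>, so the base \<open>b\<close> has the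
  same meaning in both models; for Turing machines this is not known.\<close>

datatype tree = Nl | Pr tree tree

fun hd_tree :: "tree \<Rightarrow> tree" where
  "hd_tree Nl = Nl"
| "hd_tree (Pr a b) = a"

fun tl_tree :: "tree \<Rightarrow> tree" where
  "tl_tree Nl = Nl"
| "tl_tree (Pr a b) = b"

datatype expr = Var nat | Empty | Join expr expr | Head expr | Tail expr

datatype com =
    Assign nat expr
  | Seq com com
  | Cond expr com com
  | While expr com

type_synonym state = "nat \<Rightarrow> tree"

fun evale :: "expr \<Rightarrow> state \<Rightarrow> tree" where
  "evale (Var x) s = s x"
| "evale Empty s = Nl"
| "evale (Join e f) s = Pr (evale e s) (evale f s)"
| "evale (Head e) s = hd_tree (evale e s)"
| "evale (Tail e) s = tl_tree (evale e s)"

fun cost :: "expr \<Rightarrow> nat" where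
  "cost (Var x) = 1"
| "cost Empty = 1"
| "cost (Join e f) = cost e + cost f + 1"
| "cost (Head e) = cost e + 1"
| "cost (Tail e) = cost e + 1"

text \<open>\<open>exec c s t s'\<close>: started in \<open>s\<close>, the command \<open>c\<close> halts in \<open>s'\<close> after exactly \<open>t\<close> steps.\<close>

inductive exec :: "com \<Rightarrow> state \<Rightarrow> nat \<Rightarrow> state \<Rightarrow> bool" where
  Assign: "exec (Assign x e) s (cost e + 1) (s(x := evale e s))"
| Seq: "exec c s t s' \<Longrightarrow> exec d s' t' s'' \<Longrightarrow> exec (Seq c d) s (t + t') s''"
| CondTrue: "evale e s \<noteq> Nl \<Longrightarrow> exec c s t s' \<Longrightarrow> exec (Cond e c d) s (cost e + 1 + t) s'"
| CondFalse: "evale e s = Nl \<Longrightarrow> exec d s t s' \<Longrightarrow> exec (Cond e c d) s (cost e + 1 + t) s'"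
| WhileFalse: "evale e s = Nl \<Longrightarrow> exec (While e c) s (cost e + 1) s"
| WhileTrue: "evale e s \<noteq> Nl \<Longrightarrow> exec c s t s' \<Longrightarrow> exec (While e c) s' t' s'' \<Longrightarrow>
    exec (While e c) s (cost e + 1 + t + t') s''"

inductive_cases AssignE: "exec (Assign x e) s t s'"
inductive_cases SeqE: "exec (Seq c d) s t s'"
inductive_cases CondE: "exec (Cond e c d) s t s'"
inductive_cases WhileE: "exec (While e c) s t s'"

lemma exec_deterministic:
  "exec c s t s' \<Longrightarrow> exec c s u s'' \<Longrightarrow> t = u \<and> s' = s''"
proof (induction arbitrary: u s'' rule: exec.induct)
  case (Assign x e s)
  from Assign.prems show ?case by (rule AssignE) simp
next
  case (Seq c s t s' d t' s2)
  from Seq.prems show ?case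
  proof (rule SeqE)
    fix v r w
    assume "u = v + w" "exec c s v r" "exec d r w s''"
    with Seq.IH(1)[of v r] Seq.IH(2)[of w s''] show ?thesis by simp
  qed
next
  case (CondTrue e s c t s' d)
  from CondTrue.prems show ?case
  proof (rule CondE)
    fix v
    assume "u = Suc (cost e + v)" "exec c s v s''"
    with CondTrue.IH[of v s''] show ?thesis by simp
  qed (simp add: CondTrue.hyps)
next
  case (CondFalse e s d t s' c)
  from CondFalse.prems show ?case
  proof (rule CondE)
    fix v
    assume "u = Suc (cost e + v)" "exec d s v s''"
    with CondFalse.IH[of v s''] show ?thesis by simp
  qed (simp add: CondFalse.hyps)
next
  case (WhileFalse e s c)
  from WhileFalse.prems show ?case
    by (rule WhileE) (simp_all add: WhileFalse.hyps)
next
  case (WhileTrue e s c t s' t' s2)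
  from WhileTrue.prems show ?case
  proof (rule WhileE)
    fix v r w
    assume "u = Suc (cost e + v + w)" "exec c s v r" "exec (While e c) r w s''"
    with WhileTrue.IH(1)[of v r] WhileTrue.IH(2)[of w s''] show ?thesis by simp
  qed (simp add: WhileTrue.hyps)
qed

text \<open>Input and output are passed in variable \<open>0\<close>; all other variables are initially empty.\<close>

definition computes :: "com \<Rightarrow> tree \<Rightarrow> nat \<Rightarrow> tree \<Rightarrow> bool" where
  "computes c x t y \<longleftrightarrow> (\<exists>s. exec c ((\<lambda>_. Nl)(0 := x)) t s \<and> s 0 = y)"


section \<open>Encodings\<close>

text \<open>Numbers are written in unary. They are only used for indices of variables and for the number
  of variables, so all encodings have size polynomial in the number of variables or vertices.\<close>

definition enc_bool :: "bool \<Rightarrow> tree" where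
  "enc_bool b = (if b then Pr Nl Nl else Nl)"

definition enc_list :: "('a \<Rightarrow> tree) \<Rightarrow> 'a list \<Rightarrow> tree" where
  "enc_list f xs = foldr (\<lambda>x. Pr (f x)) xs Nl"

definition enc_nat :: "nat \<Rightarrow> tree" where
  "enc_nat n = enc_list (\<lambda>_. Nl) [0..<n]"

definition enc_edges :: "nat \<Rightarrow> nat set set \<Rightarrow> tree" where
  "enc_edges n E = enc_list (\<lambda>u. enc_list (\<lambda>v. enc_bool ({u, v} \<in> E)) [0..<n]) [0..<n]"

definition enc_lists :: "nat \<Rightarrow> nat \<Rightarrow> (nat \<Rightarrow> nat set) \<Rightarrow> tree" where
  "enc_lists q n L = enc_list (\<lambda>v. enc_list (\<lambda>i. enc_bool (i \<in> L v)) [1..<Suc q]) [0..<n]"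

definition enc_vertices :: "nat \<Rightarrow> nat set \<Rightarrow> tree" where
  "enc_vertices n Q = enc_list (\<lambda>v. enc_bool (v \<in> Q)) [0..<n]"

definition enc_LED ::
    "nat \<Rightarrow> nat \<Rightarrow> nat set set \<Rightarrow> (nat \<Rightarrow> nat set) \<Rightarrow> nat set \<Rightarrow> tree" where
  "enc_LED q n E L Q = Pr (enc_edges n E) (Pr (enc_lists q n L) (enc_vertices n Q))"

definition lists_cnf :: "literal list list \<Rightarrow> literal set set \<Rightarrow> bool" where
  "lists_cnf cs F \<longleftrightarrow>
     distinct (map set cs) \<and> (\<forall>C \<in> set cs. distinct C) \<and> F = set (map set cs)"

definition enc_cnf :: "nat \<Rightarrow> literal list list \<Rightarrow> tree" where
  "enc_cnf n cs =
     Pr (enc_nat n) (enc_list (enc_list (\<lambda>(i, b). Pr (enc_nat i) (enc_bool b))) cs)"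

definition enc_assignment :: "nat \<Rightarrow> (nat \<Rightarrow> bool) \<Rightarrow> tree" where
  "enc_assignment n \<alpha> = enc_list (\<lambda>i. enc_bool (\<alpha> i)) [0..<n]"


section \<open>Algorithms and the hypothesis M3SH\<close>

text \<open>Instances without any feasible deletion set (some list is empty) must be processed within
  the time bound, but the answer on them is not constrained. The bound \<open>T\<close> takes the size of the
  hub and the number of vertices.\<close>

definition solves_LED_with_hub ::
    "com \<Rightarrow> nat \<Rightarrow> nat \<Rightarrow> nat \<Rightarrow> (nat \<Rightarrow> nat \<Rightarrow> real) \<Rightarrow> bool" where
  "solves_LED_with_hub A q \<sigma> \<delta> T \<longleftrightarrow>
     (\<forall>n E L Q.
        simple_graph {..<n} E \<and> (\<forall>v < n. L v \<subseteq> {1..q}) \<and> is_hub \<sigma> \<delta> {..<n} E Q \<longrightarrow>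
        (\<exists>t y. computes A (enc_LED q n E L Q) t y \<and> real t \<le> T (card Q) n \<and>
           ((\<exists>X. LED_feasible {..<n} E L X) \<longrightarrow>
            (\<exists>X. LED_optimal {..<n} E L X \<and> y = enc_edges n X))))"

definition solves_max_3sat :: "com \<Rightarrow> (nat \<Rightarrow> real) \<Rightarrow> bool" where
  "solves_max_3sat A T \<longleftrightarrow>
     (\<forall>n F cs. is_3cnf n F \<and> lists_cnf cs F \<longrightarrow>
        (\<exists>t y. computes A (enc_cnf n cs) t y \<and> real t \<le> T n \<and>
           (\<exists>\<alpha>. max_sat_optimal F \<alpha> \<and> y = enc_assignment n \<alpha>)))"

text \<open>A factor \<open>n\<^bsup>O(1)\<^esup>\<close> is rendered as \<open>c * (n + 1) ^ d\<close>, which also makes sense for \<open>n \<le> 1\<close>.\<close>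

definition M3SH :: bool where
  "M3SH \<longleftrightarrow>
     \<not> (\<exists>\<epsilon>::real. \<epsilon> > 0 \<and>
          (\<exists>A (c::nat) (d::nat).
             solves_max_3sat A (\<lambda>n. (2 - \<epsilon>) ^ n * (real c * real (n + 1) ^ d))))"

end

theory Submission
  imports Defs
begin

text \<open>
  Split the variables into blocks of a large constant size \<open>\<beta>\<close> and the \<open>2\<^bsup>\<beta>\<^esup>\<close> assignments of a block
  into about \<open>2\<^bsup>\<beta>\<^esup> / q\<close> tables of \<open>q\<close> assignments each. A search program branches over all ways to choose
  one table per block; once the tables are chosen, the assignment of a block is one of \<open>q\<close> values and
  becomes the colour of a single hub vertex, so the hub has about \<open>n / \<beta>\<close> vertices. A clause depends on
  at most three blocks. For every triple \<open>s\<close> of colours it receives a gadget of eight vertices whose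
  cheapest deletion set has 4 edges, or 5 if the colours of the three blocks are \<open>s\<close> and falsify
  the clause. Hence an optimal deletion set counts the violated clauses, and pendant vertices with
  singleton lists make it reveal the hub colours. If the instances are solved with base \<open>b < q\<close>, the total
  time is \<open>(2\<^bsup>\<beta>\<^esup> / q + 1)\<^bsup>n / \<beta>\<^esup> \<cdot> b\<^bsup>n / \<beta>\<^esup>\<close> up to a polynomial factor, and for large \<open>\<beta>\<close> this has
  base less than 2 in \<open>n\<close>. Tables are needed instead of several hub vertices per block because the
  component size and the three neighbours must not depend on \<open>\<epsilon>\<close>.
\<close>

section \<open>Running programs as subroutines\<close>

text \<open>Each colour triple gets its own gadget so that the component size does not depend on
  \<open>q\<close>: a gadget only has to recognise one triple. The hub shows exactly one triple per
  clause, so at most one gadget of a clause exceeds its minimum, and the clause costs add up. The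
  excess must be the same for every falsified clause, otherwise a deletion set would weight the
  clauses. A \<open>K\<^sub>5\<close> with all literals false costs at least 6 instead of 4, but
  giving up one forcing edge raises the total only to 5, so the excess is exactly 1. The remaining
  cost depends only on the formula and on the number of blocks, hence edge counts from different
  choices of tables can be compared. Rounding \<open>2 ^ \<beta> / q\<close> up to a whole number of
  tables costs a term \<open>b\<close> per block, which the slack
  \<open>2 ^ \<beta> * (1 - b / q)\<close> covers once \<open>\<beta>\<close> is large. The
  reduction has to be an actual program, so its functions are assembled from combinators that carry
  programs, times and sizes along.\<close>

fun evars :: "expr \<Rightarrow> nat set" where
  "evars (Var x) = {x}"
| "evars Empty = {}"
| "evars (Join e f) = evars e \<union> evars f"
| "evars (Head e) = evars e"
| "evars (Tail e) = evars e"

fun cvars :: "com \<Rightarrow> nat set" where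
  "cvars (Assign x e) = insert x (evars e)"
| "cvars (Seq c d) = cvars c \<union> cvars d"
| "cvars (Cond e c d) = evars e \<union> cvars c \<union> cvars d"
| "cvars (While e c) = evars e \<union> cvars c"

lemma evale_cong: "(\<And>x. x \<in> evars e \<Longrightarrow> s x = s' x) \<Longrightarrow> evale e s = evale e s'"
  by (induction e) auto

lemma finite_evars: "finite (evars e)"
  by (induction e) auto

lemma finite_cvars: "finite (cvars c)"
  by (induction c) (auto simp: finite_evars)

text \<open>Bridges \<open>computes\<close>, whose initial state is empty apart from the input, and
  \<open>runs\<close>, whose caller may keep data in other variables: a command neither reads nor
  writes outside its own variables, so a run can be replayed in any state that agrees on
  them.\<close>

lemma exec_frame:
  "exec c s t s' \<Longrightarrow> cvars c \<subseteq> W \<Longrightarrow> (\<And>x. x \<in> W \<Longrightarrow> r x = s x) \<Longrightarrow>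
    exec c r t (\<lambda>x. if x \<in> W then s' x else r x)"
proof (induction arbitrary: r rule: exec.induct)
  case (Assign x e s)
  have "evale e r = evale e s"
    using Assign by (intro evale_cong) auto
  moreover have "(\<lambda>y. if y \<in> W then (s(x := evale e s)) y else r y) = r(x := evale e s)"
    using Assign by auto
  ultimately show ?case
    using exec.Assign[of x e r] by simp
next
  case (Seq c s t s' d t' s'')
  let ?r' = "\<lambda>x. if x \<in> W then s' x else r x"
  have 1: "exec c r t ?r'"
    using Seq by auto
  have "exec d ?r' t' (\<lambda>x. if x \<in> W then s'' x else ?r' x)"
    using Seq by (intro Seq.IH(2)) auto
  moreover have "(\<lambda>x. if x \<in> W then s'' x else ?r' x) = (\<lambda>x. if x \<in> W then s'' x else r x)"
    by auto
  ultimately show ?case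
    using exec.Seq[OF 1] by simp
next
  case (CondTrue e s c t s' d)
  have "evale e r = evale e s"
    using CondTrue by (intro evale_cong) auto
  then show ?case
    using CondTrue by (intro exec.CondTrue) auto
next
  case (CondFalse e s d t s' c)
  have "evale e r = evale e s"
    using CondFalse by (intro evale_cong) auto
  then show ?case
    using CondFalse by (intro exec.CondFalse) auto
next
  case (WhileFalse e s c)
  have "evale e r = evale e s"
    using WhileFalse by (intro evale_cong) auto
  moreover have "(\<lambda>x. if x \<in> W then s x else r x) = r"
    using WhileFalse by auto
  ultimately show ?case
    using WhileFalse exec.WhileFalse[of e r c] by simp
next
  case (WhileTrue e s c t s' t' s'')
  let ?r' = "\<lambda>x. if x \<in> W then s' x else r x"
  have e: "evale e r = evale e s"
    using WhileTrue by (intro evale_cong) auto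
  have 1: "exec c r t ?r'"
    using WhileTrue by auto
  have "exec (While e c) ?r' t' (\<lambda>x. if x \<in> W then s'' x else ?r' x)"
    using WhileTrue by (intro WhileTrue.IH(2)) auto
  moreover have "(\<lambda>x. if x \<in> W then s'' x else ?r' x) = (\<lambda>x. if x \<in> W then s'' x else r x)"
    by auto
  ultimately show ?case
    using exec.WhileTrue[OF _ 1] WhileTrue e by simp
qed

text \<open>Variable 0 holds the input and the output. The variables below \<open>m\<close> are scratch space, empty before
  and after the run; all others are untouched, so programs can be composed without renaming.\<close>

definition runs :: "com \<Rightarrow> nat \<Rightarrow> tree \<Rightarrow> nat \<Rightarrow> tree \<Rightarrow> bool" where
  "runs c m x t y \<longleftrightarrow> 0 < m \<and>
     (\<forall>s. s 0 = x \<longrightarrow> (\<forall>i. 0 < i \<longrightarrow> i < m \<longrightarrow> s i = Nl) \<longrightarrow>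
        (\<exists>t'\<le>t. exec c s t' (s(0 := y))))"

lemma runsI:
  assumes "0 < m"
    and "\<And>s. s 0 = x \<Longrightarrow> \<forall>i. 0 < i \<longrightarrow> i < m \<longrightarrow> s i = Nl \<Longrightarrow> \<exists>t'\<le>t. exec c s t' (s(0 := y))"
  shows "runs c m x t y"
  using assms by (auto simp: runs_def)

lemma runsD:
  "runs c m x t y \<Longrightarrow> s 0 = x \<Longrightarrow> \<forall>i. 0 < i \<longrightarrow> i < m \<longrightarrow> s i = Nl \<Longrightarrow>
    \<exists>t'\<le>t. exec c s t' (s(0 := y))"
  by (simp add: runs_def)

lemma runs_pos: "runs c m x t y \<Longrightarrow> 0 < m"
  by (simp add: runs_def)

lemma runs_mono:
  assumes "runs c m x t y" "m \<le> m'" "t \<le> t'"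
  shows "runs c m' x t' y"
proof (rule runsI)
  show "0 < m'"
    using assms runs_pos by fastforce
next
  fix s :: state
  assume "s 0 = x" "\<forall>i. 0 < i \<longrightarrow> i < m' \<longrightarrow> s i = Nl"
  then obtain u where "u \<le> t" "exec c s u (s(0 := y))"
    using assms(2) runsD[OF assms(1), of s] by (meson less_le_trans)
  then show "\<exists>u\<le>t'. exec c s u (s(0 := y))"
    using assms(3) by (meson le_trans)
qed

lemma runs_Assign:
  assumes "evars e \<subseteq> {0}" "0 < m"
  shows "runs (Assign 0 e) m x (cost e + 1) (evale e (\<lambda>_. x))"
proof (rule runsI)
  fix s :: state
  assume "s 0 = x"
  then have "evale e s = evale e (\<lambda>_. x)"
    using assms by (intro evale_cong) auto
  then show "\<exists>t'\<le>cost e + 1. exec (Assign 0 e) s t' (s(0 := evale e (\<lambda>_. x)))"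
    using exec.Assign[of 0 e s] by auto
qed fact

lemma runs_Seq:
  assumes c: "runs c m x t y" and d: "runs d m y t' z"
  shows "runs (Seq c d) m x (t + t') z"
proof (rule runsI)
  show "0 < m"
    using c runs_pos by blast
  fix s :: state
  assume s: "s 0 = x" "\<forall>i. 0 < i \<longrightarrow> i < m \<longrightarrow> s i = Nl"
  obtain u where u: "u \<le> t" "exec c s u (s(0 := y))"
    using runsD[OF c s] by blast
  have "\<forall>i. 0 < i \<longrightarrow> i < m \<longrightarrow> (s(0 := y)) i = Nl"
    using s by auto
  then obtain v where v: "v \<le> t'" "exec d (s(0 := y)) v (s(0 := z))"
    using runsD[OF d, of "s(0 := y)"] by auto
  show "\<exists>u\<le>t + t'. exec (Seq c d) s u (s(0 := z))"
    using exec.Seq[OF u(2) v(2)] u(1) v(1) by (metis add_mono)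
qed

lemma runs_Cond:
  assumes e: "evars e \<subseteq> {0}"
    and c: "evale e (\<lambda>_. x) \<noteq> Nl \<Longrightarrow> runs c m x t y"
    and d: "evale e (\<lambda>_. x) = Nl \<Longrightarrow> runs d m x t y"
  shows "runs (Cond e c d) m x (cost e + 1 + t) y"
proof (rule runsI)
  show "0 < m"
    using c d runs_pos by blast
  fix s :: state
  assume s: "s 0 = x" "\<forall>i. 0 < i \<longrightarrow> i < m \<longrightarrow> s i = Nl"
  have ev: "evale e s = evale e (\<lambda>_. x)"
    using s(1) e by (intro evale_cong) auto
  show "\<exists>t'\<le>cost e + 1 + t. exec (Cond e c d) s t' (s(0 := y))"
  proof (cases "evale e s = Nl")
    case True
    then obtain u where "u \<le> t" "exec d s u (s(0 := y))"
      using runsD[OF d, of s] s ev by metis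
    then show ?thesis
      using exec.CondFalse[OF True, of d u "s(0 := y)" c] by (intro exI[of _ "cost e + 1 + u"]) auto
  next
    case False
    then obtain u where "u \<le> t" "exec c s u (s(0 := y))"
      using runsD[OF c, of s] s ev by metis
    then show ?thesis
      using exec.CondTrue[OF False, of c u "s(0 := y)" d] by (intro exI[of _ "cost e + 1 + u"]) auto
  qed
qed

lemma runs_While_stop:
  assumes e: "evars e \<subseteq> {0}" and "evale e (\<lambda>_. x) = Nl" "0 < m"
  shows "runs (While e c) m x (cost e + 1) x"
proof (rule runsI)
  fix s :: state
  assume s: "s 0 = x"
  have "evale e s = evale e (\<lambda>_. x)"
    using s e by (intro evale_cong) auto
  moreover have "s(0 := x) = s"
    using s by auto
  ultimately show "\<exists>t'\<le>cost e + 1. exec (While e c) s t' (s(0 := x))"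
    using exec.WhileFalse[of e s c] assms by auto
qed fact

lemma runs_While_step:
  assumes e: "evars e \<subseteq> {0}" and nz: "evale e (\<lambda>_. x) \<noteq> Nl"
    and c: "runs c m x t y" and d: "runs (While e c) m y t' z"
  shows "runs (While e c) m x (cost e + 1 + t + t') z"
proof (rule runsI)
  show "0 < m"
    using c runs_pos by blast
  fix s :: state
  assume s: "s 0 = x" "\<forall>i. 0 < i \<longrightarrow> i < m \<longrightarrow> s i = Nl"
  have ev: "evale e s \<noteq> Nl"
    using nz s(1) e by (subst evale_cong[of e s "\<lambda>_. x"]) auto
  obtain u where u: "u \<le> t" "exec c s u (s(0 := y))"
    using runsD[OF c s] by blast
  have "\<forall>i. 0 < i \<longrightarrow> i < m \<longrightarrow> (s(0 := y)) i = Nl"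
    using s by auto
  then obtain v where v: "v \<le> t'" "exec (While e c) (s(0 := y)) v (s(0 := z))"
    using runsD[OF d, of "s(0 := y)"] by auto
  show "\<exists>u\<le>cost e + 1 + t + t'. exec (While e c) s u (s(0 := z))"
    using exec.WhileTrue[OF ev u(2) v(2)] u(1) v(1)
    by (intro exI[of _ "cost e + 1 + u + v"]) auto
qed

text \<open>The language has no skip, so the base case assigns variable 0 to itself.\<close>

fun clear :: "nat \<Rightarrow> com" where
  "clear 0 = Assign 0 (Var 0)"
| "clear (Suc k) = Seq (clear k) (Assign (Suc k) Empty)"

lemma exec_clear: "exec (clear k) s (2 * k + 2) (\<lambda>x. if 0 < x \<and> x \<le> k then Nl else s x)"
proof (induction k)
  case 0
  show ?case
    proof -
    have "(\<lambda>x. if 0 < x \<and> x \<le> 0 then Nl else s x) = s(0 := evale (Var 0) s)"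
      by (auto simp: fun_eq_iff)
    then show ?thesis
      using exec.Assign[of 0 "Var 0" s] by (simp add: numeral_2_eq_2)
  qed
next
  case (Suc k)
  let ?r = "\<lambda>x. if 0 < x \<and> x \<le> k then Nl else s x"
  have "exec (Assign (Suc k) Empty) ?r 2 (?r(Suc k := Nl))"
    using exec.Assign[of "Suc k" Empty ?r] by (simp add: numeral_2_eq_2)
  moreover have "?r(Suc k := Nl) = (\<lambda>x. if 0 < x \<and> x \<le> Suc k then Nl else s x)"
    by (auto simp: le_Suc_eq)
  ultimately show ?case
    using exec.Seq[OF Suc.IH] by fastforce
qed

text \<open>\<open>computes\<close> leaves the other variables in an unknown state. Clearing every
  variable up to the largest one occurring in \<open>A\<close> restores empty scratch space at a
  constant extra cost \<open>k\<close>.\<close>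

lemma runs_subroutine:
  obtains c m k where "0 < m" "\<And>x t y. computes A x t y \<Longrightarrow> runs c m x (t + k) y"
proof -
  define b where "b = Max (insert 0 (cvars A))"
  let ?W = "{..b}"
  have W: "cvars A \<subseteq> ?W"
    using finite_cvars by (auto simp: b_def)
  have "runs (Seq A (clear b)) (Suc b) x (t + (2 * b + 2)) y" if comp: "computes A x t y" for x t y
  proof (rule runsI)
    fix s :: state
    assume s: "s 0 = x" "\<forall>i. 0 < i \<longrightarrow> i < Suc b \<longrightarrow> s i = Nl"
    obtain s' where s': "exec A ((\<lambda>_. Nl)(0 := x)) t s'" "s' 0 = y"
      using comp by (auto simp: computes_def)
    have "exec A s t (\<lambda>x. if x \<in> ?W then s' x else s x)"
      using s by (intro exec_frame[OF s'(1) W]) (auto simp: less_Suc_eq_le)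
    from exec.Seq[OF this exec_clear[of b]]
    have "exec (Seq A (clear b)) s (t + (2 * b + 2))
      (\<lambda>x. if 0 < x \<and> x \<le> b then Nl else if x \<in> ?W then s' x else s x)" .
    also have "(\<lambda>x. if 0 < x \<and> x \<le> b then Nl else if x \<in> ?W then s' x else s x) = s(0 := y)"
      using s s' by (auto simp: fun_eq_iff)
    finally show "\<exists>t'\<le>t + (2 * b + 2). exec (Seq A (clear b)) s t' (s(0 := y))"
      by blast
  qed simp
  then show thesis
    by (intro that[of "Suc b" "Seq A (clear b)" "2 * b + 2"]) auto
qed

text \<open>Both subprograms receive the same input. Variable \<open>m\<close> keeps it and
  \<open>Suc m\<close> keeps the first result; both lie outside the scratch space below
  \<open>m\<close>, so they survive the runs of \<open>c\<close> and \<open>d\<close>.\<close>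

definition pair_com :: "nat \<Rightarrow> com \<Rightarrow> com \<Rightarrow> com" where
  "pair_com m c d =
     Seq (Assign m (Var 0)) (Seq c (Seq (Assign (Suc m) (Var 0)) (Seq (Assign 0 (Var m)) (Seq d
       (Seq (Assign 0 (Join (Var (Suc m)) (Var 0))) (Seq (Assign m Empty) (Assign (Suc m) Empty)))))))"

lemma runs_pair:
  assumes c: "runs c m x t y" and d: "runs d m x t' z"
  shows "runs (pair_com m c d) (m + 2) x (t + t' + 14) (Pr y z)"
proof (rule runsI)
  fix s :: state
  assume s: "s 0 = x" "\<forall>i. 0 < i \<longrightarrow> i < m + 2 \<longrightarrow> s i = Nl"
  have m: "0 < m"
    using c runs_pos by blast
  let ?s1 = "s(m := x)"
  let ?s2 = "s(m := x, 0 := y)"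
  let ?s3 = "s(m := x, 0 := y, Suc m := y)"
  let ?s4 = "s(m := x, 0 := x, Suc m := y)"
  let ?s5 = "s(m := x, 0 := z, Suc m := y)"
  let ?s6 = "s(m := x, 0 := Pr y z, Suc m := y)"
  let ?s7 = "s(m := Nl, 0 := Pr y z, Suc m := y)"
  let ?s8 = "s(m := Nl, 0 := Pr y z, Suc m := Nl)"
  have 1: "exec (Assign m (Var 0)) s 2 ?s1"
    using exec.Assign[of m "Var 0" s] s by (simp add: numeral_2_eq_2)
  obtain u where u: "u \<le> t" "exec c ?s1 u ?s2"
    using s m runsD[OF c, of ?s1] by auto
  have 3: "exec (Assign (Suc m) (Var 0)) ?s2 2 ?s3"
    using exec.Assign[of "Suc m" "Var 0" ?s2] m by (simp add: numeral_2_eq_2)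
  have 4: "exec (Assign 0 (Var m)) ?s3 2 ?s4"
    using exec.Assign[of 0 "Var m" ?s3] m by (simp add: numeral_2_eq_2 fun_upd_twist[of 0 "Suc m"])
  obtain v where v: "v \<le> t'" "exec d ?s4 v (?s4(0 := z))"
    using s m runsD[OF d, of ?s4] by auto
  have e5: "?s4(0 := z) = ?s5"
    by (auto simp: fun_eq_iff)
  have 6: "exec (Assign 0 (Join (Var (Suc m)) (Var 0))) ?s5 4 (?s5(0 := Pr y z))"
    using exec.Assign[of 0 "Join (Var (Suc m)) (Var 0)" ?s5] m by (simp add: eval_nat_numeral)
  have e6: "?s5(0 := Pr y z) = ?s6"
    by (auto simp: fun_eq_iff)
  have 7: "exec (Assign m Empty) ?s6 2 (?s6(m := Nl))"
    using exec.Assign[of m Empty ?s6] by (simp add: eval_nat_numeral)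
  have e7: "?s6(m := Nl) = ?s7"
    using m by (auto simp: fun_eq_iff)
  have 8: "exec (Assign (Suc m) Empty) ?s7 2 (?s7(Suc m := Nl))"
    using exec.Assign[of "Suc m" Empty ?s7] by (simp add: eval_nat_numeral)
  have e8: "?s7(Suc m := Nl) = s(0 := Pr y z)"
    using m s(2)[rule_format, of m] s(2)[rule_format, of "Suc m"] by (auto simp: fun_eq_iff)
  have "exec (pair_com m c d) s (2 + (u + (2 + (2 + (v + (4 + (2 + 2))))))) (s(0 := Pr y z))"
    unfolding pair_com_def
    using exec.Seq[OF 1 exec.Seq[OF u(2) exec.Seq[OF 3 exec.Seq[OF 4
      exec.Seq[OF v(2)[unfolded e5] exec.Seq[OF 6[unfolded e6] exec.Seq[OF 7[unfolded e7]
        8[unfolded e8]]]]]]]] .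
  moreover have "2 + (u + (2 + (2 + (v + (4 + (2 + 2)))))) \<le> t + t' + 14"
    using u(1) v(1) by simp
  ultimately show "\<exists>ta\<le>t + t' + 14. exec (pair_com m c d) s ta (s(0 := Pr y z))"
    by blast
qed simp

section \<open>Trees as lists and loops over them\<close>

fun elems :: "tree \<Rightarrow> tree list" where
  "elems Nl = []"
| "elems (Pr a b) = a # elems b"

abbreviation len :: "tree \<Rightarrow> nat" where
  "len t \<equiv> length (elems t)"

lemma enc_list_simps [simp]:
  "enc_list f [] = Nl" "enc_list f (x # xs) = Pr (f x) (enc_list f xs)"
  by (simp_all add: enc_list_def)

lemma elems_enc_list [simp]: "elems (enc_list f xs) = map f xs"
  by (induction xs) auto

lemma enc_list_elems [simp]: "enc_list (\<lambda>x. x) (elems t) = t"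
  by (induction t) auto

text \<open>A program sees its input only in variable 0, so environment, list element and
  accumulator are packed into it. The environment itself stays in \<open>m\<close>, the rest of the
  list in \<open>Suc m\<close>.\<close>

definition fold_body :: "nat \<Rightarrow> com \<Rightarrow> com" where
  "fold_body m c = Seq (Assign 0 (Join (Var m) (Join (Head (Var (Suc m))) (Var 0))))
       (Seq c (Assign (Suc m) (Tail (Var (Suc m)))))"

definition fold_com :: "nat \<Rightarrow> com \<Rightarrow> com" where
  "fold_com m c =
     Seq (Assign m (Head (Var 0))) (Seq (Assign (Suc m) (Head (Tail (Var 0))))
       (Seq (Assign 0 (Tail (Tail (Var 0)))) (Seq (While (Var (Suc m)) (fold_body m c))
         (Assign m Empty))))"

text \<open>The assumption on \<open>c\<close> covers only the accumulators that arise in this run.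
  A single time bound \<open>t\<close> exists for these, whereas over all accumulators there would
  in general be none.\<close>

lemma exec_fold_loop:
  fixes F :: "tree \<Rightarrow> tree \<Rightarrow> tree \<Rightarrow> tree"
  assumes "\<And>j. j < len l \<Longrightarrow>
      runs c m (Pr e (Pr (elems l ! j) (foldl (F e) a (take j (elems l))))) t
        (F e (foldl (F e) a (take j (elems l))) (elems l ! j))"
    and "0 < m" "s 0 = a" "s m = e" "s (Suc m) = l" "\<And>i. 0 < i \<Longrightarrow> i < m \<Longrightarrow> s i = Nl"
  shows "\<exists>t'\<le>2 + len l * (t + 12).
    exec (While (Var (Suc m)) (fold_body m c)) s t' (s(0 := foldl (F e) a (elems l), Suc m := Nl))"
  using assms
proof (induction l arbitrary: s a)
  case Nl
  then have "s(0 := foldl (F e) a (elems Nl), Suc m := Nl) = s"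
    by (auto simp: fun_eq_iff)
  moreover have "exec (While (Var (Suc m)) (fold_body m c)) s 2 s"
    using exec.WhileFalse[of "Var (Suc m)" s "fold_body m c"] Nl by (simp add: numeral_2_eq_2)
  ultimately show ?case
    by (metis le_add1)
next
  case (Pr y l')
  let ?b = "F e a y"
  let ?s1 = "s(0 := Pr e (Pr y a))"
  let ?s2 = "s(0 := ?b)"
  let ?s3 = "s(0 := ?b, Suc m := l')"
  have "exec (Assign 0 (Join (Var m) (Join (Head (Var (Suc m))) (Var 0)))) s 7 ?s1"
    using exec.Assign[of 0 "Join (Var m) (Join (Head (Var (Suc m))) (Var 0))" s] Pr.prems
    by (simp add: eval_nat_numeral)
  note 1 = this
  have r: "runs c m (Pr e (Pr y a)) t ?b"
    using Pr.prems(1)[of 0] by simp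
  obtain u where u: "u \<le> t" "exec c ?s1 u ?s2"
    using Pr.prems runsD[OF r, of ?s1] by auto
  have 3: "exec (Assign (Suc m) (Tail (Var (Suc m)))) ?s2 3 ?s3"
    using exec.Assign[of "Suc m" "Tail (Var (Suc m))" ?s2] Pr.prems by (simp add: eval_nat_numeral)
  have 4: "exec (fold_body m c) s (7 + (u + 3)) ?s3"
    unfolding fold_body_def using exec.Seq[OF 1 exec.Seq[OF u(2) 3]] .
  have "\<exists>t'\<le>2 + length (elems l') * (t + 12).
    exec (While (Var (Suc m)) (fold_body m c)) ?s3 t'
      (?s3(0 := foldl (F e) ?b (elems l'), Suc m := Nl))"
  proof (rule Pr.IH(2))
    fix j assume "j < length (elems l')"
    then show "runs c m (Pr e (Pr (elems l' ! j) (foldl (F e) ?b (take j (elems l'))))) t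
        (F e (foldl (F e) ?b (take j (elems l'))) (elems l' ! j))"
      using Pr.prems(1)[of "Suc j"] by simp
  qed (use Pr.prems in auto)
  then obtain v where v: "v \<le> 2 + length (elems l') * (t + 12)"
    "exec (While (Var (Suc m)) (fold_body m c)) ?s3 v
      (?s3(0 := foldl (F e) ?b (elems l'), Suc m := Nl))"
    by blast
  have "?s3(0 := foldl (F e) ?b (elems l'), Suc m := Nl) =
    s(0 := foldl (F e) a (elems (Pr y l')), Suc m := Nl)"
    by (auto simp: fun_eq_iff)
  then have "exec (While (Var (Suc m)) (fold_body m c)) s (cost (Var (Suc m)) + 1 + (7 + (u + 3)) + v)
      (s(0 := foldl (F e) a (elems (Pr y l')), Suc m := Nl))"
    using exec.WhileTrue[OF _ 4 v(2)] Pr.prems(5) by simp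
  moreover have "cost (Var (Suc m)) + 1 + (7 + (u + 3)) + v \<le> 2 + len (Pr y l') * (t + 12)"
    using u(1) v(1) by simp
  ultimately show ?case
    by blast
qed

lemma runs_fold:
  fixes F :: "tree \<Rightarrow> tree \<Rightarrow> tree \<Rightarrow> tree"
  assumes c: "\<And>j. j < len l \<Longrightarrow>
      runs c m (Pr e (Pr (elems l ! j) (foldl (F e) a (take j (elems l))))) t
        (F e (foldl (F e) a (take j (elems l))) (elems l ! j))"
    and m: "0 < m"
  shows "runs (fold_com m c) (m + 2) (Pr e (Pr l a)) (15 + len l * (t + 12))
    (foldl (F e) a (elems l))"
proof (rule runsI)
  fix s :: state
  assume s: "s 0 = Pr e (Pr l a)" "\<forall>i. 0 < i \<longrightarrow> i < m + 2 \<longrightarrow> s i = Nl"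
  let ?z = "foldl (F e) a (elems l)"
  let ?s1 = "s(m := e)"
  let ?s2 = "s(m := e, Suc m := l)"
  let ?s3 = "s(m := e, Suc m := l, 0 := a)"
  have 1: "exec (Assign m (Head (Var 0))) s 3 ?s1"
    using exec.Assign[of m "Head (Var 0)" s] s by (simp add: eval_nat_numeral)
  have 2: "exec (Assign (Suc m) (Head (Tail (Var 0)))) ?s1 4 ?s2"
    using exec.Assign[of "Suc m" "Head (Tail (Var 0))" ?s1] s m by (simp add: eval_nat_numeral)
  have 3: "exec (Assign 0 (Tail (Tail (Var 0)))) ?s2 4 ?s3"
    using exec.Assign[of 0 "Tail (Tail (Var 0))" ?s2] s m by (simp add: eval_nat_numeral)
  have "\<exists>t'\<le>2 + len l * (t + 12).
    exec (While (Var (Suc m)) (fold_body m c)) ?s3 t' (?s3(0 := ?z, Suc m := Nl))"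
    using c m s by (intro exec_fold_loop) auto
  then obtain v where v: "v \<le> 2 + len l * (t + 12)"
    "exec (While (Var (Suc m)) (fold_body m c)) ?s3 v (?s3(0 := ?z, Suc m := Nl))"
    by blast
  have 5: "exec (Assign m Empty) (?s3(0 := ?z, Suc m := Nl)) 2 (?s3(0 := ?z, Suc m := Nl, m := Nl))"
    using exec.Assign[of m Empty "?s3(0 := ?z, Suc m := Nl)"] by (simp add: eval_nat_numeral)
  have e5: "?s3(0 := ?z, Suc m := Nl, m := Nl) = s(0 := ?z)"
    using m s(2)[rule_format, of m] s(2)[rule_format, of "Suc m"] by (auto simp: fun_eq_iff)
  have "exec (fold_com m c) s (3 + (4 + (4 + (v + 2)))) (s(0 := ?z))"
    unfolding fold_com_def
    using exec.Seq[OF 1 exec.Seq[OF 2 exec.Seq[OF 3 exec.Seq[OF v(2) 5[unfolded e5]]]]] .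
  moreover have "3 + (4 + (4 + (v + 2))) \<le> 15 + len l * (t + 12)"
    using v(1) by simp
  ultimately show "\<exists>t'\<le>15 + len l * (t + 12). exec (fold_com m c) s t' (s(0 := ?z))"
    by blast
qed simp

section \<open>Polynomial-time functions on trees\<close>

text \<open>With a base of at least 2, one exponent absorbs constants, sums and products. The
  measure is a parameter because the same calculus serves tree sizes and, in the final time bound,
  the number of variables.\<close>

definition poly_bd :: "('a \<Rightarrow> nat) \<Rightarrow> ('a \<Rightarrow> nat) \<Rightarrow> bool" where
  "poly_bd \<mu> h \<longleftrightarrow> (\<exists>d. \<forall>x. h x \<le> (\<mu> x + 2) ^ d)"

lemma poly_bdE:
  assumes "poly_bd \<mu> h"
  obtains d where "\<And>x. h x \<le> (\<mu> x + 2) ^ d"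
  using assms by (auto simp: poly_bd_def)

lemma poly_bd_mono: "poly_bd \<mu> h \<Longrightarrow> (\<And>x. g x \<le> h x) \<Longrightarrow> poly_bd \<mu> g"
  unfolding poly_bd_def by (meson le_trans)

lemma poly_bd_const: "poly_bd \<mu> (\<lambda>_. k)"
proof -
  have "k \<le> (\<mu> x + 2) ^ k" for x
    using power_mono[of 2 "\<mu> x + 2" k] less_exp[of k] by linarith
  then show ?thesis
    unfolding poly_bd_def by blast
qed

lemma poly_bd_measure: "poly_bd \<mu> \<mu>"
  unfolding poly_bd_def by (rule exI[of _ 1]) simp

lemma poly_bd_mult:
  assumes "poly_bd \<mu> f" "poly_bd \<mu> g"
  shows "poly_bd \<mu> (\<lambda>x. f x * g x)"
proof -
  obtain a b where "\<And>x. f x \<le> (\<mu> x + 2) ^ a" "\<And>x. g x \<le> (\<mu> x + 2) ^ b"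
    using assms by (meson poly_bdE)
  then have "f x * g x \<le> (\<mu> x + 2) ^ (a + b)" for x
    by (simp add: power_add mult_mono)
  then show ?thesis
    by (auto simp: poly_bd_def)
qed

lemma poly_bd_add:
  assumes "poly_bd \<mu> f" "poly_bd \<mu> g"
  shows "poly_bd \<mu> (\<lambda>x. f x + g x)"
proof -
  have "poly_bd \<mu> (\<lambda>x. (f x + 1) * (g x + 1))"
  proof -
    have *: "poly_bd \<mu> (\<lambda>x. h x + 1)" if "poly_bd \<mu> h" for h
    proof -
      obtain d where d: "\<And>x. h x \<le> (\<mu> x + 2) ^ d"
        using poly_bdE \<open>poly_bd \<mu> h\<close> by metis
      have "h x + 1 \<le> (\<mu> x + 2) ^ (Suc d)" for x
      proof -
        have "1 \<le> (\<mu> x + 2) ^ d"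
          by simp
        then have "h x + 1 \<le> 2 * (\<mu> x + 2) ^ d"
          using d[of x] by linarith
        then show ?thesis
          by (simp add: algebra_simps)
      qed
      then show ?thesis
        unfolding poly_bd_def by blast
    qed
    show ?thesis
      using assms by (intro poly_bd_mult *)
  qed
  then show ?thesis
    by (rule poly_bd_mono) (simp add: algebra_simps)
qed

lemma poly_bd_power: "poly_bd \<mu> f \<Longrightarrow> poly_bd \<mu> (\<lambda>x. f x ^ k)"
  by (induction k) (auto intro: poly_bd_mult poly_bd_const simp del: One_nat_def)

lemma poly_bd_compose:
  assumes "poly_bd \<mu> h" "poly_bd \<nu> (\<lambda>x. \<mu> (f x))"
  shows "poly_bd \<nu> (\<lambda>x. h (f x))"
proof -
  obtain d where d: "\<And>x. h x \<le> (\<mu> x + 2) ^ d"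
    using assms(1) by (rule poly_bdE) blast
  have "poly_bd \<nu> (\<lambda>x. (\<mu> (f x) + 2) ^ d)"
    by (intro poly_bd_power poly_bd_add assms poly_bd_const)
  then show ?thesis
    by (rule poly_bd_mono) (rule d)
qed

lemmas poly_bd_intros = poly_bd_const poly_bd_measure poly_bd_add poly_bd_mult poly_bd_power

text \<open>The size of the result has to be bounded as well: trees are shared, so the size of a result can be
  exponential in the time.\<close>

definition polytime :: "(tree \<Rightarrow> tree) \<Rightarrow> bool" where
  "polytime f \<longleftrightarrow> (\<exists>c m t. (\<forall>x. runs c m x (t x) (f x)) \<and> poly_bd size t \<and> poly_bd size (\<lambda>x. size (f x)))"

lemma polytimeI:
  assumes "\<And>x. runs c m x (t x) (f x)" "poly_bd size t" "poly_bd size (\<lambda>x. size (f x))"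
  shows "polytime f"
  using assms unfolding polytime_def by blast

lemma polytimeE:
  assumes "polytime f"
  obtains c m t where "\<And>x. runs c m x (t x) (f x)" "poly_bd size t" "poly_bd size (\<lambda>x. size (f x))"
  using assms unfolding polytime_def by blast

lemma polytime_size: "polytime f \<Longrightarrow> poly_bd size (\<lambda>x. size (f x))"
  by (auto elim: polytimeE)

lemma polytime_expr:
  assumes "evars e \<subseteq> {0}" "poly_bd size (\<lambda>x. size (evale e (\<lambda>_. x)))"
  shows "polytime (\<lambda>x. evale e (\<lambda>_. x))"
  using assms by (intro polytimeI[where m = 1, OF runs_Assign]) (auto intro: poly_bd_const)

lemma polytime_id: "polytime (\<lambda>x. x)"
  using polytime_expr[of "Var 0"] by (simp add: poly_bd_measure)

lemma polytime_Nl: "polytime (\<lambda>x. Nl)"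
  using polytime_expr[of Empty] by (simp add: poly_bd_const)

lemma polytime_compose:
  assumes "polytime g" "polytime f"
  shows "polytime (\<lambda>x. g (f x))"
proof -
  obtain c m t where c: "\<And>x. runs c m x (t x) (f x)" "poly_bd size t"
    using assms by (meson polytimeE)
  obtain d k u where d: "\<And>x. runs d k x (u x) (g x)" "poly_bd size u"
    using assms by (meson polytimeE)
  show ?thesis
  proof (rule polytimeI)
    show "runs (Seq c d) (max m k) x (t x + u (f x)) (g (f x))" for x
      by (rule runs_Seq[OF runs_mono[OF c(1)] runs_mono[OF d(1)]]) auto
    show "poly_bd size (\<lambda>x. t x + u (f x))"
      by (intro poly_bd_add c poly_bd_compose[OF d(2)] polytime_size assms)
    show "poly_bd size (\<lambda>x. size (g (f x)))"
      by (intro poly_bd_compose[OF polytime_size[OF assms(1)]] polytime_size assms)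
  qed
qed

lemma polytime_hd: "polytime f \<Longrightarrow> polytime (\<lambda>x. hd_tree (f x))"
proof (rule polytime_compose[of hd_tree])
  have "size (hd_tree x) \<le> size x" for x
    by (cases x) auto
  then show "polytime hd_tree"
    using polytime_expr[of "Head (Var 0)"] by (simp add: poly_bd_mono[OF poly_bd_measure])
qed

lemma polytime_tl: "polytime f \<Longrightarrow> polytime (\<lambda>x. tl_tree (f x))"
proof (rule polytime_compose[of tl_tree])
  have "size (tl_tree x) \<le> size x" for x
    by (cases x) auto
  then show "polytime tl_tree"
    using polytime_expr[of "Tail (Var 0)"] by (simp add: poly_bd_mono[OF poly_bd_measure])
qed

lemma polytime_Pr:
  assumes "polytime f" "polytime g"
  shows "polytime (\<lambda>x. Pr (f x) (g x))"
proof -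
  obtain c m t where c: "\<And>x. runs c m x (t x) (f x)" "poly_bd size t"
    using assms by (meson polytimeE)
  obtain d k u where d: "\<And>x. runs d k x (u x) (g x)" "poly_bd size u"
    using assms by (meson polytimeE)
  show ?thesis
  proof (rule polytimeI)
    show "runs (pair_com (max m k) c d) (max m k + 2) x (t x + u x + 14) (Pr (f x) (g x))" for x
      by (rule runs_pair[OF runs_mono[OF c(1)] runs_mono[OF d(1)]]) auto
    have "poly_bd size (\<lambda>x. size (f x) + size (g x) + 1)"
      by (intro poly_bd_add polytime_size assms poly_bd_const)
    then show "poly_bd size (\<lambda>x. size (Pr (f x) (g x)))"
      by simp
  qed (intro poly_bd_add c d poly_bd_const)
qed

lemma polytime_const: "polytime (\<lambda>_. a)"
  by (induction a) (auto intro: polytime_Nl polytime_Pr)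

lemma polytime_case_Nl:
  assumes "polytime b" "polytime f" "polytime g"
  shows "polytime (\<lambda>x. if b x = Nl then f x else g x)"
proof -
  obtain c m t where c: "\<And>x. runs c m x (t x) (f (tl_tree x))" "poly_bd size t"
    using polytime_compose[OF assms(2) polytime_tl[OF polytime_id]] by (meson polytimeE)
  obtain d k u where d: "\<And>x. runs d k x (u x) (g (tl_tree x))" "poly_bd size u"
    using polytime_compose[OF assms(3) polytime_tl[OF polytime_id]] by (meson polytimeE)
  \<comment> \<open>Both branches need the original input after the test, so the test value is put
    in front of it; the branches were prepared for this by \<open>tl_tree\<close>.\<close>
  have "polytime (\<lambda>x. if hd_tree x = Nl then f (tl_tree x) else g (tl_tree x))"
  proof (rule polytimeI)
    show "runs (Cond (Head (Var 0)) d c) (max m k) x (cost (Head (Var 0)) + 1 + (t x + u x))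
      (if hd_tree x = Nl then f (tl_tree x) else g (tl_tree x))" for x
      by (rule runs_Cond) (auto intro: runs_mono[OF c(1)] runs_mono[OF d(1)])
    have "poly_bd size (\<lambda>x. size (f (tl_tree x)) + size (g (tl_tree x)))"
      by (intro poly_bd_add polytime_size polytime_compose[OF assms(2)] polytime_compose[OF assms(3)]
          polytime_tl polytime_id)
    then show "poly_bd size (\<lambda>x. size (if hd_tree x = Nl then f (tl_tree x) else g (tl_tree x)))"
      by (rule poly_bd_mono) auto
  qed (intro poly_bd_add c d poly_bd_const)
  from polytime_compose[OF this polytime_Pr[OF assms(1) polytime_id]] show ?thesis
    by (simp cong: if_cong)
qed

lemma size_elems: "y \<in> set (elems l) \<Longrightarrow> size y < size l"
  by (induction l) auto

lemma length_elems: "len l \<le> size l"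
  by (induction l) auto

text \<open>Polynomial-time steps alone do not suffice, as each step could square the accumulator.
  Therefore all intermediate accumulators are assumed to be polynomially bounded in the initial
  data.\<close>

lemma polytime_foldl:
  fixes F :: "tree \<Rightarrow> tree \<Rightarrow> tree \<Rightarrow> tree"
  assumes F: "polytime (\<lambda>z. F (hd_tree z) (tl_tree (tl_tree z)) (hd_tree (tl_tree z)))"
    and bd: "\<And>e l a j. j \<le> len l \<Longrightarrow>
      size (foldl (F e) a (take j (elems l))) \<le> (size e + size l + size a + 2) ^ k"
    and e: "polytime e" and l: "polytime l" and a: "polytime a"
  shows "polytime (\<lambda>x. foldl (F (e x)) (a x) (elems (l x)))"
proof -
  obtain c m t where c: "\<And>z. runs c m z (t z) (F (hd_tree z) (tl_tree (tl_tree z)) (hd_tree (tl_tree z)))"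
    "poly_bd size t"
    using F by (meson polytimeE)
  obtain d where d: "\<And>z. t z \<le> (size z + 2) ^ d"
    using c(2) by (meson poly_bdE)
  define P where "P x = Pr (e x) (Pr (l x) (a x))" for x
  have "polytime P"
    unfolding P_def by (intro polytime_Pr e l a)
  then obtain c' m' t' where c': "\<And>x. runs c' m' x (t' x) (P x)" "poly_bd size t'"
    by (meson polytimeE)
  have m: "0 < m"
    using c(1) runs_pos by blast
  \<comment> \<open>Environment and element are no larger than \<open>P x\<close>, and the
    accumulator has size at most \<open>(size (P x) + 2) ^ k\<close>; together they bound the
    argument of one step.\<close>
  define T where "T x = ((2 * size (P x) + (size (P x) + 2) ^ k + 2) + 2) ^ d" for x
  have sP: "poly_bd size (\<lambda>x. size (P x))"
    using polytime_size[OF \<open>polytime P\<close>] .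
  then have T: "poly_bd size T"
    unfolding T_def by (intro poly_bd_intros)
  have bd': "size (foldl (F (e x)) (a x) (take j (elems (l x)))) \<le> (size (P x) + 2) ^ k"
    if "j \<le> len (l x)" for x j
  proof -
    have "(size (e x) + size (l x) + size (a x) + 2) ^ k \<le> (size (P x) + 2) ^ k"
      by (rule power_mono) (auto simp: P_def)
    with bd[OF that, of "e x" "a x"] show ?thesis
      by linarith
  qed
  show ?thesis
  proof (rule polytimeI)
    show "runs (Seq c' (fold_com m c)) (max m' (m + 2)) x
        (t' x + (15 + len (l x) * (T x + 12))) (foldl (F (e x)) (a x) (elems (l x)))" for x
    proof (rule runs_Seq)
      show "runs c' (max m' (m + 2)) x (t' x) (P x)"
        by (rule runs_mono[OF c'(1)]) auto
      have "runs (fold_com m c) (m + 2) (P x) (15 + len (l x) * (T x + 12))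
          (foldl (F (e x)) (a x) (elems (l x)))"
        unfolding P_def
      proof (rule runs_fold)
        fix j assume j: "j < len (l x)"
        let ?z = "Pr (e x) (Pr (elems (l x) ! j) (foldl (F (e x)) (a x) (take j (elems (l x)))))"
        have "size (elems (l x) ! j) < size (l x)"
          using j by (intro size_elems) simp
        then have "size ?z + 2 \<le> 2 * size (P x) + (size (P x) + 2) ^ k + 2 + 2"
          using bd'[of j x] j by (simp add: P_def)
        from power_mono[OF this, of d] d[of ?z] have "t ?z \<le> T x"
          unfolding T_def by linarith
        with c(1)[of ?z] show "runs c m ?z (T x) (F (e x) (foldl (F (e x)) (a x) (take j (elems (l x)))) (elems (l x) ! j))"
          by (auto elim: runs_mono)
      qed (rule m)
      then show "runs (fold_com m c) (max m' (m + 2)) (P x) (15 + len (l x) * (T x + 12))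
          (foldl (F (e x)) (a x) (elems (l x)))"
        by (rule runs_mono) auto
    qed
    have "poly_bd size (\<lambda>x. len (l x))"
      using polytime_size[OF l] by (rule poly_bd_mono) (rule length_elems)
    then show "poly_bd size (\<lambda>x. t' x + (15 + len (l x) * (T x + 12)))"
      by (intro poly_bd_intros c' T)
    have "poly_bd size (\<lambda>x. (size (P x) + 2) ^ k)"
      by (intro poly_bd_intros sP)
    then show "poly_bd size (\<lambda>x. size (foldl (F (e x)) (a x) (elems (l x))))"
      by (rule poly_bd_mono) (use bd' in fastforce)
  qed
qed

lemma size_foldl_additive:
  assumes "\<And>a y. size (F a y) \<le> size a + (size e + size y + 2) ^ k"
  shows "size (foldl F a (take j (elems l))) \<le> size (a::tree) + size l * (size (e::tree) + size l + 2) ^ k"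
proof (induction l arbitrary: a j)
  case Nl
  then show ?case by simp
next
  case (Pr y l)
  show ?case
  proof (cases j)
    case 0
    then show ?thesis by simp
  next
    case (Suc i)
    let ?B = "(size e + size (Pr y l) + 2) ^ k"
    have "size (foldl F a (take j (elems (Pr y l)))) \<le> size (F a y) + size l * (size e + size l + 2) ^ k"
      using Pr.IH(2)[of "F a y" i] Suc by simp
    also have "\<dots> \<le> size a + (size e + size y + 2) ^ k + size l * (size e + size l + 2) ^ k"
      using assms by simp
    also have "\<dots> \<le> size a + ?B + size l * ?B"
      by (intro add_mono mult_mono power_mono) auto
    also have "\<dots> \<le> size a + size (Pr y l) * ?B"
      by (simp add: algebra_simps)
    finally show ?thesis .
  qed
qed

text \<open>The convenient sufficient condition: growth per step that depends on environment and
  element, but not on the accumulator, adds up to a polynomial.\<close>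

lemma polytime_foldl_additive:
  fixes F :: "tree \<Rightarrow> tree \<Rightarrow> tree \<Rightarrow> tree"
  assumes F: "polytime (\<lambda>z. F (hd_tree z) (tl_tree (tl_tree z)) (hd_tree (tl_tree z)))"
    and bd: "\<And>e a y. size (F e a y) \<le> size a + (size e + size y + 2) ^ k"
    and "polytime e" "polytime l" "polytime a"
  shows "polytime (\<lambda>x. foldl (F (e x)) (a x) (elems (l x)))"
proof (rule polytime_foldl[OF F])
  fix e l a :: tree and j
  let ?S = "size e + size l + size a + 2"
  have "size (foldl (F e) a (take j (elems l))) \<le> size a + size l * (size e + size l + 2) ^ k"
    using bd by (rule size_foldl_additive)
  also have "\<dots> \<le> ?S * ?S ^ k + ?S * ?S ^ k"
  proof (rule add_mono)
    have "size a * 1 \<le> ?S * ?S ^ k"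
      by (rule mult_mono) auto
    then show "size a \<le> ?S * ?S ^ k"
      by simp
    show "size l * (size e + size l + 2) ^ k \<le> ?S * ?S ^ k"
      by (intro mult_mono power_mono) auto
  qed
  also have "\<dots> = 2 * ?S ^ Suc k"
    by simp
  also have "\<dots> \<le> ?S * ?S ^ Suc k"
    by (intro mult_le_mono1) simp
  finally show "size (foldl (F e) a (take j (elems l))) \<le> ?S ^ Suc (Suc k)"
    by simp
qed (use assms in auto)

section \<open>Polynomial-time tests and list operations\<close>

definition polytest :: "(tree \<Rightarrow> bool) \<Rightarrow> bool" where
  "polytest P \<longleftrightarrow> polytime (\<lambda>x. enc_bool (P x))"

lemma enc_bool_eq_Nl [simp]: "enc_bool b = Nl \<longleftrightarrow> \<not> b"
  by (simp add: enc_bool_def)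

lemma polytime_enc_bool: "polytest P \<Longrightarrow> polytime (\<lambda>x. enc_bool (P x))"
  by (simp add: polytest_def)

lemma polytime_cong: "polytime g \<Longrightarrow> (\<And>x. f x = g x) \<Longrightarrow> polytime f"
  by (metis ext)

lemma polytest_cong: "polytest Q \<Longrightarrow> (\<And>x. P x = Q x) \<Longrightarrow> polytest P"
  by (simp add: polytest_def)

lemma polytime_If:
  assumes "polytest P" "polytime f" "polytime g"
  shows "polytime (\<lambda>x. if P x then f x else g x)"
  by (rule polytime_cong[OF polytime_case_Nl[OF polytime_enc_bool[OF assms(1)] assms(3) assms(2)]]) simp

lemma polytest_nonNl:
  assumes "polytime f"
  shows "polytest (\<lambda>x. f x \<noteq> Nl)"
  unfolding polytest_def
  by (rule polytime_cong[OF polytime_case_Nl[OF assms polytime_const[of "enc_bool False"]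
        polytime_const[of "enc_bool True"]]]) simp

lemma polytest_not:
  assumes "polytest P"
  shows "polytest (\<lambda>x. \<not> P x)"
  unfolding polytest_def
  by (rule polytime_cong[OF polytime_If[OF assms polytime_const[of "enc_bool False"]
        polytime_const[of "enc_bool True"]]]) simp

lemma polytest_conj:
  assumes "polytest P" "polytest Q"
  shows "polytest (\<lambda>x. P x \<and> Q x)"
  unfolding polytest_def
  by (rule polytime_cong[OF polytime_If[OF assms(1) polytime_enc_bool[OF assms(2)]
        polytime_const[of "enc_bool False"]]]) simp

lemma polytest_disj: "polytest P \<Longrightarrow> polytest Q \<Longrightarrow> polytest (\<lambda>x. P x \<or> Q x)"
  by (rule polytest_cong[OF polytest_not[OF polytest_conj[OF polytest_not polytest_not, of P Q]]]) simp_all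

lemma polytest_isNl: "polytime f \<Longrightarrow> polytest (\<lambda>x. f x = Nl)"
  by (rule polytest_cong[OF polytest_not[OF polytest_nonNl, of f]]) simp_all

lemma polytest_iff: "polytest P \<Longrightarrow> polytest Q \<Longrightarrow> polytest (\<lambda>x. P x = Q x)"
  by (rule polytest_cong[OF polytest_disj[OF polytest_conj polytest_conj[OF polytest_not polytest_not], of P Q P Q]]) auto

text \<open>Left folds produce lists in reverse order; a final \<open>revt Nl\<close> puts them
  right.\<close>

definition revt :: "tree \<Rightarrow> tree \<Rightarrow> tree" where
  "revt a l = foldl (\<lambda>a y. Pr y a) a (elems l)"

lemma elems_revt [simp]: "elems (revt a l) = rev (elems l) @ elems a"
proof -
  have "elems (foldl (\<lambda>a y. Pr y a) a xs) = rev xs @ elems a" for xs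
    by (induction xs arbitrary: a) auto
  then show ?thesis
    by (simp add: revt_def)
qed

lemma size_revt: "size (revt a l) = size a + size l"
proof (induction l arbitrary: a)
  case (Pr y l)
  from Pr(2)[of "Pr y a"] show ?case
    by (simp add: revt_def)
qed (simp add: revt_def)

lemma elems_inject: "elems a = elems b \<longleftrightarrow> a = b"
  by (metis enc_list_elems)

lemma polytime_revt: "polytime a \<Longrightarrow> polytime l \<Longrightarrow> polytime (\<lambda>x. revt (a x) (l x))"
  unfolding revt_def
proof (rule polytime_foldl_additive[where e = "\<lambda>_. Nl" and F = "\<lambda>e a y. Pr y a" and k = 1])
  show "polytime (\<lambda>z. Pr (hd_tree (tl_tree z)) (tl_tree (tl_tree z)))"
    by (intro polytime_Pr polytime_hd polytime_tl polytime_id)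
qed (auto intro: polytime_const)

text \<open>Brings the size of one mapped element together with its list cell into the form of
  growth that \<open>polytime_foldl_additive\<close> asks for.\<close>

lemma Suc_power_le: "2 \<le> N \<Longrightarrow> Suc (Suc N ^ d) \<le> N ^ (2 * d + 1)" for N :: nat
proof -
  assume N: "2 \<le> N"
  then have "N * 2 \<le> N * N"
    by (rule mult_le_mono2)
  with N have "Suc N \<le> N ^ 2"
    unfolding power2_eq_square by linarith
  then have "Suc N ^ d \<le> (N ^ 2) ^ d"
    by (rule power_mono) simp
  moreover have "1 \<le> N ^ (2 * d)"
    using N by simp
  ultimately have "Suc (Suc N ^ d) \<le> 2 * N ^ (2 * d)"
    by (simp add: power_mult)
  also have "\<dots> \<le> N * N ^ (2 * d)"
    using N by (rule mult_le_mono1)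
  finally show ?thesis
    by simp
qed

lemma polytime_map:
  fixes F :: "tree \<Rightarrow> tree \<Rightarrow> tree"
  assumes F: "polytime (\<lambda>z. F (hd_tree z) (tl_tree z))" and "polytime e" "polytime l"
  shows "polytime (\<lambda>x. enc_list (F (e x)) (elems (l x)))"
proof -
  obtain d where d: "\<And>z. size (F (hd_tree z) (tl_tree z)) \<le> (size z + 2) ^ d"
    using polytime_size[OF F] by (meson poly_bdE)
  have "polytime (\<lambda>x. foldl (\<lambda>a y. Pr (F (e x) y) a) Nl (elems (l x)))"
  proof (rule polytime_foldl_additive[where F = "\<lambda>e a y. Pr (F e y) a" and k = "2 * d + 1"])
    show "polytime (\<lambda>z. Pr (F (hd_tree z) (hd_tree (tl_tree z))) (tl_tree (tl_tree z)))"
    proof (intro polytime_Pr)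
      have "polytime (\<lambda>z. Pr (hd_tree z) (hd_tree (tl_tree z)))"
        by (intro polytime_Pr polytime_hd polytime_tl polytime_id)
      from polytime_compose[OF F this] show "polytime (\<lambda>z. F (hd_tree z) (hd_tree (tl_tree z)))"
        by simp
    qed (intro polytime_tl polytime_id)
    fix e a y :: tree
    have "size (F e y) \<le> (Suc (size e + size y + 2)) ^ d"
      using d[of "Pr e y"] by simp
    with Suc_power_le[of "size e + size y + 2" d]
    show "size (Pr (F e y) a) \<le> size a + (size e + size y + 2) ^ (2 * d + 1)"
      by simp
  qed (use assms in \<open>auto intro: polytime_const\<close>)
  then have "polytime (\<lambda>x. revt Nl (foldl (\<lambda>a y. Pr (F (e x) y) a) Nl (elems (l x))))"
    by (intro polytime_revt polytime_const)
  also have "(\<lambda>x. revt Nl (foldl (\<lambda>a y. Pr (F (e x) y) a) Nl (elems (l x)))) =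
    (\<lambda>x. enc_list (F (e x)) (elems (l x)))"
  proof
    fix x
    have "elems (foldl (\<lambda>a y. Pr (F (e x) y) a) a xs) = rev (map (F (e x)) xs) @ elems a" for a xs
      by (induction xs arbitrary: a) auto
    then show "revt Nl (foldl (\<lambda>a y. Pr (F (e x) y) a) Nl (elems (l x))) = enc_list (F (e x)) (elems (l x))"
      by (simp add: elems_inject[symmetric])
  qed
  finally show ?thesis .
qed

definition concatt :: "tree \<Rightarrow> tree" where
  "concatt l = enc_list (\<lambda>x. x) (concat (map elems (elems l)))"

lemma polytime_concatt:
  assumes "polytime l"
  shows "polytime (\<lambda>x. concatt (l x))"
proof -
  have "polytime (\<lambda>x. foldl (\<lambda>a y. revt a y) Nl (elems (l x)))"
  proof (rule polytime_foldl_additive[where e = "\<lambda>_. Nl" and F = "\<lambda>e a y. revt a y" and k = 1])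
    show "polytime (\<lambda>z. revt (tl_tree (tl_tree z)) (hd_tree (tl_tree z)))"
      by (intro polytime_revt polytime_hd polytime_tl polytime_id)
  qed (use assms in \<open>auto intro: polytime_const simp: size_revt\<close>)
  then have "polytime (\<lambda>x. revt Nl (foldl (\<lambda>a y. revt a y) Nl (elems (l x))))"
    by (intro polytime_revt polytime_const)
  also have "(\<lambda>x. revt Nl (foldl (\<lambda>a y. revt a y) Nl (elems (l x)))) = (\<lambda>x. concatt (l x))"
  proof
    fix x
    have "elems (foldl (\<lambda>a y. revt a y) a xs) = rev (concat (map elems xs)) @ elems a" for a xs
      by (induction xs arbitrary: a) auto
    then show "revt Nl (foldl (\<lambda>a y. revt a y) Nl (elems (l x))) = concatt (l x)"
      by (simp add: elems_inject[symmetric] concatt_def)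
  qed
  finally show ?thesis .
qed

text \<open>Numbers are unary, that is, lengths. Dropping as many elements as another list has
  serves both for comparing two numbers and for indexing.\<close>

definition dropt :: "tree \<Rightarrow> tree \<Rightarrow> tree" where
  "dropt k l = (tl_tree ^^ len k) l"

lemma polytime_dropt:
  assumes "polytime k" "polytime l"
  shows "polytime (\<lambda>x. dropt (k x) (l x))"
proof -
  have "polytime (\<lambda>x. foldl (\<lambda>a y. tl_tree a) (l x) (elems (k x)))"
  proof (rule polytime_foldl_additive[where e = "\<lambda>_. Nl" and F = "\<lambda>e a y. tl_tree a" and k = 1])
    show "polytime (\<lambda>z. tl_tree (tl_tree (tl_tree z)))"
      by (intro polytime_tl polytime_id)
    show "size (tl_tree a) \<le> size a + (size e + size y + 2) ^ 1" for a e y :: tree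
      by (cases a) auto
  qed (use assms in \<open>auto intro: polytime_const\<close>)
  moreover have "foldl (\<lambda>a y. tl_tree a) a ys = (tl_tree ^^ length ys) a" for a and ys :: "tree list"
    by (induction ys arbitrary: a) (auto simp: funpow_swap1)
  ultimately show ?thesis
    by (simp add: dropt_def)
qed

lemma tl_tree_funpow_Nl [simp]: "(tl_tree ^^ k) Nl = Nl"
  by (induction k) auto

lemma elems_tl_funpow: "elems ((tl_tree ^^ k) l) = drop k (elems l)"
proof (induction k arbitrary: l)
  case (Suc k)
  then show ?case
    by (cases l) (simp_all add: funpow_swap1)
qed simp

lemma elems_dropt [simp]: "elems (dropt k l) = drop (len k) (elems l)"
  by (simp add: dropt_def elems_tl_funpow)

lemma elems_eq_Nil [simp]: "elems t = [] \<longleftrightarrow> t = Nl"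
  by (cases t) auto

lemma hd_tree_tl_funpow: "k < len l \<Longrightarrow> hd_tree ((tl_tree ^^ k) l) = elems l ! k"
proof (induction k arbitrary: l)
  case 0
  then show ?case by (cases l) auto
next
  case (Suc k)
  then show ?case by (cases l) (simp_all add: funpow_swap1)
qed

lemma dropt_eq_Nl: "dropt k l = Nl \<longleftrightarrow> len l \<le> len k"
  using elems_eq_Nil[of "dropt k l"] by (simp del: elems_eq_Nil)

lemma polytest_len_less:
  "polytime a \<Longrightarrow> polytime b \<Longrightarrow> polytest (\<lambda>x. len (a x) < len (b x))"
  by (rule polytest_cong[OF polytest_nonNl[OF polytime_dropt, of a b]]) (auto simp: dropt_eq_Nl)

lemma polytest_len_eq:
  "polytime a \<Longrightarrow> polytime b \<Longrightarrow> polytest (\<lambda>x. len (a x) = len (b x))"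
  by (rule polytest_cong[OF polytest_conj[OF polytest_isNl[OF polytime_dropt] polytest_isNl[OF polytime_dropt], of a b b a]])
    (auto simp: dropt_eq_Nl)

lemma polytime_tl_funpow: "polytime f \<Longrightarrow> polytime (\<lambda>x. (tl_tree ^^ k) (f x))"
  by (induction k) (auto intro: polytime_tl)

lemma polytime_enc_list:
  "(\<And>i. i \<in> set is \<Longrightarrow> polytime (F i)) \<Longrightarrow> polytime (\<lambda>x. enc_list (\<lambda>i. F i x) is)"
  by (induction "is") (auto intro: polytime_const polytime_Pr)

fun tailst :: "tree \<Rightarrow> tree" where
  "tailst Nl = Nl"
| "tailst (Pr a b) = Pr (Pr a b) (tailst b)"

text \<open>The growth per step is the remaining list, which is part of the accumulator, so the
  additive criterion does not apply. The head of the accumulator never outgrows the initial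
  accumulator, which gives a quadratic bound.\<close>

lemma polytime_tailst:
  assumes "polytime l"
  shows "polytime (\<lambda>x. tailst (l x))"
proof -
  let ?F = "\<lambda>(e::tree) a (y::tree). Pr (tl_tree (hd_tree a)) (Pr (hd_tree a) (tl_tree a))"
  have hd: "size (hd_tree a) \<le> size a" and tl: "size (tl_tree a) \<le> size a" for a :: tree
    by (cases a; simp)+
  have "polytime (\<lambda>x. foldl (?F Nl) (Pr (l x) Nl) (elems (l x)))"
  proof (rule polytime_foldl[where e = "\<lambda>_. Nl" and F = ?F and k = 3])
    show "polytime (\<lambda>z. Pr (tl_tree (hd_tree (tl_tree (tl_tree z))))
        (Pr (hd_tree (tl_tree (tl_tree z))) (tl_tree (tl_tree (tl_tree z)))))"
      by (intro polytime_Pr polytime_hd polytime_tl polytime_id)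
    fix e l a :: tree and j
    assume j: "j \<le> len l"
    have inv: "size (hd_tree (foldl (?F e) a xs)) \<le> size a \<and>
      size (tl_tree (foldl (?F e) a xs)) \<le> size a + length xs * (size a + 1) \<and>
      size (foldl (?F e) a xs) \<le> 2 * size a + length xs * (size a + 1) + 1" for xs
    proof (induction xs rule: rev_induct)
      case Nil
      then show ?case using hd[of a] tl[of a] by simp
    next
      case (snoc x xs)
      then show ?case
        using tl[of "hd_tree (foldl (?F e) a xs)"] by (simp add: algebra_simps)
    qed
    let ?S = "size e + size l + size a + 2"
    have "size (foldl (?F e) a (take j (elems l))) \<le> 2 * size a + length (take j (elems l)) * (size a + 1) + 1"
      using inv by blast
    also have "\<dots> \<le> 2 * size a + size l * (size a + 1) + 1"
      using length_elems[of l] by (intro add_mono mult_mono) auto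
    also have "\<dots> \<le> ?S * ?S"
      by (simp add: algebra_simps)
    also have "\<dots> \<le> ?S * ?S * ?S"
      by simp
    finally show "size (foldl (?F e) a (take j (elems l))) \<le> ?S ^ 3"
      by (simp add: power3_eq_cube)
  qed (use assms in \<open>auto intro: polytime_const polytime_Pr\<close>)
  then have "polytime (\<lambda>x. revt Nl (tl_tree (foldl (?F Nl) (Pr (l x) Nl) (elems (l x)))))"
    by (intro polytime_revt polytime_const polytime_tl)
  also have "(\<lambda>x. revt Nl (tl_tree (foldl (?F Nl) (Pr (l x) Nl) (elems (l x))))) = (\<lambda>x. tailst (l x))"
  proof
    fix x
    have "elems (tl_tree (foldl (?F Nl) (Pr t a) (elems t))) = rev (elems (tailst t)) @ elems a" for t a
      by (induction t arbitrary: a) auto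
    then show "revt Nl (tl_tree (foldl (?F Nl) (Pr (l x) Nl) (elems (l x)))) = tailst (l x)"
      by (simp add: elems_inject[symmetric])
  qed
  finally show ?thesis .
qed

definition count_row :: "tree \<Rightarrow> tree \<Rightarrow> tree" where
  "count_row a l = foldl (\<lambda>a b. if b = Nl then a else Pr Nl a) a (elems l)"

lemma length_count_row:
  "len (count_row a l) = len a + length (filter (\<lambda>b. b \<noteq> Nl) (elems l))"
proof -
  have "len (foldl (\<lambda>a b. if b = Nl then a else Pr Nl a) a xs) =
    len a + length (filter (\<lambda>b. b \<noteq> Nl) xs)" for xs
    by (induction xs arbitrary: a) auto
  then show ?thesis
    by (simp add: count_row_def)
qed

lemma size_count_row: "size (count_row a l) \<le> size a + size l"
proof (induction l arbitrary: a)
  case (Pr y l)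
  from Pr(2)[of a] Pr(2)[of "Pr Nl a"] show ?case
    by (simp add: count_row_def)
qed (simp add: count_row_def)

lemma polytime_count_row: "polytime a \<Longrightarrow> polytime l \<Longrightarrow> polytime (\<lambda>x. count_row (a x) (l x))"
  unfolding count_row_def
proof (rule polytime_foldl_additive[where e = "\<lambda>_. Nl" and F = "\<lambda>e a b. if b = Nl then a else Pr Nl a" and k = 1])
  show "polytime (\<lambda>z. if hd_tree (tl_tree z) = Nl then tl_tree (tl_tree z) else Pr Nl (tl_tree (tl_tree z)))"
    by (intro polytime_case_Nl polytime_Pr polytime_const polytime_hd polytime_tl polytime_id)
qed (auto intro: polytime_const)

definition count_matrix :: "tree \<Rightarrow> tree" where
  "count_matrix l = foldl count_row Nl (elems l)"

lemma length_count_matrix: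
  "len (count_matrix l) = (\<Sum>r\<leftarrow>elems l. length (filter (\<lambda>b. b \<noteq> Nl) (elems r)))"
proof -
  have "len (foldl count_row a xs) =
    len a + (\<Sum>r\<leftarrow>xs. length (filter (\<lambda>b. b \<noteq> Nl) (elems r)))" for a xs
    by (induction xs arbitrary: a) (auto simp: length_count_row)
  then show ?thesis
    by (simp add: count_matrix_def)
qed

lemma polytime_count_matrix: "polytime l \<Longrightarrow> polytime (\<lambda>x. count_matrix (l x))"
  unfolding count_matrix_def
proof (rule polytime_foldl_additive[where e = "\<lambda>_. Nl" and F = "\<lambda>e. count_row" and k = 1])
  show "polytime (\<lambda>z. count_row (tl_tree (tl_tree z)) (hd_tree (tl_tree z)))"
    by (intro polytime_count_row polytime_hd polytime_tl polytime_id)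
  show "size (count_row a y) \<le> size a + (size e + size y + 2) ^ 1" for a e y
    using size_count_row[of a y] by simp
qed (auto intro: polytime_const)

lemmas polytime_intros = polytime_id polytime_const polytime_hd polytime_tl polytime_Pr polytime_If polytime_enc_bool
  polytime_revt polytime_concatt polytime_dropt polytime_tailst polytime_tl_funpow polytime_count_row
  polytime_count_matrix polytime_enc_list
  polytest_nonNl polytest_isNl polytest_not polytest_conj polytest_disj polytest_iff polytest_len_less polytest_len_eq

section \<open>Deletion sets and monochromatic edges\<close>

definition mono_edges :: "'a set set \<Rightarrow> ('a \<Rightarrow> nat) \<Rightarrow> 'a set set" where
  "mono_edges E \<phi> = {e \<in> E. \<exists>u v. e = {u, v} \<and> \<phi> u = \<phi> v}"

lemma LED_feasible_mono_edges:
  assumes "\<And>v. v \<in> V \<Longrightarrow> \<phi> v \<in> L v"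
  shows "LED_feasible V E L (mono_edges E \<phi>)"
  using assms unfolding LED_feasible_def proper_list_coloring_def mono_edges_def by blast

text \<open>The monochromatic edges of a witnessing colouring all lie in \<open>X\<close> and form a
  feasible set themselves, so minimality gives equality. Deletion sets can thus be traded for list
  colourings.\<close>

lemma LED_optimal_mono_edges:
  assumes "simple_graph V E" "LED_optimal V E L X"
  obtains \<phi> where "\<And>v. v \<in> V \<Longrightarrow> \<phi> v \<in> L v" "X = mono_edges E \<phi>"
    "\<And>\<psi>. (\<And>v. v \<in> V \<Longrightarrow> \<psi> v \<in> L v) \<Longrightarrow> card X \<le> card (mono_edges E \<psi>)"
proof -
  have X: "LED_feasible V E L X" and min: "\<And>Y. LED_feasible V E L Y \<Longrightarrow> card X \<le> card Y"
    using assms(2) by (auto simp: LED_optimal_def is_arg_min_def not_less)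
  then obtain \<phi> where \<phi>: "X \<subseteq> E" "proper_list_coloring V (E - X) L \<phi>"
    by (auto simp: LED_feasible_def)
  have "finite E"
  proof (rule finite_subset)
    show "E \<subseteq> Pow V" "finite (Pow V)"
      using assms(1) by (auto simp: simple_graph_def)
  qed
  then have fin: "finite X"
    using \<phi> finite_subset by blast
  have list: "\<phi> v \<in> L v" if "v \<in> V" for v
    using \<phi> that by (auto simp: proper_list_coloring_def)
  have "mono_edges E \<phi> \<subseteq> X"
    using \<phi> by (auto simp: mono_edges_def proper_list_coloring_def)
  moreover have "card X \<le> card (mono_edges E \<phi>)"
    using list by (intro min LED_feasible_mono_edges)
  ultimately have "X = mono_edges E \<phi>"
    using fin by (metis card_seteq)
  then show thesis
    using list min LED_feasible_mono_edges by (intro that[of \<phi>]) blast+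
qed

text \<open>Matches the adjacency matrix, in which every edge occurs twice; the program counts its
  true entries.\<close>

lemma sum_ordered_pairs_eq:
  assumes "finite V" "X \<subseteq> {{u, v} | u v. u \<in> V \<and> v \<in> V \<and> u \<noteq> v}"
  shows "(\<Sum>u\<in>V. \<Sum>v\<in>V. of_bool ({u, v} \<in> X)) = 2 * card X"
proof -
  have "X \<subseteq> Pow V"
    using assms(2) by auto
  then have "finite X"
    using assms(1) finite_subset by auto
  then show ?thesis
    using assms(2)
  proof (induction X rule: finite_induct)
    case (insert e X)
    from insert.prems obtain a b where ab: "e = {a, b}" "a \<in> V" "b \<in> V" "a \<noteq> b"
      by auto
    have "(\<Sum>u\<in>V. \<Sum>v\<in>V. of_bool ({u, v} = e)) = (\<Sum>x\<in>V \<times> V. of_bool ({fst x, snd x} = e) :: nat)"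
      by (simp add: sum.cartesian_product case_prod_beta)
    also have "\<dots> = card {x \<in> V \<times> V. {fst x, snd x} = e}"
      using assms(1) by (simp add: sum.If_cases of_bool_def Collect_conj_eq Int_commute)
    also have "{x \<in> V \<times> V. {fst x, snd x} = e} = {(a, b), (b, a)}"
      using ab by (auto simp: doubleton_eq_iff)
    also have "card \<dots> = 2"
      using ab by simp
    finally have e: "(\<Sum>u\<in>V. \<Sum>v\<in>V. of_bool ({u, v} = e) :: nat) = 2" .
    have "(\<Sum>u\<in>V. \<Sum>v\<in>V. of_bool ({u, v} \<in> insert e X) :: nat) =
      (\<Sum>u\<in>V. \<Sum>v\<in>V. of_bool ({u, v} = e) + of_bool ({u, v} \<in> X))"
      using insert.hyps by (intro sum.cong refl) auto
    also have "\<dots> = 2 + 2 * card X"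
      using insert e by (simp add: sum.distrib)
    finally show ?case
      using insert.hyps by simp
  qed simp
qed

section \<open>Vertices, lists and the gadget graph\<close>

datatype vtx = Leaf nat nat | Hub nat | Gad nat nat nat

text \<open>Hub numbers are positive, so 0 stands for a vertex outside the hub.\<close>

fun hubno :: "vtx \<Rightarrow> nat" where
  "hubno (Hub h) = h"
| "hubno _ = 0"

text \<open>A triple of colours, counted from 0, is stored as one number below \<open>q ^ 3\<close>
  through its base-\<open>q\<close> digits.\<close>

definition digit :: "nat \<Rightarrow> nat \<Rightarrow> nat \<Rightarrow> nat" where
  "digit q l \<sigma> = \<sigma> div q ^ l mod q"

text \<open>\<open>Leaf i c\<close> is the pendant vertex of variable \<open>i\<close> for colour
  \<open>Suc c\<close>; \<open>Gad j \<sigma> a\<close> plays role \<open>a\<close> in the gadget of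
  clause \<open>j\<close> and triple \<open>\<sigma>\<close>. The \<open>max 2\<close> concerns
  digit 0: with the list \<open>{1}\<close> an idle relay would force its literal to colour 2, with
  \<open>{1, 2}\<close> it can always give way.\<close>

fun lst :: "nat \<Rightarrow> vtx \<Rightarrow> nat set" where
  "lst q (Leaf i c) = {Suc c}"
| "lst q (Hub h) = {1..q}"
| "lst q (Gad j \<sigma> a) = (if a < 4 then {1, 2} else if a = 4 then {2}
     else {1, max 2 (Suc (digit q (a - 5) \<sigma>))})"

text \<open>Vertices 0, 1, 2 of a gadget stand for the three literals of the clause (colour 2 means false);
  with the balancing vertex 3 and the constant vertex 4 of colour 2 they form a \<open>K\<^sub>5\<close>. Vertex \<open>l + 5\<close> is a
  relay between literal \<open>l\<close> and its hub vertex.\<close>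

definition gadget_edge :: "nat \<Rightarrow> nat \<Rightarrow> bool" where
  "gadget_edge a b \<longleftrightarrow> a < 5 \<and> b < 5 \<and> a \<noteq> b \<or> a < 3 \<and> b = a + 5 \<or> b < 3 \<and> a = b + 5"

definition same_gadget_adj :: "vtx \<Rightarrow> vtx \<Rightarrow> bool" where
  "same_gadget_adj u v \<longleftrightarrow> (\<exists>j \<sigma> a b. u = Gad j \<sigma> a \<and> v = Gad j \<sigma> b \<and> gadget_edge a b)"

definition K5_cost :: "(nat \<Rightarrow> nat) \<Rightarrow> nat" where
  "K5_cost g = of_bool (g 0 = g 1) + of_bool (g 0 = g 2) + of_bool (g 0 = g 3) + of_bool (g 0 = g 4) +
     of_bool (g 1 = g 2) + of_bool (g 1 = g 3) + of_bool (g 1 = g 4) + of_bool (g 2 = g 3) +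
     of_bool (g 2 = g 4) + of_bool (g 3 = g 4)"

lemma lessThan_8: "{..<8::nat} = {0, 1, 2, 3, 4, 5, 6, 7}"
  by (auto simp: eval_nat_numeral)

lemma lessThan_3: "{..<3::nat} = {0, 1, 2}"
  by (auto simp: eval_nat_numeral)

text \<open>The K5 has ten edges and the relays add three; the factor 2 comes from ordered
  pairs.\<close>

lemma gadget_edge_cost:
  fixes g :: "nat \<Rightarrow> nat"
  shows "(\<Sum>a<8. \<Sum>b<8. of_bool (gadget_edge a b \<and> g a = g b)) =
    2 * (K5_cost g + (\<Sum>l<3. of_bool (g l = g (l + 5))))"
proof -
  define h :: "nat \<Rightarrow> nat \<Rightarrow> nat" where "h a b = of_bool (g a = g b)" for a b
  have sym: "h a b = h b a" for a b
    by (simp add: h_def eq_commute)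
  have "(\<Sum>a<8. \<Sum>b<8. of_bool (gadget_edge a b \<and> g a = g b)) = (\<Sum>a<8. \<Sum>b<8. if gadget_edge a b then h a b else 0)"
    by (intro sum.cong refl) (simp add: h_def)
  also have "\<dots> = 2 * (h 0 1 + h 0 2 + h 0 3 + h 0 4 + h 1 2 + h 1 3 + h 1 4 + h 2 3 + h 2 4 + h 3 4 +
      (\<Sum>l<3. h l (l + 5)))"
    unfolding lessThan_8 lessThan_3
    by (simp add: gadget_edge_def sym[of "Suc 0" 0] sym[of 2 0] sym[of 3 0] sym[of 4 0] sym[of 2 "Suc 0"] sym[of 3 "Suc 0"] sym[of 4 "Suc 0"] sym[of 3 2] sym[of 4 2] sym[of 4 3] sym[of 5 0] sym[of 6 "Suc 0"] sym[of 7 2])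
  finally show ?thesis
    by (simp add: h_def K5_cost_def)
qed

text \<open>A 2-colouring of \<open>K\<^sub>5\<close> has 4 monochromatic edges if the split is \<open>3 : 2\<close> and at least 6 otherwise.
  Vertex 3 can always achieve \<open>3 : 2\<close> unless all literals are false.\<close>

lemma K5_cost_ge:
  assumes "g 0 \<in> {1, 2}" "g 1 \<in> {1, 2}" "g 2 \<in> {1, 2}" "g 3 \<in> {1, 2}" "g 4 = 2"
  shows "4 + 2 * of_bool (g 0 = 2 \<and> g 1 = 2 \<and> g 2 = 2) \<le> K5_cost g"
proof -
  have "g i = 1 \<or> g i = 2" if "i < 4" for i
    using assms that by (auto simp: less_Suc_eq eval_nat_numeral)
  then have "g 0 = 1 \<or> g 0 = 2" "g 1 = 1 \<or> g 1 = 2" "g 2 = 1 \<or> g 2 = 2" "g 3 = 1 \<or> g 3 = 2"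
    by simp_all
  then show ?thesis
    using assms(5) unfolding K5_cost_def by (elim disjE) simp_all
qed

section \<open>The instance built from a clause set and a choice of tables\<close>

text \<open>Uniqueness of three-digit representations: exactly one of the \<open>q ^ 3\<close>
  gadgets of a clause belongs to the colours that the hub shows.\<close>

lemma base_digits:
  assumes "\<sigma> < q ^ 3" and d: "d0 < q" "d1 < q" "d2 < (q::nat)"
  shows "(\<sigma> mod q = d0 \<and> \<sigma> div q mod q = d1 \<and> \<sigma> div q\<^sup>2 mod q = d2) \<longleftrightarrow> \<sigma> = d0 + q * (d1 + q * d2)"
proof
  have "\<sigma> div q\<^sup>2 < q"
    using assms by (intro less_mult_imp_div_less) (simp add: power2_eq_square power3_eq_cube mult.assoc)
  then have "\<sigma> div q\<^sup>2 mod q = \<sigma> div q div q"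
    by (simp add: div_mult2_eq power2_eq_square)
  moreover have "\<sigma> = \<sigma> mod q + q * (\<sigma> div q mod q + q * (\<sigma> div q div q))"
    by (metis add.commute mult_div_mod_eq)
  ultimately show "\<sigma> mod q = d0 \<and> \<sigma> div q mod q = d1 \<and> \<sigma> div q\<^sup>2 mod q = d2 \<Longrightarrow> \<sigma> = d0 + q * (d1 + q * d2)"
    by metis
  show "\<sigma> mod q = d0 \<and> \<sigma> div q mod q = d1 \<and> \<sigma> div q\<^sup>2 mod q = d2" if "\<sigma> = d0 + q * (d1 + q * d2)"
    using d that by (simp add: div_mult2_eq power2_eq_square)
qed

text \<open>\<open>blk i\<close> is the hub number of the block of variable \<open>i\<close>;
  \<open>val i s\<close> is its value under assignment \<open>s\<close> of the table chosen for that
  block, which hub colour \<open>Suc s\<close> selects. Hub numbers are nonzero because 0 means no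
  hub vertex.\<close>

locale led_instance =
  fixes q :: nat and hs :: "nat list" and m :: nat and blk :: "nat \<Rightarrow> nat"
    and val :: "nat \<Rightarrow> nat \<Rightarrow> bool" and cs :: "literal list list"
  assumes q2: "2 \<le> q" and hs: "distinct hs" "0 \<notin> set hs" and m: "0 < m"
    and blk: "\<And>i. i < m \<Longrightarrow> blk i \<in> set hs"
    and cs: "\<And>C i b. C \<in> set cs \<Longrightarrow> (i, b) \<in> set C \<Longrightarrow> i < m"
      "\<And>C. C \<in> set cs \<Longrightarrow> length C \<le> 3"
begin

text \<open>A literal missing from a short clause is false and is attached to an arbitrary hub vertex.\<close>

definition lit_hub :: "literal list \<Rightarrow> nat \<Rightarrow> nat" where
  "lit_hub C l = (if l < length C then blk (fst (C ! l)) else blk 0)"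

definition lit_false :: "literal list \<Rightarrow> nat \<Rightarrow> nat \<Rightarrow> bool" where
  "lit_false C l s \<longleftrightarrow> (l < length C \<longrightarrow> val (fst (C ! l)) s \<noteq> snd (C ! l))"

definition pin :: "literal list \<Rightarrow> nat \<Rightarrow> nat \<Rightarrow> nat" where
  "pin C l s = (if lit_false C l s then lit_hub C l else 0)"

text \<open>The hub vertex adjacent to a vertex, or 0. In the gadget of a colour triple, hub colour \<open>Suc s\<close> has to force
  colour 2 on a literal vertex with list \<open>{1, 2}\<close>: for \<open>s = 0\<close> a direct edge does this, for \<open>s > 0\<close> a relay
  with list \<open>{1, Suc s}\<close>. There is no edge if the literal is true for the colour.\<close>

fun att :: "vtx \<Rightarrow> nat" where
  "att (Leaf i c) = blk i"
| "att (Hub h) = 0"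
| "att (Gad j \<sigma> a) = (if a < 3 \<and> digit q a \<sigma> = 0 then pin (cs ! j) a 0
     else if 5 \<le> a \<and> digit q (a - 5) \<sigma> \<noteq> 0 then pin (cs ! j) (a - 5) (digit q (a - 5) \<sigma>) else 0)"

definition adj :: "vtx \<Rightarrow> vtx \<Rightarrow> bool" where
  "adj u v \<longleftrightarrow> hubno u \<noteq> 0 \<and> hubno u = att v \<or> hubno v \<noteq> 0 \<and> hubno v = att u \<or> same_gadget_adj u v"

text \<open>The pendant vertices come first, so \<open>Leaf i c\<close> has position
  \<open>q * i + c\<close> and the program finds its row without searching.\<close>

definition verts :: "vtx list" where
  "verts = concat (map (\<lambda>i. map (Leaf i) [0..<q]) [0..<m]) @ map Hub hs @
     concat (map (\<lambda>j. concat (map (\<lambda>\<sigma>. map (Gad j \<sigma>) [0..<8]) [0..<q ^ 3])) [0..<length cs])"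

definition LV :: "vtx set" where "LV = (\<lambda>(i, c). Leaf i c) ` ({..<m} \<times> {..<q})"
definition HV :: "vtx set" where "HV = Hub ` set hs"
definition GV :: "vtx set" where
  "GV = (\<lambda>(j, \<sigma>, a). Gad j \<sigma> a) ` ({..<length cs} \<times> {..<q ^ 3} \<times> {..<8})"

lemma set_verts: "set verts = LV \<union> (HV \<union> GV)"
proof -
  have "set (concat (map (\<lambda>i. map (Leaf i) [0..<q]) [0..<m])) = LV"
    by (auto simp: LV_def)
  moreover have "set (concat (map (\<lambda>j. concat (map (\<lambda>\<sigma>. map (Gad j \<sigma>) [0..<8]) [0..<q ^ 3])) [0..<length cs])) = GV"
    by (force simp: GV_def)
  ultimately show ?thesis
    by (simp only: verts_def set_append) (simp add: HV_def)
qed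

lemma distinct_verts: "distinct verts"
proof -
  have 1: "distinct (concat (map (\<lambda>i. map (Leaf i) [0..<q]) xs))" if "distinct xs" for xs
    using that by (induction xs) (auto simp: distinct_map inj_on_def)
  have 2: "distinct (concat (map (\<lambda>\<sigma>. map (Gad j \<sigma>) [0..<8]) xs))" if "distinct xs" for xs j
    using that by (induction xs) (auto simp: distinct_map inj_on_def)
  have 3: "distinct (concat (map (\<lambda>j. concat (map (\<lambda>\<sigma>. map (Gad j \<sigma>) [0..<8]) [0..<q ^ 3])) xs))"
    if "distinct xs" for xs
    using that by (induction xs) (auto simp: 2)
  show ?thesis
    unfolding verts_def using hs(1) 1[of "[0..<m]"] 3[of "[0..<length cs]"]
    by (auto simp: distinct_map inj_on_def)
qed

lemma length_verts: "length verts = m * q + length hs + length cs * (q ^ 3 * 8)"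
proof -
  have "length (concat (map f xs)) = length xs * k" if "\<And>x. length (f x) = k" for f :: "nat \<Rightarrow> vtx list" and xs k
    by (induction xs) (auto simp: that)
  then show ?thesis
    unfolding verts_def by simp
qed

lemma blk_pos: "i < m \<Longrightarrow> 0 < blk i"
  using blk[of i] hs(2) by (metis gr0I)

lemma lit_hub_in:
  assumes "j < length cs"
  shows "lit_hub (cs ! j) l \<in> set hs"
proof (cases "l < length (cs ! j)")
  case True
  then have "cs ! j ! l \<in> set (cs ! j)"
    by simp
  then have "fst (cs ! j ! l) < m"
    using cs(1)[of "cs ! j" "fst (cs ! j ! l)" "snd (cs ! j ! l)"] assms by simp
  then show ?thesis
    using True by (simp add: lit_hub_def blk)
next
  case False
  then show ?thesis
    using m by (simp add: lit_hub_def blk)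
qed

lemma lit_hub_pos: "j < length cs \<Longrightarrow> 0 < lit_hub (cs ! j) l"
  using lit_hub_in hs(2) by (metis gr0I)

lemma digit_less: "digit q l \<sigma> < q"
  using q2 by (simp add: digit_def)

lemma att_in: "v \<in> set verts \<Longrightarrow> att v \<noteq> 0 \<Longrightarrow> att v \<in> set hs"
  by (auto simp: set_verts LV_def HV_def GV_def blk pin_def lit_hub_in split: if_splits)

abbreviation N :: nat where
  "N \<equiv> length verts"

lemma adj_sym: "adj u v \<longleftrightarrow> adj v u"
  by (auto simp: adj_def same_gadget_adj_def gadget_edge_def)

lemma not_adj_self: "\<not> adj v v"
  by (cases v) (auto simp: adj_def same_gadget_adj_def gadget_edge_def)

definition list_col :: "(vtx \<Rightarrow> nat) \<Rightarrow> bool" where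
  "list_col \<phi> \<longleftrightarrow> (\<forall>v\<in>set verts. \<phi> v \<in> lst q v)"

text \<open>Ordered pairs are counted: this is twice the number of monochromatic edges.\<close>

definition cost2 :: "(vtx \<Rightarrow> nat) \<Rightarrow> nat" where
  "cost2 \<phi> = (\<Sum>u\<in>set verts. \<Sum>v\<in>set verts. of_bool (adj u v \<and> \<phi> u = \<phi> v))"

definition hub_cost :: "(vtx \<Rightarrow> nat) \<Rightarrow> vtx \<Rightarrow> nat" where
  "hub_cost \<phi> v = of_bool (att v \<noteq> 0 \<and> \<phi> (Hub (att v)) = \<phi> v)"

definition gcost :: "(vtx \<Rightarrow> nat) \<Rightarrow> nat \<Rightarrow> nat \<Rightarrow> nat" where
  "gcost \<phi> j \<sigma> = (\<Sum>a<8. hub_cost \<phi> (Gad j \<sigma> a)) +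
     (K5_cost (\<lambda>a. \<phi> (Gad j \<sigma> a)) + (\<Sum>l<3. of_bool (\<phi> (Gad j \<sigma> l) = \<phi> (Gad j \<sigma> (l + 5)))))"

lemma sum_GV: "(\<Sum>v\<in>GV. f v) = (\<Sum>j<length cs. \<Sum>\<sigma><q ^ 3. \<Sum>a<8. f (Gad j \<sigma> a))"
  unfolding GV_def
  by (subst sum.reindex) (auto simp: inj_on_def sum.cartesian_product case_prod_beta)

lemma sum_LV: "(\<Sum>v\<in>LV. f v) = (\<Sum>i<m. \<Sum>c<q. f (Leaf i c))"
  unfolding LV_def
  by (subst sum.reindex) (auto simp: inj_on_def sum.cartesian_product case_prod_beta)

lemma sum_HV: "(\<Sum>v\<in>HV. f v) = (\<Sum>h\<in>set hs. f (Hub h))"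
  unfolding HV_def by (subst sum.reindex) (auto simp: inj_on_def)

lemma sum_verts: "(\<Sum>v\<in>set verts. f v) = (\<Sum>v\<in>LV. f v) + ((\<Sum>v\<in>HV. f v) + (\<Sum>v\<in>GV. f v))"
  for f :: "vtx \<Rightarrow> nat"
proof -
  have fin: "finite LV" "finite HV" "finite GV"
    by (auto simp: LV_def HV_def GV_def)
  have "LV \<inter> (HV \<union> GV) = {}" "HV \<inter> GV = {}"
    by (auto simp: LV_def HV_def GV_def)
  then show ?thesis
    using fin by (simp add: set_verts sum.union_disjoint)
qed

lemma sum_hubs_eq:
  assumes "v \<in> set verts"
  shows "(\<Sum>u\<in>set verts. of_bool (hubno u \<noteq> 0 \<and> hubno u = att v \<and> \<phi> u = \<phi> v)) = hub_cost \<phi> v"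
proof -
  have "(\<Sum>u\<in>set verts. of_bool (hubno u \<noteq> 0 \<and> hubno u = att v \<and> \<phi> u = \<phi> v) :: nat) =
    (\<Sum>h\<in>set hs. of_bool (h \<noteq> 0 \<and> h = att v \<and> \<phi> (Hub h) = \<phi> v))"
    by (simp add: sum_verts sum_LV sum_HV sum_GV del: sum_of_bool_eq)
  also have "\<dots> = (\<Sum>h\<in>set hs. if h = att v then hub_cost \<phi> v else 0)"
    by (intro sum.cong refl) (auto simp: hub_cost_def)
  also have "\<dots> = hub_cost \<phi> v"
    using att_in[OF assms] by (auto simp: hub_cost_def)
  finally show ?thesis .
qed

text \<open>Every edge either joins a vertex to its hub vertex or lies inside one gadget. Edges of
  the first kind are charged to their end outside the hub; both kinds occur in both orders.\<close>

lemma cost2_eq: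
  "cost2 \<phi> = 2 * ((\<Sum>i<m. \<Sum>c<q. hub_cost \<phi> (Leaf i c)) + (\<Sum>j<length cs. \<Sum>\<sigma><q ^ 3. gcost \<phi> j \<sigma>))"
proof -
  let ?V = "set verts"
  let ?h = "\<lambda>u v. of_bool (hubno u \<noteq> 0 \<and> hubno u = att v \<and> \<phi> u = \<phi> v) :: nat"
  let ?g = "\<lambda>u v. of_bool (same_gadget_adj u v \<and> \<phi> u = \<phi> v) :: nat"
  \<comment> \<open>The three terms exclude each other: a hub vertex has \<open>att\<close> equal to
    0 and belongs to no gadget.\<close>
  have split: "of_bool (adj u v \<and> \<phi> u = \<phi> v) = ?h u v + ?h v u + ?g u v" for u v
    by (cases u; cases v) (auto simp: adj_def same_gadget_adj_def simp del: att.simps(3))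
  have "cost2 \<phi> = (\<Sum>u\<in>?V. \<Sum>v\<in>?V. ?h u v) + (\<Sum>u\<in>?V. \<Sum>v\<in>?V. ?h v u) + (\<Sum>u\<in>?V. \<Sum>v\<in>?V. ?g u v)"
    unfolding cost2_def split by (simp only: sum.distrib)
  also have "(\<Sum>u\<in>?V. \<Sum>v\<in>?V. ?h u v) = (\<Sum>v\<in>?V. \<Sum>u\<in>?V. ?h u v)"
    by (rule sum.swap)
  also have "\<dots> = (\<Sum>v\<in>?V. hub_cost \<phi> v)"
    by (intro sum.cong refl sum_hubs_eq)
  also have "(\<Sum>u\<in>?V. \<Sum>v\<in>?V. ?g u v) = (\<Sum>u\<in>GV. \<Sum>v\<in>GV. ?g u v)"
    by (simp add: sum_verts sum_LV sum_HV same_gadget_adj_def del: sum_of_bool_eq)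
  also have "\<dots> = (\<Sum>j<length cs. \<Sum>\<sigma><q ^ 3. 2 * (K5_cost (\<lambda>a. \<phi> (Gad j \<sigma> a)) +
      (\<Sum>l<3. of_bool (\<phi> (Gad j \<sigma> l) = \<phi> (Gad j \<sigma> (l + 5))))))"
    unfolding sum_GV
  proof (intro sum.cong refl)
    fix j \<sigma> assume j: "j \<in> {..<length cs}" and \<sigma>: "\<sigma> \<in> {..<q ^ 3}"
    have "(\<Sum>j'<length cs. \<Sum>\<sigma>'<q ^ 3. \<Sum>b<8. ?g (Gad j \<sigma> a) (Gad j' \<sigma>' b)) =
      (\<Sum>b<8. of_bool (gadget_edge a b \<and> \<phi> (Gad j \<sigma> a) = \<phi> (Gad j \<sigma> b)))" for a
    proof -
      have "(\<Sum>j'<length cs. \<Sum>\<sigma>'<q ^ 3. \<Sum>b<8. ?g (Gad j \<sigma> a) (Gad j' \<sigma>' b)) =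
        (\<Sum>j'<length cs. if j' = j then \<Sum>\<sigma>'<q ^ 3. if \<sigma>' = \<sigma> then
          \<Sum>b<8. of_bool (gadget_edge a b \<and> \<phi> (Gad j \<sigma> a) = \<phi> (Gad j \<sigma> b)) else 0 else 0)"
      proof (intro sum.cong refl)
        fix j'
        show "(\<Sum>\<sigma>'<q ^ 3. \<Sum>b<8. ?g (Gad j \<sigma> a) (Gad j' \<sigma>' b)) = (if j' = j then \<Sum>\<sigma>'<q ^ 3. if \<sigma>' = \<sigma> then
          \<Sum>b<8. of_bool (gadget_edge a b \<and> \<phi> (Gad j \<sigma> a) = \<phi> (Gad j \<sigma> b)) else 0 else 0)"
        proof (cases "j' = j")
          case True
          have "(\<Sum>b<8. ?g (Gad j \<sigma> a) (Gad j \<sigma>' b)) =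
            (if \<sigma>' = \<sigma> then \<Sum>b<8. of_bool (gadget_edge a b \<and> \<phi> (Gad j \<sigma> a) = \<phi> (Gad j \<sigma> b)) else 0)" for \<sigma>'
            by (cases "\<sigma>' = \<sigma>") (simp_all add: same_gadget_adj_def del: sum_of_bool_eq)
          with True show ?thesis
            by (simp only: if_True simp_thms)
        qed (simp add: same_gadget_adj_def del: sum_of_bool_eq)
      qed
      also have "\<dots> = (\<Sum>b<8. of_bool (gadget_edge a b \<and> \<phi> (Gad j \<sigma> a) = \<phi> (Gad j \<sigma> b)))"
        using j \<sigma> by (simp only: sum.delta finite_lessThan if_True)
      finally show ?thesis .
    qed
    then show "(\<Sum>a<8. \<Sum>j'<length cs. \<Sum>\<sigma>'<q ^ 3. \<Sum>b<8. ?g (Gad j \<sigma> a) (Gad j' \<sigma>' b)) =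
      2 * (K5_cost (\<lambda>a. \<phi> (Gad j \<sigma> a)) + (\<Sum>l<3. of_bool (\<phi> (Gad j \<sigma> l) = \<phi> (Gad j \<sigma> (l + 5)))))"
      using gadget_edge_cost[of "\<lambda>a. \<phi> (Gad j \<sigma> a)"] by (simp del: sum_of_bool_eq)
  qed
  also have "(\<Sum>v\<in>?V. hub_cost \<phi> v) = (\<Sum>i<m. \<Sum>c<q. hub_cost \<phi> (Leaf i c)) +
      (\<Sum>j<length cs. \<Sum>\<sigma><q ^ 3. \<Sum>a<8. hub_cost \<phi> (Gad j \<sigma> a))"
    by (simp add: sum_verts sum_LV sum_HV sum_GV hub_cost_def del: sum_of_bool_eq att.simps(3))
  finally show ?thesis
    unfolding gcost_def sum.distrib sum_distrib_left[symmetric] by simp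
qed

definition falsified :: "(nat \<Rightarrow> nat) \<Rightarrow> literal list \<Rightarrow> bool" where
  "falsified r C \<longleftrightarrow> (\<forall>l<3. lit_false C l (r (lit_hub C l)))"

definition matches :: "(nat \<Rightarrow> nat) \<Rightarrow> nat \<Rightarrow> nat \<Rightarrow> nat \<Rightarrow> bool" where
  "matches r j \<sigma> l \<longleftrightarrow> lit_false (cs ! j) l (digit q l \<sigma>) \<and> r (lit_hub (cs ! j) l) = digit q l \<sigma>"

lemma all_less_3: "(\<forall>l<3. P l) \<longleftrightarrow> P 0 \<and> P 1 \<and> P (2::nat)"
  by (auto simp: eval_nat_numeral less_Suc_eq)

text \<open>\<open>matches\<close> compares a hub colour with a digit of \<open>\<sigma>\<close>, so
  all three can hold only for the number \<open>?s\<close> formed from the hub colours. A falsified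
  clause is therefore charged in exactly one gadget.\<close>

lemma sum_matches:
  assumes r: "\<And>h. h \<in> set hs \<Longrightarrow> r h < q" and j: "j < length cs"
  shows "(\<Sum>\<sigma><q ^ 3. of_bool (\<forall>l<3. matches r j \<sigma> l)) = (of_bool (falsified r (cs ! j)) :: nat)"
proof -
  let ?d = "\<lambda>l. r (lit_hub (cs ! j) l)"
  let ?s = "?d 0 + q * (?d 1 + q * ?d 2)"
  have d: "?d l < q" for l
    using r lit_hub_in[OF j] by blast
  have le: "a + q * b < q * B" if "a < q" "b < B" for a b B
  proof -
    have "a + q * b < q * (b + 1)"
      using that by simp
    also have "\<dots> \<le> q * B"
      using that by (intro mult_le_mono2) simp
    finally show ?thesis .
  qed
  have s: "?s < q ^ 3"
    using le[OF d le[OF d d], of 0 1 2] by (simp add: power3_eq_cube mult.assoc)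
  have "(\<forall>l<3. matches r j \<sigma> l) \<longleftrightarrow> \<sigma> = ?s \<and> falsified r (cs ! j)" if "\<sigma> < q ^ 3" for \<sigma>
    using base_digits[OF that d d d, of 0 1 2]
    by (auto simp: all_less_3 matches_def falsified_def digit_def)
  then have "(\<Sum>\<sigma><q ^ 3. of_bool (\<forall>l<3. matches r j \<sigma> l) :: nat) =
    (\<Sum>\<sigma><q ^ 3. if \<sigma> = ?s then of_bool (falsified r (cs ! j)) else 0)"
    by (intro sum.cong refl) auto
  then show ?thesis
    using s by (simp only: sum.delta finite_lessThan lessThan_iff if_True)
qed

end

section \<open>Cheapest deletion set of a gadget\<close>

context led_instance
begin

text \<open>Collects the edges through which the hub forces literal \<open>l\<close>; at most one of
  the two hub edges is present for a given \<open>\<sigma>\<close>.\<close>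

definition chain_cost :: "(vtx \<Rightarrow> nat) \<Rightarrow> nat \<Rightarrow> nat \<Rightarrow> nat \<Rightarrow> nat" where
  "chain_cost \<phi> j \<sigma> l = hub_cost \<phi> (Gad j \<sigma> l) + hub_cost \<phi> (Gad j \<sigma> (l + 5)) +
     of_bool (\<phi> (Gad j \<sigma> l) = \<phi> (Gad j \<sigma> (l + 5)))"

lemma gcost_alt: "gcost \<phi> j \<sigma> = K5_cost (\<lambda>a. \<phi> (Gad j \<sigma> a)) + (\<Sum>l<3. chain_cost \<phi> j \<sigma> l)"
proof -
  define h where "h a = hub_cost \<phi> (Gad j \<sigma> a)" for a
  have "h 3 = 0" "h 4 = 0"
    by (simp_all add: h_def hub_cost_def)
  then have "(\<Sum>a<8. h a) = (\<Sum>l<3. h l + h (l + 5))"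
    unfolding lessThan_8 lessThan_3 by simp
  then show ?thesis
    unfolding gcost_def chain_cost_def h_def sum.distrib by simp
qed

lemma hub_cost_low:
  assumes "l < 3" "j < length cs"
  shows "hub_cost \<phi> (Gad j \<sigma> l) = of_bool (digit q l \<sigma> = 0 \<and> lit_false (cs ! j) l 0 \<and>
    \<phi> (Hub (lit_hub (cs ! j) l)) = \<phi> (Gad j \<sigma> l))"
  using assms lit_hub_pos[OF assms(2), of l] by (auto simp: hub_cost_def pin_def)

lemma hub_cost_high:
  assumes "l < 3" "j < length cs"
  shows "hub_cost \<phi> (Gad j \<sigma> (l + 5)) = of_bool (digit q l \<sigma> \<noteq> 0 \<and> lit_false (cs ! j) l (digit q l \<sigma>) \<and>
    \<phi> (Hub (lit_hub (cs ! j) l)) = \<phi> (Gad j \<sigma> (l + 5)))"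
  using assms lit_hub_pos[OF assms(2), of l] by (auto simp: hub_cost_def pin_def)

text \<open>In the matching case, either all literal vertices have colour 2 and the K5 alone costs
  at least 6, or some literal has colour 1 although the hub forces it, and then its path to the hub
  contains a monochromatic edge besides the 4 of the K5.\<close>

lemma gcost_ge:
  assumes \<phi>: "list_col \<phi>" and j: "j < length cs" and \<sigma>: "\<sigma> < q ^ 3"
  shows "4 + of_bool (\<forall>l<3. matches (\<lambda>h. \<phi> (Hub h) - 1) j \<sigma> l) \<le> gcost \<phi> j \<sigma>"
proof -
  define g where "g a = \<phi> (Gad j \<sigma> a)" for a
  have g: "g a \<in> lst q (Gad j \<sigma> a)" if "a < 8" for a
    using \<phi> j \<sigma> that unfolding list_col_def set_verts GV_def g_def by (force simp del: lst.simps)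
  have K: "4 + 2 * of_bool (g 0 = 2 \<and> g 1 = 2 \<and> g 2 = 2) \<le> K5_cost g"
    using g[of 0] g[of 1] g[of 2] g[of 3] g[of 4] by (intro K5_cost_ge) simp_all
  have alt: "gcost \<phi> j \<sigma> = K5_cost g + (\<Sum>l<3. chain_cost \<phi> j \<sigma> l)"
    using gcost_alt[of \<phi> j \<sigma>] by (simp add: g_def[abs_def])
  show ?thesis
  proof (cases "(\<forall>l<3. matches (\<lambda>h. \<phi> (Hub h) - 1) j \<sigma> l) \<and> \<not> (g 0 = 2 \<and> g 1 = 2 \<and> g 2 = 2)")
    case False
    then show ?thesis
      using K alt by (auto split: if_splits)
  next
    case True
    then obtain l where l: "l < 3" "g l \<noteq> 2"
      by (metis one_less_numeral_iff semiring_norm(77) zero_less_numeral numeral_less_iff semiring_norm(81) lessI numeral_3_eq_3 numeral_2_eq_2)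
    then have gl: "g l = 1"
      using g[of l] by simp
    have mt: "lit_false (cs ! j) l (digit q l \<sigma>)" "\<phi> (Hub (lit_hub (cs ! j) l)) - 1 = digit q l \<sigma>"
      using True l by (auto simp: matches_def)
    have "\<phi> (Hub (lit_hub (cs ! j) l)) \<in> lst q (Hub (lit_hub (cs ! j) l))"
      using \<phi> lit_hub_in[OF j, of l] by (auto simp: list_col_def set_verts HV_def simp del: lst.simps)
    with mt have hub: "\<phi> (Hub (lit_hub (cs ! j) l)) = Suc (digit q l \<sigma>)"
      by auto
    have w: "g (l + 5) = 1 \<or> g (l + 5) = max 2 (Suc (digit q l \<sigma>))"
      using g[of "l + 5"] l by simp
    \<comment> \<open>For digit 0 the direct edge to the hub is violated. Otherwise the relay agrees
      either with the literal, having colour 1, or with the hub vertex.\<close>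
    have "1 \<le> chain_cost \<phi> j \<sigma> l"
      using w mt gl hub
      unfolding chain_cost_def hub_cost_low[OF l(1) j] hub_cost_high[OF l(1) j] g_def
      by (cases "digit q l \<sigma> = 0") (auto simp: max_def split: if_splits)
    also have "\<dots> \<le> (\<Sum>l<3. chain_cost \<phi> j \<sigma> l)"
      using l by (intro member_le_sum) auto
    finally show ?thesis
      using K alt by auto
  qed
qed

text \<open>If all three literals are forced, it is cheaper to violate the edge that forces literal 0 than to
  make the \<open>K\<^sub>5\<close> unbalanced.\<close>

definition forced :: "(nat \<Rightarrow> nat) \<Rightarrow> nat \<Rightarrow> nat \<Rightarrow> nat \<Rightarrow> bool" where
  "forced r j \<sigma> l \<longleftrightarrow> matches r j \<sigma> l \<and> \<not> (l = 0 \<and> (\<forall>l<3. matches r j \<sigma> l))"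

text \<open>The cheapest extension of the hub colours \<open>r\<close>. Vertex 3 balances the K5:
  two forced literals and vertex 4 already make three vertices of colour 2, so it then takes colour
  1, and otherwise colour 2.\<close>

fun col :: "(nat \<Rightarrow> nat) \<Rightarrow> vtx \<Rightarrow> nat" where
  "col r (Leaf i c) = Suc c"
| "col r (Hub h) = Suc (r h)"
| "col r (Gad j \<sigma> a) =
    (if a < 3 then (if forced r j \<sigma> a then 2 else 1)
     else if a = 3 then
       (if forced r j \<sigma> 0 \<and> forced r j \<sigma> 1 \<or> forced r j \<sigma> 0 \<and> forced r j \<sigma> 2 \<or> forced r j \<sigma> 1 \<and> forced r j \<sigma> 2 then 1 else 2)
     else if a = 4 then 2
     else if forced r j \<sigma> (a - 5) then 1 else max 2 (Suc (digit q (a - 5) \<sigma>)))"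

lemma list_col_col:
  assumes "\<And>h. h \<in> set hs \<Longrightarrow> r h < q"
  shows "list_col (col r)"
  using assms by (auto simp: list_col_def set_verts LV_def HV_def GV_def Suc_le_eq)

text \<open>\<open>forced\<close> never holds for all three literals, so the K5 splits
  \<open>3 : 2\<close>. A path costs something only if its literal matches without being forced,
  that is, for literal 0 when everything matches.\<close>

lemma gcost_col:
  assumes j: "j < length cs"
  shows "gcost (col r) j \<sigma> = 4 + of_bool (\<forall>l<3. matches r j \<sigma> l)"
proof -
  have "\<not> (forced r j \<sigma> 0 \<and> forced r j \<sigma> 1 \<and> forced r j \<sigma> 2)"
    by (auto simp: forced_def all_less_3)
  then have K: "K5_cost (\<lambda>a. col r (Gad j \<sigma> a)) = 4"
    unfolding K5_cost_def
    by (cases "forced r j \<sigma> 0"; cases "forced r j \<sigma> 1"; cases "forced r j \<sigma> 2") simp_all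
  have "chain_cost (col r) j \<sigma> l = of_bool (l = 0 \<and> (\<forall>l<3. matches r j \<sigma> l))" if l: "l < 3" for l
  proof (cases "forced r j \<sigma> l")
    case True
    then show ?thesis
      using l unfolding chain_cost_def hub_cost_low[OF l j] hub_cost_high[OF l j]
      by (auto simp: forced_def matches_def)
  next
    case False
    have iff: "l = 0 \<and> (\<forall>l<3. matches r j \<sigma> l) \<longleftrightarrow> matches r j \<sigma> l"
      using False l by (auto simp: forced_def)
    show ?thesis
      using l False unfolding chain_cost_def hub_cost_low[OF l j] hub_cost_high[OF l j] iff
      by (cases "digit q l \<sigma> = 0") (auto simp: matches_def max_def)
  qed
  then have "(\<Sum>l<3. chain_cost (col r) j \<sigma> l) = (\<Sum>l<3::nat. if l = 0 then of_bool (\<forall>l<3. matches r j \<sigma> l) else 0)"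
    by (intro sum.cong refl) auto
  then show ?thesis
    unfolding gcost_alt K by (simp only: sum.delta finite_lessThan) simp
qed

text \<open>The lists of the pendant vertices of \<open>i\<close> are the \<open>q\<close> single
  colours, so exactly one of them agrees with the hub vertex, whatever its colour. The cost is
  constant, and the deleted edge names the colour.\<close>

lemma sum_leaf_cost:
  assumes i: "i < m" and \<phi>: "\<phi> (Hub (blk i)) \<in> {1..q}" "\<And>c. c < q \<Longrightarrow> \<phi> (Leaf i c) = Suc c"
  shows "(\<Sum>c<q. hub_cost \<phi> (Leaf i c)) = 1"
proof -
  have "(\<Sum>c<q. hub_cost \<phi> (Leaf i c)) = (\<Sum>c<q. if c = \<phi> (Hub (blk i)) - 1 then 1 else 0)"
    using \<phi> blk_pos[OF i] by (intro sum.cong refl) (auto simp: hub_cost_def)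
  also have "\<dots> = 1"
    using \<phi> by (auto simp: sum.delta)
  finally show ?thesis .
qed

definition viol :: "(nat \<Rightarrow> nat) \<Rightarrow> nat" where
  "viol r = (\<Sum>j<length cs. of_bool (falsified r (cs ! j)))"

definition base_cost :: nat where
  "base_cost = m + length cs * (q ^ 3 * 4)"

lemma list_col_Hub: "list_col \<phi> \<Longrightarrow> h \<in> set hs \<Longrightarrow> \<phi> (Hub h) \<in> {1..q}"
  using lst.simps(2) unfolding list_col_def set_verts HV_def by blast

lemma list_col_Leaf: "list_col \<phi> \<Longrightarrow> i < m \<Longrightarrow> c < q \<Longrightarrow> \<phi> (Leaf i c) = Suc c"
  unfolding list_col_def set_verts LV_def by force

text \<open>Sums the gadget minima; by \<open>sum_matches\<close> the excess over all triples of a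
  clause is 1 exactly if the hub colours falsify the clause.\<close>

lemma cost2_ge:
  assumes \<phi>: "list_col \<phi>"
  shows "2 * (base_cost + viol (\<lambda>h. \<phi> (Hub h) - 1)) \<le> cost2 \<phi>"
proof -
  let ?r = "\<lambda>h. \<phi> (Hub h) - 1"
  have r: "?r h < q" if "h \<in> set hs" for h
    using list_col_Hub[OF \<phi> that] by auto
  have "(\<Sum>i<m. \<Sum>c<q. hub_cost \<phi> (Leaf i c)) = m"
    using sum_leaf_cost list_col_Hub[OF \<phi>] list_col_Leaf[OF \<phi>] blk by simp
  moreover have "length cs * (q ^ 3 * 4) + viol ?r \<le> (\<Sum>j<length cs. \<Sum>\<sigma><q ^ 3. gcost \<phi> j \<sigma>)"
  proof -
    have "length cs * (q ^ 3 * 4) + viol ?r = (\<Sum>j<length cs. q ^ 3 * 4 + of_bool (falsified ?r (cs ! j)))"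
      by (simp only: viol_def sum.distrib sum_constant card_lessThan) simp
    also have "\<dots> = (\<Sum>j<length cs. \<Sum>\<sigma><q ^ 3. 4 + of_bool (\<forall>l<3. matches ?r j \<sigma> l))"
    proof (intro sum.cong refl)
      fix j assume "j \<in> {..<length cs}"
      then have "(\<Sum>\<sigma><q ^ 3. of_bool (\<forall>l<3. matches ?r j \<sigma> l)) = (of_bool (falsified ?r (cs ! j)) :: nat)"
        using r by (intro sum_matches) auto
      then show "q ^ 3 * 4 + of_bool (falsified ?r (cs ! j)) =
        (\<Sum>\<sigma><q ^ 3. 4 + of_bool (\<forall>l<3. matches ?r j \<sigma> l))"
        by (simp only: sum.distrib sum_constant card_lessThan) simp
    qed
    also have "\<dots> \<le> (\<Sum>j<length cs. \<Sum>\<sigma><q ^ 3. gcost \<phi> j \<sigma>)"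
      using gcost_ge[OF \<phi>] by (intro sum_mono) auto
    finally show ?thesis .
  qed
  ultimately show ?thesis
    by (simp add: cost2_eq base_cost_def)
qed

lemma cost2_col:
  assumes r: "\<And>h. h \<in> set hs \<Longrightarrow> r h < q"
  shows "cost2 (col r) = 2 * (base_cost + viol r)"
proof -
  have \<phi>: "list_col (col r)"
    using r by (rule list_col_col)
  have "(\<Sum>i<m. \<Sum>c<q. hub_cost (col r) (Leaf i c)) = m"
    using sum_leaf_cost list_col_Hub[OF \<phi>] list_col_Leaf[OF \<phi>] blk by simp
  moreover have "(\<Sum>j<length cs. \<Sum>\<sigma><q ^ 3. gcost (col r) j \<sigma>) = length cs * (q ^ 3 * 4) + viol r"
  proof -
    have "(\<Sum>\<sigma><q ^ 3. gcost (col r) j \<sigma>) = q ^ 3 * 4 + of_bool (falsified r (cs ! j))"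
      if j: "j < length cs" for j
    proof -
      have "(\<Sum>\<sigma><q ^ 3. of_bool (\<forall>l<3. matches r j \<sigma> l)) = (of_bool (falsified r (cs ! j)) :: nat)"
        using r j by (intro sum_matches) auto
      then show ?thesis
        by (simp only: gcost_col[OF j] sum.distrib sum_constant card_lessThan) simp
    qed
    then show ?thesis
      unfolding viol_def by (simp add: sum.distrib del: sum_of_bool_eq)
  qed
  ultimately show ?thesis
    by (simp add: cost2_eq base_cost_def)
qed

section \<open>The instance on numbered vertices\<close>

definition edges :: "nat set set" where
  "edges = {{i, k} | i k. i < N \<and> k < N \<and> adj (verts ! i) (verts ! k)}"

definition lists :: "nat \<Rightarrow> nat set" where
  "lists i = lst q (verts ! i)"

definition hub :: "nat set" where
  "hub = {i. i < N \<and> hubno (verts ! i) \<noteq> 0}"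

lemma edge_iff: "i < N \<Longrightarrow> k < N \<Longrightarrow> {i, k} \<in> edges \<longleftrightarrow> adj (verts ! i) (verts ! k)"
  unfolding edges_def using adj_sym by (auto simp: doubleton_eq_iff)

lemma simple_graph_edges: "simple_graph {..<N} edges"
  unfolding simple_graph_def
proof
  show "edges \<subseteq> {{u, v} | u v. u \<in> {..<N} \<and> v \<in> {..<N} \<and> u \<noteq> v}"
  proof
    fix e assume "e \<in> edges"
    then obtain i k where e: "e = {i, k}" "i < N" "k < N" "adj (verts ! i) (verts ! k)"
      by (auto simp: edges_def)
    then have "i \<noteq> k"
      using not_adj_self by metis
    with e show "e \<in> {{u, v} | u v. u \<in> {..<N} \<and> v \<in> {..<N} \<and> u \<noteq> v}"
      by blast
  qed
qed simp

lemma lists_subset: "i < N \<Longrightarrow> lists i \<subseteq> {1..q}"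
proof -
  assume "i < N"
  then have "verts ! i \<in> LV \<union> (HV \<union> GV)"
    using set_verts nth_mem by blast
  then show ?thesis
    using q2 digit_less by (auto simp: lists_def LV_def HV_def GV_def Suc_le_eq split: if_splits)
qed

lemma sum_index: "(\<Sum>i<N. f (verts ! i)) = (\<Sum>v\<in>set verts. f v)"
  using sum.reindex_bij_betw[OF bij_betw_nth[OF distinct_verts refl refl], of f] .

lemma mono_edge_iff:
  assumes "i < N" "k < N"
  shows "{i, k} \<in> mono_edges edges \<phi> \<longleftrightarrow> adj (verts ! i) (verts ! k) \<and> \<phi> i = \<phi> k"
  using edge_iff[OF assms] by (auto simp: mono_edges_def doubleton_eq_iff)

lemma sum_mono_edges:
  "(\<Sum>i<N. \<Sum>k<N. of_bool ({i, k} \<in> mono_edges edges (\<lambda>i. \<psi> (verts ! i)))) = cost2 \<psi>"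
proof -
  have "cost2 \<psi> = (\<Sum>i<N. \<Sum>k<N.
      of_bool (adj (verts ! i) (verts ! k) \<and> \<psi> (verts ! i) = \<psi> (verts ! k)))"
    unfolding cost2_def sum_index[symmetric] ..
  also have "\<dots> = (\<Sum>i<N. \<Sum>k<N. of_bool ({i, k} \<in> mono_edges edges (\<lambda>i. \<psi> (verts ! i))))"
    by (intro sum.cong refl) (simp add: mono_edge_iff)
  finally show ?thesis ..
qed

lemma sum_pairs_edges:
  "X \<subseteq> edges \<Longrightarrow> (\<Sum>i<N. \<Sum>k<N. of_bool ({i, k} \<in> X)) = 2 * card X"
  using simple_graph_edges by (intro sum_ordered_pairs_eq) (auto simp: simple_graph_def)

lemma card_mono_edges: "2 * card (mono_edges edges (\<lambda>i. \<psi> (verts ! i))) = cost2 \<psi>"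
  unfolding sum_mono_edges[symmetric]
  by (rule sum_pairs_edges[symmetric]) (auto simp: mono_edges_def)

lemma feasible_col:
  assumes r: "\<And>h. h \<in> set hs \<Longrightarrow> r h < q"
  shows "i \<in> {..<N} \<Longrightarrow> col r (verts ! i) \<in> lists i"
  using list_col_col[OF r] unfolding list_col_def lists_def by simp

lemma ex_feasible: "\<exists>X. LED_feasible {..<N} edges lists X"
  using feasible_col[of "\<lambda>_. 0"] q2
  by (intro exI[of _ "mono_edges edges (\<lambda>i. col (\<lambda>_. 0) (verts ! i))"] LED_feasible_mono_edges) auto

text \<open>The colourings \<open>col r'\<close> attain the lower bound \<open>cost2_ge\<close>, so
  the hub colours of an optimal colouring minimise \<open>viol\<close>, and the size of
  \<open>X\<close> is known exactly.\<close>

lemma optimal_deletion: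
  assumes X: "LED_optimal {..<N} edges lists X"
  obtains r where "\<And>h. h \<in> set hs \<Longrightarrow> r h < q"
    "\<And>k i c. k < N \<Longrightarrow> verts ! k = Leaf i c \<Longrightarrow> (\<exists>k'<N. {k, k'} \<in> X) \<longleftrightarrow> r (blk i) = c"
    "(\<Sum>i<N. \<Sum>k<N. of_bool ({i, k} \<in> X)) = 2 * (base_cost + viol r)"
    "\<forall>r'. (\<forall>h\<in>set hs. r' h < q) \<longrightarrow> viol r \<le> viol r'"
proof -
  obtain \<phi> where \<phi>: "\<And>i. i \<in> {..<N} \<Longrightarrow> \<phi> i \<in> lists i" "X = mono_edges edges \<phi>"
    and min: "\<And>\<psi>. (\<And>i. i \<in> {..<N} \<Longrightarrow> \<psi> i \<in> lists i) \<Longrightarrow> card X \<le> card (mono_edges edges \<psi>)"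
    using LED_optimal_mono_edges[OF simple_graph_edges X] by metis
  \<comment> \<open>Carries the colouring over from positions to vertices; \<open>verts\<close> is
    distinct.\<close>
  define \<psi> where "\<psi> v = \<phi> (the_inv_into {..<N} (nth verts) v)" for v
  have inj: "inj_on (nth verts) {..<N}"
    using distinct_verts by (simp add: inj_on_nth)
  have \<psi>: "\<psi> (verts ! i) = \<phi> i" if "i < N" for i
    using that by (simp add: \<psi>_def the_inv_into_f_f[OF inj])
  \<comment> \<open>\<open>\<phi>\<close> is arbitrary beyond the positions below \<open>N\<close>,
    but the ends of edges are such positions, where both colourings agree.\<close>
  have "mono_edges edges \<phi> = mono_edges edges (\<lambda>i. \<psi> (verts ! i))"
  proof -
    have eq: "(\<exists>u v. e = {u, v} \<and> \<phi> u = \<phi> v) \<longleftrightarrow> (\<exists>u v. e = {u, v} \<and> \<psi> (verts ! u) = \<psi> (verts ! v))"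
      if "e \<in> edges" for e
    proof -
      have "u < N \<and> v < N" if "e = {u, v}" for u v
        using \<open>e \<in> edges\<close> that by (auto simp: edges_def doubleton_eq_iff)
      then show ?thesis
        using \<psi> by metis
    qed
    show ?thesis
      unfolding mono_edges_def by (intro Collect_cong conj_cong refl eq)
  qed
  with \<phi> have X': "X = mono_edges edges (\<lambda>i. \<psi> (verts ! i))"
    by simp
  have lc: "list_col \<psi>"
    using \<phi>(1) \<psi> by (auto simp: list_col_def in_set_conv_nth lists_def)
  let ?r = "\<lambda>h. \<psi> (Hub h) - 1"
  have r: "?r h < q" if "h \<in> set hs" for h
    using list_col_Hub[OF lc that] by auto
  have le: "cost2 \<psi> \<le> 2 * (base_cost + viol r')" if "\<And>h. h \<in> set hs \<Longrightarrow> r' h < q" for r'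
  proof -
    have "card X \<le> card (mono_edges edges (\<lambda>i. col r' (verts ! i)))"
      using that by (intro min feasible_col)
    then have "cost2 \<psi> \<le> cost2 (col r')"
      unfolding card_mono_edges[symmetric] X' by simp
    then show ?thesis
      using cost2_col[OF that] by simp
  qed
  show thesis
  proof (rule that[of ?r])
    show "?r h < q" if "h \<in> set hs" for h
      using r that .
    show "(\<Sum>i<N. \<Sum>k<N. of_bool ({i, k} \<in> X)) = 2 * (base_cost + viol ?r)"
    proof -
      have "cost2 \<psi> \<le> 2 * (base_cost + viol ?r)"
        using r by (rule le)
      with cost2_ge[OF lc] show ?thesis
        unfolding X' sum_mono_edges by simp
    qed
    show "\<forall>r'. (\<forall>h\<in>set hs. r' h < q) \<longrightarrow> viol ?r \<le> viol r'"
    proof (intro allI impI)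
      fix r' assume "\<forall>h\<in>set hs. r' h < q"
      then have "cost2 \<psi> \<le> 2 * (base_cost + viol r')"
        by (intro le) blast
      with cost2_ge[OF lc] show "viol ?r \<le> viol r'"
        by simp
    qed
    fix k i c
    assume k: "k < N" "verts ! k = Leaf i c"
    then have "Leaf i c \<in> set verts"
      by (metis nth_mem)
    then have ic: "i < m" "c < q"
      by (auto simp: set_verts LV_def HV_def GV_def)
    have hub: "\<psi> (Hub (blk i)) \<in> {1..q}"
      using list_col_Hub[OF lc blk[OF ic(1)]] .
    have "(\<exists>k'<N. {k, k'} \<in> X) \<longleftrightarrow> (\<exists>v\<in>set verts. adj (Leaf i c) v \<and> Suc c = \<psi> v)"
    proof -
      have "{k, k'} \<in> X \<longleftrightarrow> adj (Leaf i c) (verts ! k') \<and> Suc c = \<psi> (verts ! k')" if "k' < N" for k'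
        unfolding X' using mono_edge_iff[OF k(1) that] k(2) list_col_Leaf[OF lc ic] by simp
      then show ?thesis
        by (metis in_set_conv_nth)
    qed
    also have "\<dots> \<longleftrightarrow> \<psi> (Hub (blk i)) = Suc c"
    proof
      assume "\<exists>v\<in>set verts. adj (Leaf i c) v \<and> Suc c = \<psi> v"
      then obtain v where v: "adj (Leaf i c) v" "Suc c = \<psi> v"
        by blast
      from v(1) have "v = Hub (blk i)"
        by (cases v) (auto simp: adj_def same_gadget_adj_def)
      with v show "\<psi> (Hub (blk i)) = Suc c"
        by simp
    next
      assume "\<psi> (Hub (blk i)) = Suc c"
      moreover have "adj (Leaf i c) (Hub (blk i))"
        using blk_pos[OF ic(1)] by (simp add: adj_def)
      moreover have "Hub (blk i) \<in> set verts"
        using blk[OF ic(1)] by (simp add: set_verts HV_def)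
      ultimately show "\<exists>v\<in>set verts. adj (Leaf i c) v \<and> Suc c = \<psi> v"
        by metis
    qed
    also have "\<dots> \<longleftrightarrow> \<psi> (Hub (blk i)) - 1 = c"
      using hub by auto
    finally show "(\<exists>k'<N. {k, k'} \<in> X) \<longleftrightarrow> \<psi> (Hub (blk i)) - 1 = c" .
  qed
qed

section \<open>Size of the hub and of the remaining components\<close>

lemma card_hub: "card hub = length hs"
proof -
  have "bij_betw (nth verts) hub HV"
    unfolding bij_betw_def
  proof
    show "inj_on (nth verts) hub"
      using distinct_verts by (intro inj_on_nth) (auto simp: hub_def)
    have hubno: "hubno v \<noteq> 0 \<longleftrightarrow> v \<in> HV" if "v \<in> set verts" for v
    proof -
      have "v \<in> LV \<union> (HV \<union> GV)"
        using that by (simp only: set_verts)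
      moreover have "h \<noteq> 0" if "h \<in> set hs" for h
        using that hs(2) by metis
      ultimately show ?thesis
        by (auto simp: LV_def HV_def GV_def)
    qed
    show "nth verts ` hub = HV"
    proof
      show "nth verts ` hub \<subseteq> HV"
        using hubno by (auto simp: hub_def)
      show "HV \<subseteq> nth verts ` hub"
      proof
        fix v assume v: "v \<in> HV"
        then have "v \<in> set verts"
          by (simp add: set_verts)
        then obtain i where "i < N" "v = verts ! i"
          by (metis in_set_conv_nth)
        with v hubno \<open>v \<in> set verts\<close> show "v \<in> nth verts ` hub"
          by (auto simp: hub_def)
      qed
    qed
  qed
  then have "card hub = card HV"
    by (rule bij_betw_same_card)
  also have "\<dots> = length hs"
    using hs(1) by (simp add: HV_def card_image inj_on_def distinct_card)
  finally show ?thesis .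
qed

text \<open>Edges between vertices outside the hub stay within a cell, so cells bound the
  components: a single pendant vertex or a whole gadget. The first number only keeps the kinds
  apart.\<close>

fun cell :: "vtx \<Rightarrow> nat \<times> nat \<times> nat" where
  "cell (Leaf i c) = (0, i, c)"
| "cell (Hub h) = (1, h, 0)"
| "cell (Gad j \<sigma> a) = (2, j, \<sigma>)"

lemma adj_cell: "adj u v \<Longrightarrow> hubno u = 0 \<Longrightarrow> hubno v = 0 \<Longrightarrow> cell u = cell v"
  by (auto simp: adj_def same_gadget_adj_def)

lemma card_cell: "card {v \<in> set verts. cell v = cell u} \<le> 8"
proof -
  have "{v \<in> set verts. cell v = cell u} \<subseteq> (case u of Leaf i c \<Rightarrow> {Leaf i c} | Hub h \<Rightarrow> {Hub h}
    | Gad j \<sigma> a \<Rightarrow> Gad j \<sigma> ` {..<8})"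
  proof
    fix v assume "v \<in> {v \<in> set verts. cell v = cell u}"
    then show "v \<in> (case u of Leaf i c \<Rightarrow> {Leaf i c} | Hub h \<Rightarrow> {Hub h} | Gad j \<sigma> a \<Rightarrow> Gad j \<sigma> ` {..<8})"
      by (cases u; cases v) (auto simp: set_verts LV_def HV_def GV_def)
  qed
  then have "card {v \<in> set verts. cell v = cell u} \<le>
      card (case u of Leaf i c \<Rightarrow> {Leaf i c} | Hub h \<Rightarrow> {Hub h} | Gad j \<sigma> a \<Rightarrow> Gad j \<sigma> ` {..<8})"
    by (intro card_mono) (auto split: vtx.split)
  also have "\<dots> \<le> 8"
    by (auto split: vtx.split simp: card_image inj_on_def)
  finally show ?thesis .
qed

text \<open>A gadget has six places for a hub edge, but for each literal the digit decides between
  the literal vertex and its relay. Three hub neighbours remain.\<close>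

lemma card_cell_att: "card {att v | v. cell v = cell u \<and> v \<in> set verts \<and> hubno v = 0 \<and> att v \<noteq> 0} \<le> 3"
proof -
  let ?S = "{att v | v. cell v = cell u \<and> v \<in> set verts \<and> hubno v = 0 \<and> att v \<noteq> 0}"
  have "\<exists>f. ?S \<subseteq> f ` {..<3::nat}"
  proof (cases u)
    case (Leaf i c)
    have "?S \<subseteq> (\<lambda>_. blk i) ` {..<3::nat}"
    proof
      fix h assume "h \<in> ?S"
      then obtain v where v: "h = att v" "cell v = cell u"
        by blast
      then have "h = blk i"
        using Leaf by (cases v) auto
      then show "h \<in> (\<lambda>_. blk i) ` {..<3::nat}"
        using image_eqI[of h "\<lambda>_. blk i" "0::nat" "{..<3}"] by simp
    qed
    then show ?thesis by blast
  next
    case (Hub k)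
    have "?S \<subseteq> {}"
    proof
      fix h assume "h \<in> ?S"
      then obtain v where v: "h = att v" "cell v = cell u" "att v \<noteq> 0"
        by blast
      then show "h \<in> {}"
        using Hub by (cases v) auto
    qed
    then show ?thesis by blast
  next
    case (Gad j \<sigma> a)
    have "?S \<subseteq> (\<lambda>l. pin (cs ! j) l (digit q l \<sigma>)) ` {..<3::nat}"
    proof
      fix h assume "h \<in> ?S"
      then obtain v where v: "h = att v" "cell v = cell u" "att v \<noteq> 0" "v \<in> set verts"
        by blast
      then obtain b where b: "v = Gad j \<sigma> b"
        using Gad by (cases v) auto
      then have "b < 8"
        using v by (auto simp: set_verts LV_def HV_def GV_def)
      have "(b < 3 \<and> h = pin (cs ! j) b (digit q b \<sigma>)) \<or> (5 \<le> b \<and> b - 5 < 3 \<and> h = pin (cs ! j) (b - 5) (digit q (b - 5) \<sigma>))"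
      proof (cases "b < 3 \<and> digit q b \<sigma> = 0")
        case True
        then show ?thesis
          using v(1) b by simp
      next
        case False
        then have h: "h = (if 5 \<le> b \<and> digit q (b - 5) \<sigma> \<noteq> 0 then pin (cs ! j) (b - 5) (digit q (b - 5) \<sigma>) else 0)"
          using v(1) b by (simp only: att.simps if_False)
        with v(1,3) have "5 \<le> b \<and> digit q (b - 5) \<sigma> \<noteq> 0"
          by (metis (full_types))
        with h \<open>b < 8\<close> show ?thesis
          by simp
      qed
      then show "h \<in> (\<lambda>l. pin (cs ! j) l (digit q l \<sigma>)) ` {..<3::nat}"
        by auto
    qed
    then show ?thesis by blast
  qed
  then obtain f where "?S \<subseteq> f ` {..<3::nat}"
    by blast
  then have "card ?S \<le> card (f ` {..<3})"
    by (intro card_mono) auto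
  also have "\<dots> \<le> 3"
    using card_image_le[of "{..<3}" f] by simp
  finally show ?thesis .
qed

lemma is_hub_hub: "is_hub 8 3 {..<N} edges hub"
  unfolding is_hub_def
proof (intro conjI ballI)
  show "hub \<subseteq> {..<N}"
    by (auto simp: hub_def)
next
  fix C assume "C \<in> components ({..<N} - hub) edges"
  then obtain i where i: "i \<in> {..<N} - hub"
    and C: "C = (adj_on ({..<N} - hub) edges)\<^sup>* `` {i}"
    by (auto simp: components_def quotient_def)
  \<comment> \<open>A path that avoids the hub cannot leave its cell.\<close>
  have inC: "k < N \<and> hubno (verts ! k) = 0 \<and> cell (verts ! k) = cell (verts ! i)" if "k \<in> C" for k
  proof -
    from that C have "(i, k) \<in> (adj_on ({..<N} - hub) edges)\<^sup>*"
      by simp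
    then show ?thesis
    proof (induction rule: rtrancl_induct)
      case base
      then show ?case using i by (auto simp: hub_def)
    next
      case (step k k')
      then have "k' \<in> {..<N} - hub" "k \<in> {..<N} - hub" "{k, k'} \<in> edges"
        by (auto simp: adj_on_def)
      then show ?case
        using step.IH adj_cell[of "verts ! k" "verts ! k'"] edge_iff[of k k'] by (auto simp: hub_def)
    qed
  qed
  have inj: "inj_on (nth verts) A" if "A \<subseteq> {..<N}" for A
    using that distinct_verts by (intro inj_on_nth) auto
  have C_sub: "C \<subseteq> {..<N}"
    using inC by auto
  have "card C = card (nth verts ` C)"
    using inj[OF C_sub] by (simp add: card_image)
  also have "\<dots> \<le> card {v \<in> set verts. cell v = cell (verts ! i)}"
    using inC by (intro card_mono) auto
  also have "\<dots> \<le> 8"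
    by (rule card_cell)
  finally show "card C \<le> 8" .
  let ?Q = "{v \<in> hub. \<exists>u\<in>C. {u, v} \<in> edges}"
  let ?S = "{att v | v. cell v = cell (verts ! i) \<and> v \<in> set verts \<and> hubno v = 0 \<and> att v \<noteq> 0}"
  have "?Q \<subseteq> {..<N}"
    by (auto simp: hub_def)
  then have "card ?Q = card (nth verts ` ?Q)"
    using inj by (simp add: card_image)
  also have "\<dots> \<le> card (Hub ` ?S)"
  proof (rule card_mono)
    have "?S \<subseteq> att ` set verts"
      by blast
    then show "finite (Hub ` ?S)"
      using finite_subset by blast
    show "nth verts ` ?Q \<subseteq> Hub ` ?S"
    proof
      fix v assume "v \<in> nth verts ` ?Q"
      then obtain k u where k: "v = verts ! k" "k \<in> hub" "u \<in> C" "{u, k} \<in> edges"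
        by blast
      note u = inC[OF k(3)]
      have kl: "k < N" "hubno (verts ! k) \<noteq> 0"
        using k by (auto simp: hub_def)
      then obtain h where h: "verts ! k = Hub h" "h \<noteq> 0"
        by (cases "verts ! k") auto
      have "adj (verts ! u) (verts ! k)"
        using k kl u edge_iff by blast
      then have "att (verts ! u) = h"
        using u h by (auto simp: adj_def same_gadget_adj_def)
      then have "h \<in> ?S"
        using u h by (auto intro!: exI[of _ "verts ! u"])
      then show "v \<in> Hub ` ?S"
        using k h by blast
    qed
  qed
  also have "\<dots> \<le> 3"
    using card_cell_att[of "verts ! i"] by (simp add: card_image inj_on_def)
  finally show "card ?Q \<le> 3" .
qed

end

section \<open>Computing the instance\<close>

text \<open>A vertex is described by its list, its hub number, the hub vertex adjacent to it, its clause (as the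
  length of the remaining clause list), colour triple and role in the gadget, and the row of its role in
  the adjacency matrix of the gadget.\<close>

definition desc :: "tree \<Rightarrow> tree \<Rightarrow> tree \<Rightarrow> tree \<Rightarrow> tree \<Rightarrow> tree \<Rightarrow> tree \<Rightarrow> tree" where
  "desc ls hb ac gr sg rl rw = Pr ls (Pr hb (Pr ac (Pr gr (Pr sg (Pr rl rw)))))"

definition d_lst :: "tree \<Rightarrow> tree" where "d_lst u = hd_tree u"
definition d_hub :: "tree \<Rightarrow> tree" where "d_hub u = hd_tree (tl_tree u)"
definition d_att :: "tree \<Rightarrow> tree" where "d_att u = hd_tree (tl_tree (tl_tree u))"
definition d_grp :: "tree \<Rightarrow> tree" where "d_grp u = hd_tree (tl_tree (tl_tree (tl_tree u)))"
definition d_sig :: "tree \<Rightarrow> tree" where "d_sig u = hd_tree (tl_tree (tl_tree (tl_tree (tl_tree u))))"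
definition d_role :: "tree \<Rightarrow> tree" where
  "d_role u = hd_tree (tl_tree (tl_tree (tl_tree (tl_tree (tl_tree u)))))"
definition d_row :: "tree \<Rightarrow> tree" where
  "d_row u = tl_tree (tl_tree (tl_tree (tl_tree (tl_tree (tl_tree u)))))"

lemmas d_defs = d_lst_def d_hub_def d_att_def d_grp_def d_sig_def d_role_def d_row_def

lemma d_desc [simp]:
  "d_lst (desc ls hb ac gr sg rl rw) = ls" "d_hub (desc ls hb ac gr sg rl rw) = hb"
  "d_att (desc ls hb ac gr sg rl rw) = ac" "d_grp (desc ls hb ac gr sg rl rw) = gr"
  "d_sig (desc ls hb ac gr sg rl rw) = sg" "d_role (desc ls hb ac gr sg rl rw) = rl"
  "d_row (desc ls hb ac gr sg rl rw) = rw"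
  by (simp_all add: desc_def d_defs)

text \<open>Only emptiness can be tested, so numbers are compared by length. Outside gadgets both
  the row and the clause list are empty, so the last disjunct fails there.\<close>

definition adjt :: "tree \<Rightarrow> tree \<Rightarrow> bool" where
  "adjt u v \<longleftrightarrow> d_hub u \<noteq> Nl \<and> len (d_hub u) = len (d_att v) \<or>
     d_hub v \<noteq> Nl \<and> len (d_hub v) = len (d_att u) \<or>
     len (d_grp u) = len (d_grp v) \<and> len (d_sig u) = len (d_sig v) \<and>
       hd_tree (dropt (d_role v) (d_row u)) \<noteq> Nl"

lemma polytest_adjt: "polytime f \<Longrightarrow> polytime g \<Longrightarrow> polytest (\<lambda>x. adjt (f x) (g x))"
  unfolding adjt_def d_defs by (intro polytime_intros)

definition lstt :: "nat \<Rightarrow> nat set \<Rightarrow> tree" where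
  "lstt q S = enc_list (\<lambda>i. enc_bool (i \<in> S)) [1..<Suc q]"

definition leaft :: "nat \<Rightarrow> tree \<Rightarrow> tree" where
  "leaft q e = enc_list (\<lambda>c. desc (lstt q {Suc c}) Nl (hd_tree e) Nl Nl Nl Nl) [0..<q]"

definition hubt :: "nat \<Rightarrow> tree \<Rightarrow> tree" where
  "hubt q h = desc (lstt q {1..q}) h Nl Nl Nl Nl Nl"

text \<open>Follows \<open>pin\<close>: a missing literal falls back to the hub vertex of variable
  0, and a table bit equal to the sign of the literal means a true literal, which gets no
  edge.\<close>

definition pint :: "tree \<Rightarrow> tree \<Rightarrow> nat \<Rightarrow> nat \<Rightarrow> tree" where
  "pint g C l s =
     (if (tl_tree ^^ l) C = Nl then hd_tree (hd_tree g)
      else if (hd_tree ((tl_tree ^^ s) (tl_tree (hd_tree (dropt (hd_tree (hd_tree ((tl_tree ^^ l) C))) g)))) \<noteq> Nl)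
          = (tl_tree (hd_tree ((tl_tree ^^ l) C)) \<noteq> Nl) then Nl
      else hd_tree (hd_tree (dropt (hd_tree (hd_tree ((tl_tree ^^ l) C))) g)))"

definition attt :: "nat \<Rightarrow> tree \<Rightarrow> tree \<Rightarrow> nat \<Rightarrow> nat \<Rightarrow> tree" where
  "attt q g C \<sigma> a = (if a < 3 \<and> digit q a \<sigma> = 0 then pint g C a 0
     else if 5 \<le> a \<and> digit q (a - 5) \<sigma> \<noteq> 0 then pint g C (a - 5) (digit q (a - 5) \<sigma>) else Nl)"

text \<open>\<open>t\<close> is the clause list from the current clause on: its head is the clause
  and its length identifies it. As \<open>q\<close> is fixed, triples and roles are unrolled in the
  program text, and the colour lists are constants.\<close>

definition gadt :: "nat \<Rightarrow> tree \<Rightarrow> tree \<Rightarrow> tree" where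
  "gadt q g t = enc_list (\<lambda>(\<sigma>, a). desc (lstt q (lst q (Gad 0 \<sigma> a))) Nl (attt q g (hd_tree t) \<sigma> a) t
     (enc_nat \<sigma>) (enc_nat a) (enc_list (\<lambda>b. enc_bool (gadget_edge a b)) [0..<8])) (List.product [0..<q ^ 3] [0..<8])"

lemma polytime_pint: "polytime g \<Longrightarrow> polytime C \<Longrightarrow> polytime (\<lambda>x. pint (g x) (C x) l s)"
  unfolding pint_def by (intro polytime_intros)

lemma polytime_attt: "polytime g \<Longrightarrow> polytime C \<Longrightarrow> polytime (\<lambda>x. attt q (g x) (C x) \<sigma> a)"
  unfolding attt_def
  by (cases "a < 3 \<and> digit q a \<sigma> = 0"; cases "5 \<le> a \<and> digit q (a - 5) \<sigma> \<noteq> 0")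
    (simp_all only: if_True if_False simp_thms polytime_pint polytime_const)

lemma polytime_leaft: "polytime e \<Longrightarrow> polytime (\<lambda>x. leaft q (e x))"
  unfolding leaft_def desc_def by (intro polytime_intros)

lemma polytime_hubt: "polytime h \<Longrightarrow> polytime (\<lambda>x. hubt q (h x))"
  unfolding hubt_def desc_def by (intro polytime_intros)

lemma polytime_gadt: "polytime g \<Longrightarrow> polytime t \<Longrightarrow> polytime (\<lambda>x. gadt q (g x) (t x))"
  unfolding gadt_def case_prod_beta desc_def by (intro polytime_intros polytime_attt)

definition vertst :: "nat \<Rightarrow> tree \<Rightarrow> tree \<Rightarrow> tree \<Rightarrow> tree" where
  "vertst q g h c = concatt (Pr (concatt (enc_list (leaft q) (elems g))) (Pr (enc_list (hubt q) (elems h))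
     (Pr (concatt (enc_list (gadt q g) (elems (tailst c)))) Nl)))"

lemma polytime_vertst:
  assumes "polytime g" "polytime h" "polytime c"
  shows "polytime (\<lambda>x. vertst q (g x) (h x) (c x))"
proof -
  have "polytime (\<lambda>x. enc_list (leaft q) (elems (g x)))"
    by (rule polytime_map[where F = "\<lambda>_. leaft q" and e = "\<lambda>_. Nl"])
      (intro polytime_leaft polytime_tl polytime_id polytime_const assms)+
  moreover have "polytime (\<lambda>x. enc_list (hubt q) (elems (h x)))"
    by (rule polytime_map[where F = "\<lambda>_. hubt q" and e = "\<lambda>_. Nl"])
      (intro polytime_hubt polytime_tl polytime_id polytime_const assms)+
  moreover have "polytime (\<lambda>x. enc_list (gadt q (g x)) (elems (tailst (c x))))"
    by (rule polytime_map[where F = "gadt q"])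
      (intro polytime_gadt polytime_tl polytime_hd polytime_id polytime_tailst assms)+
  ultimately show ?thesis
    unfolding vertst_def by (intro polytime_concatt polytime_Pr polytime_const)
qed

definition reducet :: "nat \<Rightarrow> tree \<Rightarrow> tree \<Rightarrow> tree \<Rightarrow> tree" where
  "reducet q g h c = (let vs = elems (vertst q g h c) in
     Pr (enc_list (\<lambda>u. enc_list (\<lambda>v. enc_bool (adjt u v)) vs) vs)
       (Pr (enc_list d_lst vs) (enc_list (\<lambda>u. enc_bool (d_hub u \<noteq> Nl)) vs)))"

lemma polytime_reducet:
  assumes "polytime g" "polytime h" "polytime c"
  shows "polytime (\<lambda>x. reducet q (g x) (h x) (c x))"
proof -
  note V = polytime_vertst[OF assms, of q]
  have "polytime (\<lambda>x. enc_list (\<lambda>u. enc_list (\<lambda>v. enc_bool (adjt u v)) (elems (vertst q (g x) (h x) (c x))))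
      (elems (vertst q (g x) (h x) (c x))))"
  proof (rule polytime_map[where F = "\<lambda>e u. enc_list (\<lambda>v. enc_bool (adjt u v)) (elems e)", OF _ V V])
    show "polytime (\<lambda>z. enc_list (\<lambda>v. enc_bool (adjt (tl_tree z) v)) (elems (hd_tree z)))"
      by (rule polytime_map[where F = "\<lambda>u v. enc_bool (adjt u v)"])
        (intro polytime_enc_bool polytest_adjt polytime_hd polytime_tl polytime_id)+
  qed
  moreover have "polytime (\<lambda>x. enc_list d_lst (elems (vertst q (g x) (h x) (c x))))"
    by (rule polytime_map[where F = "\<lambda>_. d_lst" and e = "\<lambda>_. Nl", OF _ _ V])
      (unfold d_defs, (intro polytime_hd polytime_tl polytime_id polytime_const)+)
  moreover have "polytime (\<lambda>x. enc_list (\<lambda>u. enc_bool (d_hub u \<noteq> Nl)) (elems (vertst q (g x) (h x) (c x))))"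
    by (rule polytime_map[where F = "\<lambda>_ u. enc_bool (d_hub u \<noteq> Nl)" and e = "\<lambda>_. Nl", OF _ _ V])
      (unfold d_defs, (intro polytime_enc_bool polytest_nonNl polytime_hd polytime_tl polytime_id polytime_const)+)
  ultimately show ?thesis
    unfolding reducet_def Let_def by (intro polytime_Pr)
qed

text \<open>A variable is represented by the hub number of its block and its values under the
  \<open>q\<close> assignments of the chosen table.\<close>

type_synonym entry = "nat \<times> bool list"

definition enc_entry :: "entry \<Rightarrow> tree" where
  "enc_entry e = Pr (enc_nat (fst e)) (enc_list enc_bool (snd e))"

definition enc_clause :: "literal list \<Rightarrow> tree" where
  "enc_clause = enc_list (\<lambda>(i, b). Pr (enc_nat i) (enc_bool b))"

lemma len_enc_nat [simp]: "len (enc_nat n) = n"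
  by (simp add: enc_nat_def)

lemma enc_nat_0 [simp]: "enc_nat 0 = Nl"
  by (simp add: enc_nat_def)

lemma enc_nat_eq_Nl [simp]: "enc_nat n = Nl \<longleftrightarrow> n = 0"
  by (metis elems_eq_Nil len_enc_nat length_0_conv)

lemma enc_list_cong: "map f xs = map g ys \<Longrightarrow> enc_list f xs = enc_list g ys"
  by (metis elems_enc_list elems_inject)

lemma elems_tailst: "elems (tailst (enc_list f xs)) = map (\<lambda>j. enc_list f (drop j xs)) [0..<length xs]"
proof (induction xs)
  case (Cons x xs)
  have "[0..<length (x # xs)] = 0 # map Suc [0..<length xs]"
    by (simp add: map_Suc_upt upt_conv_Cons del: upt_Suc)
  then show ?case
    using Cons by simp
qed simp

lemma hd_tree_dropt: "len k < len l \<Longrightarrow> hd_tree (dropt k l) = elems l ! len k"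
  unfolding dropt_def by (rule hd_tree_tl_funpow)

lemma tl_funpow_enc_list: "(tl_tree ^^ k) (enc_list f xs) = enc_list f (drop k xs)"
  by (simp add: elems_inject[symmetric] elems_tl_funpow drop_map)

lemma hd_tree_enc_list: "xs \<noteq> [] \<Longrightarrow> hd_tree (enc_list f xs) = f (hd xs)"
  by (cases xs) auto

section \<open>Correctness of the computed instance\<close>

locale led_encoding = led_instance q hs "length g" "\<lambda>i. fst (g ! i)" "\<lambda>i s. snd (g ! i) ! s" cs
  for q :: nat and hs :: "nat list" and g :: "entry list" and cs :: "literal list list" +
  assumes tables: "\<And>e. e \<in> set g \<Longrightarrow> length (snd e) = q"
begin

abbreviation "gt \<equiv> enc_list enc_entry g"
abbreviation "ht \<equiv> enc_list enc_nat hs"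
abbreviation "ct \<equiv> enc_list enc_clause cs"

fun desc_of :: "vtx \<Rightarrow> tree" where
  "desc_of (Leaf i c) = desc (lstt q {Suc c}) Nl (enc_nat (att (Leaf i c))) Nl Nl Nl Nl"
| "desc_of (Hub h) = desc (lstt q {1..q}) (enc_nat h) Nl Nl Nl Nl Nl"
| "desc_of (Gad j \<sigma> a) = desc (lstt q (lst q (Gad j \<sigma> a))) Nl (enc_nat (att (Gad j \<sigma> a)))
     (enc_list enc_clause (drop j cs)) (enc_nat \<sigma>) (enc_nat a) (enc_list (\<lambda>b. enc_bool (gadget_edge a b)) [0..<8])"

lemma pint_eq:
  assumes "j < length cs" "s < q"
  shows "pint gt (enc_clause (cs ! j)) l s = enc_nat (pin (cs ! j) l s)"
proof -
  let ?C = "cs ! j"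
  have t: "(tl_tree ^^ l) (enc_clause ?C) = enc_clause (drop l ?C)"
    by (simp add: enc_clause_def tl_funpow_enc_list)
  show ?thesis
  proof (cases "l < length ?C")
    case False
    then have "(tl_tree ^^ l) (enc_clause ?C) = Nl"
      unfolding t by (simp add: enc_clause_def)
    moreover have "hd_tree (hd_tree gt) = enc_nat (fst (g ! 0))"
      using m by (simp add: hd_tree_enc_list hd_conv_nth enc_entry_def)
    ultimately show ?thesis
      using False by (simp add: pint_def pin_def lit_false_def lit_hub_def)
  next
    case True
    obtain i b where ib: "?C ! l = (i, b)"
      by (cases "?C ! l") auto
    have h: "hd_tree (enc_clause (drop l ?C)) = Pr (enc_nat i) (enc_bool b)"
      using True by (simp add: enc_clause_def hd_tree_enc_list hd_drop_conv_nth ib)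
    have ne: "enc_clause (drop l ?C) \<noteq> Nl"
      using True by (metis drop_eq_Nil elems_enc_list elems_eq_Nil enc_clause_def map_is_Nil_conv not_le)
    have i: "i < length g"
      using cs(1)[of ?C i b] assms True ib by (metis nth_mem)
    have e: "hd_tree (dropt (enc_nat i) gt) = enc_entry (g ! i)"
      using i by (subst hd_tree_dropt) simp_all
    have v: "hd_tree ((tl_tree ^^ s) (enc_list enc_bool (snd (g ! i)))) = enc_bool (snd (g ! i) ! s)"
      using i assms tables[of "g ! i"] by (subst hd_tree_tl_funpow) simp_all
    show ?thesis
      unfolding pint_def t h using True ne e v
      by (auto simp: pin_def lit_false_def lit_hub_def ib enc_entry_def)
  qed
qed

lemma attt_eq:
  assumes "j < length cs"
  shows "attt q gt (enc_clause (cs ! j)) \<sigma> a = enc_nat (att (Gad j \<sigma> a))"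
  using assms q2 by (simp add: attt_def pint_eq digit_less)

lemma elems_vertst: "elems (vertst q gt ht ct) = map desc_of verts"
proof -
  have g: "map f g = map (\<lambda>i. f (g ! i)) [0..<length g]" for f :: "entry \<Rightarrow> tree list"
    by (rule nth_equalityI) simp_all
  have leaf: "elems (leaft q (enc_entry (g ! i))) = map desc_of (map (Leaf i) [0..<q])" for i
    by (simp add: leaft_def enc_entry_def)
  have hub: "hubt q (enc_nat h) = desc_of (Hub h)" for h
    by (simp add: hubt_def)
  have gad: "elems (gadt q gt (enc_list enc_clause (drop j cs))) =
    map desc_of (concat (map (\<lambda>\<sigma>. map (Gad j \<sigma>) [0..<8]) [0..<q ^ 3]))" if j: "j < length cs" for j
  proof -
    have "hd_tree (enc_list enc_clause (drop j cs)) = enc_clause (cs ! j)"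
      using j by (simp add: hd_tree_enc_list hd_drop_conv_nth)
    moreover have "lst q (Gad 0 \<sigma> a) = lst q (Gad j \<sigma> a)" for \<sigma> a
      by simp
    ultimately show ?thesis
      using j by (simp add: gadt_def product_concat_map map_concat comp_def case_prod_beta attt_eq
          del: lst.simps att.simps)
  qed
  have "elems (vertst q gt ht ct) =
    concat (map (\<lambda>i. elems (leaft q (enc_entry (g ! i)))) [0..<length g]) @ map (\<lambda>h. hubt q (enc_nat h)) hs @
    concat (map (\<lambda>j. elems (gadt q gt (enc_list enc_clause (drop j cs)))) [0..<length cs])"
    unfolding vertst_def concatt_def
    by (simp add: elems_tailst comp_def g[of "\<lambda>e. elems (leaft q (enc_entry e))"])
  also have "\<dots> = map desc_of verts"
  proof -
    have "map (\<lambda>j. elems (gadt q gt (enc_list enc_clause (drop j cs)))) [0..<length cs] =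
      map (\<lambda>j. map desc_of (concat (map (\<lambda>\<sigma>. map (Gad j \<sigma>) [0..<8]) [0..<q ^ 3]))) [0..<length cs]"
      by (intro map_cong refl gad) simp
    then show ?thesis
      unfolding verts_def map_append leaf hub
      by (simp only:) (simp only: map_concat map_map comp_def)
  qed
  finally show ?thesis .
qed

lemma adjt_desc_of:
  assumes "u \<in> set verts" "v \<in> set verts"
  shows "adjt (desc_of u) (desc_of v) \<longleftrightarrow> adj u v"
proof -
  have [simp]: "dropt k Nl = Nl" for k
    by (simp add: dropt_def)
  have row: "hd_tree (dropt (enc_nat b) (enc_list (\<lambda>b. enc_bool (gadget_edge a b)) [0..<8])) = enc_bool (gadget_edge a b)"
    if "b < 8" for a b
    using that by (subst hd_tree_dropt) simp_all
  have gad: "j < length cs \<and> a < 8" if "Gad j \<sigma> a \<in> set verts" for j \<sigma> a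
    using that by (auto simp: set_verts LV_def HV_def GV_def)
  \<comment> \<open>The remaining lists of two clauses differ in length, so the length determines
    the clause.\<close>
  have drop: "len (enc_list enc_clause (drop j cs)) = length cs - j" for j
    by simp
  show ?thesis
  proof (cases u)
    case (Gad j \<sigma> a)
    note u = this
    have ja: "j < length cs" "a < 8"
      using gad[of j \<sigma> a] assms u by simp_all
    show ?thesis
    proof (cases v)
      case (Gad j' \<sigma>' b)
      then have "j' < length cs" "b < 8"
        using gad[of j' \<sigma>' b] assms by simp_all
      then show ?thesis
        using ja unfolding u Gad adjt_def adj_def same_gadget_adj_def desc_of.simps d_desc drop
        by (auto simp: row simp del: att.simps)
    next
      case (Leaf i c)
      then show ?thesis
        using ja unfolding u Leaf adjt_def adj_def same_gadget_adj_def desc_of.simps d_desc drop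
        by (simp del: att.simps)
    next
      case (Hub h)
      then show ?thesis
        using ja unfolding u Hub adjt_def adj_def same_gadget_adj_def desc_of.simps d_desc drop
        by (simp del: att.simps(3))
    qed
  next
    case (Leaf i c)
    then show ?thesis
      by (cases v) (simp_all add: adjt_def adj_def same_gadget_adj_def del: att.simps(3))
  next
    case (Hub h)
    then show ?thesis
      by (cases v) (simp_all add: adjt_def adj_def same_gadget_adj_def del: att.simps(3))
  qed
qed

lemma enc_list_verts: "enc_list f (map desc_of verts) = enc_list (\<lambda>i. f (desc_of (verts ! i))) [0..<N]"
  by (rule enc_list_cong, rule nth_equalityI) simp_all

lemma reducet_eq: "reducet q gt ht ct = enc_LED q (N) edges lists hub"
proof -
  have "enc_list (\<lambda>u. enc_list (\<lambda>v. enc_bool (adjt u v)) (map desc_of verts)) (map desc_of verts) =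
      enc_edges (N) edges"
    unfolding enc_list_verts enc_edges_def
    by (intro enc_list_cong map_cong refl) (simp add: adjt_desc_of edge_iff)
  moreover have "enc_list d_lst (map desc_of verts) = enc_lists q (N) lists"
  proof -
    have "d_lst (desc_of v) = lstt q (lst q v)" for v
      by (cases v) simp_all
    then show ?thesis
      unfolding enc_list_verts enc_lists_def lists_def lstt_def by simp
  qed
  moreover have "enc_list (\<lambda>u. enc_bool (d_hub u \<noteq> Nl)) (map desc_of verts) = enc_vertices (N) hub"
  proof -
    have "d_hub (desc_of v) \<noteq> Nl \<longleftrightarrow> hubno v \<noteq> 0" for v
      by (cases v) simp_all
    then show ?thesis
      unfolding enc_list_verts enc_vertices_def
      by (intro enc_list_cong map_cong refl) (simp add: hub_def)
  qed
  ultimately show ?thesis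
    unfolding reducet_def Let_def elems_vertst enc_LED_def by simp
qed

end

section \<open>Reading the assignment off a deletion set\<close>

lemma polytest_bex: "(\<And>c. c < q \<Longrightarrow> polytest (P c)) \<Longrightarrow> polytest (\<lambda>x. \<exists>c<q::nat. P c x)"
proof (induction q)
  case 0
  then show ?case
    by (simp add: polytest_def polytime_const)
next
  case (Suc q)
  have "polytest (\<lambda>x. (\<exists>c<q. P c x) \<or> P q x)"
    using Suc by (intro polytest_disj) auto
  then show ?case
    by (rule polytest_cong) (auto simp: less_Suc_eq)
qed

text \<open>\<open>D\<close> starts with the row counts of the \<open>q\<close> pendant vertices of
  one variable. For an optimal deletion set exactly one of these is nonzero, so the disjunction
  picks the table bit at that colour.\<close>

definition bitt :: "nat \<Rightarrow> tree \<Rightarrow> tree \<Rightarrow> bool" where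
  "bitt q D g \<longleftrightarrow> (\<exists>c<q. hd_tree ((tl_tree ^^ c) D) \<noteq> Nl \<and>
     hd_tree ((tl_tree ^^ c) (tl_tree (hd_tree g))) \<noteq> Nl)"

text \<open>The state holds the unread row counts, the unread entries and the bits found so far in
  reverse order; a step consumes the \<open>q\<close> rows of one variable.\<close>

definition stept :: "nat \<Rightarrow> tree \<Rightarrow> tree" where
  "stept q a = Pr ((tl_tree ^^ q) (hd_tree a)) (Pr (tl_tree (hd_tree (tl_tree a)))
     (Pr (enc_bool (bitt q (hd_tree a) (hd_tree (tl_tree a)))) (tl_tree (tl_tree a))))"

definition extractt :: "nat \<Rightarrow> tree \<Rightarrow> tree \<Rightarrow> tree \<Rightarrow> tree" where
  "extractt q y g k = revt Nl (tl_tree (tl_tree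
     (foldl (\<lambda>a _. stept q a) (Pr (enc_list (count_row Nl) (elems y)) (Pr g Nl)) (elems k))))"

lemma size_hd_tl: "size (hd_tree a) \<le> size a" "size (tl_tree a) \<le> size a"
  by (cases a; simp)+

lemma size_tl_funpow: "size ((tl_tree ^^ k) a) \<le> size a"
proof (induction k)
  case (Suc k)
  then show ?case
    using size_hd_tl(2)[of "(tl_tree ^^ k) a"] by simp
qed simp

lemma polytime_extractt:
  assumes "polytime y" "polytime g" "polytime k"
  shows "polytime (\<lambda>x. extractt q (y x) (g x) (k x))"
proof -
  have "polytime (\<lambda>x. enc_list (count_row Nl) (elems (y x)))"
    by (rule polytime_map[where F = "\<lambda>_. count_row Nl" and e = "\<lambda>_. Nl"])
      (intro polytime_count_row polytime_tl polytime_id polytime_const assms)+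
  note init = polytime_Pr[OF this polytime_Pr[OF assms(2) polytime_const[of Nl]]]
  have "polytime (\<lambda>x. foldl (\<lambda>a _. stept q a) (Pr (enc_list (count_row Nl) (elems (y x))) (Pr (g x) Nl)) (elems (k x)))"
  proof (rule polytime_foldl_additive[where F = "\<lambda>e a y. stept q a" and e = "\<lambda>_. Nl" and k = 3, OF _ _ _ assms(3) init])
    show "polytime (\<lambda>z. stept q (tl_tree (tl_tree z)))"
      unfolding stept_def bitt_def by (intro polytime_intros polytest_bex)
    fix e a y :: tree
    have "size (hd_tree a) + (size (tl_tree (hd_tree (tl_tree a))) + size (tl_tree (tl_tree a))) \<le> size a"
      using size_hd_tl(2)[of "hd_tree (tl_tree a)"]
      by (cases a; cases "tl_tree a") auto
    then have "size (stept q a) \<le> size a + 4"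
      using size_tl_funpow[of q "hd_tree a"] by (simp add: stept_def enc_bool_def)
    also have "\<dots> \<le> size a + (size e + size y + 2) ^ 3"
      using power_mono[of 2 "size e + size y + 2" 3] by simp
    finally show "size (stept q a) \<le> size a + (size e + size y + 2) ^ 3" .
  qed (rule polytime_const)
  then show ?thesis
    unfolding extractt_def by (intro polytime_revt polytime_tl polytime_const)
qed

lemma extractt_eq:
  "extractt q y g k = enc_list (\<lambda>i. enc_bool (bitt q ((tl_tree ^^ (q * i)) (enc_list (count_row Nl) (elems y)))
     ((tl_tree ^^ i) g))) [0..<len k]"
proof -
  define D where "D = enc_list (count_row Nl) (elems y)"
  define bit where "bit i = enc_bool (bitt q ((tl_tree ^^ (q * i)) D) ((tl_tree ^^ i) g))" for i
  have "foldl (\<lambda>a _. stept q a) a xs = (stept q ^^ length xs) a" for a and xs :: "tree list"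
    by (induction xs arbitrary: a) (simp_all add: funpow_swap1)
  moreover have "(stept q ^^ n) (Pr D (Pr g Nl)) =
    Pr ((tl_tree ^^ (q * n)) D) (Pr ((tl_tree ^^ n) g) (enc_list bit (rev [0..<n])))" for n
  proof (induction n)
    case (Suc n)
    have "(tl_tree ^^ q) ((tl_tree ^^ (q * n)) D) = (tl_tree ^^ (q * Suc n)) D"
      by (simp add: funpow_add)
    then show ?case
      using Suc by (simp add: stept_def bit_def)
  qed simp
  ultimately have "extractt q y g k = revt Nl (enc_list bit (rev [0..<len k]))"
    by (simp add: extractt_def D_def)
  also have "\<dots> = enc_list bit [0..<len k]"
    by (rule iffD1[OF elems_inject]) (simp only: elems_revt elems_enc_list rev_map rev_rev_ident elems.simps append_Nil2)
  finally show ?thesis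
    by (simp add: bit_def[abs_def] D_def)
qed

lemma len_count_edges:
  "len (count_matrix (enc_edges N X)) = (\<Sum>i<N. \<Sum>k<N. of_bool ({i, k} \<in> X))"
proof -
  have "length (filter (\<lambda>b. b \<noteq> Nl) (map (\<lambda>v. enc_bool (P v)) xs)) = (\<Sum>v\<leftarrow>xs. of_bool (P v))"
    for P and xs :: "nat list"
    by (induction xs) auto
  then have "len (count_matrix (enc_edges N X)) = (\<Sum>i\<leftarrow>[0..<N]. \<Sum>k\<leftarrow>[0..<N]. of_bool ({i, k} \<in> X))"
    by (simp add: length_count_matrix enc_edges_def comp_def)
  also have "\<dots> = (\<Sum>i<N. \<Sum>k<N. of_bool ({i, k} \<in> X))"
    by (simp only: interv_sum_list_conv_sum_set_nat atLeast0LessThan set_upt)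
  finally show ?thesis .
qed

lemma count_row_edges_nonNl:
  "count_row Nl (enc_list (\<lambda>v. enc_bool (P v)) xs) \<noteq> Nl \<longleftrightarrow> (\<exists>v\<in>set xs. P v)"
proof -
  have "count_row Nl (enc_list (\<lambda>v. enc_bool (P v)) xs) \<noteq> Nl \<longleftrightarrow>
    0 < len (count_row Nl (enc_list (\<lambda>v. enc_bool (P v)) xs))"
    by simp
  also have "\<dots> \<longleftrightarrow> (\<exists>v\<in>set xs. P v)"
    by (simp only: length_count_row elems_enc_list) (auto simp: filter_empty_conv)
  finally show ?thesis .
qed

context led_encoding
begin

lemma verts_nth_Leaf:
  assumes "i < length g" "c < q"
  shows "q * i + c < N" "verts ! (q * i + c) = Leaf i c"
proof -
  have ls: "length (concat (map (\<lambda>i. map (Leaf i) [0..<q]) [0..<n])) = q * n" for n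
    by (induction n) auto
  have "concat (map (\<lambda>i. map (Leaf i) [0..<q]) [0..<n]) ! (q * i + c) = Leaf i c" if "i < n" for n
    using that
  proof (induction n)
    case (Suc n)
    have "q * i + c < q * n" if "i < n"
    proof -
      have "q * i + c < q * (i + 1)"
        using assms by simp
      also have "\<dots> \<le> q * n"
        using that by (intro mult_le_mono2) simp
      finally show ?thesis .
    qed
    then show ?case
      using Suc assms(2) ls[of n] by (cases "i = n") (auto simp: nth_append)
  qed simp
  moreover have "q * i + c < q * length g"
  proof -
    have "q * i + c < q * (i + 1)"
      using assms by simp
    also have "\<dots> \<le> q * length g"
      using assms by (intro mult_le_mono2) simp
    finally show ?thesis .
  qed
  ultimately show "q * i + c < N" "verts ! (q * i + c) = Leaf i c"
    using assms ls[of "length g"] unfolding verts_def by (auto simp: nth_append)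
qed

text \<open>\<open>g\<close> may describe more variables than the formula has, because blocks are
  filled up; only the first \<open>n\<close> are read.\<close>

lemma extractt_edges:
  assumes r: "\<And>h. h \<in> set hs \<Longrightarrow> r h < q"
    and X: "\<And>k i c. k < N \<Longrightarrow> verts ! k = Leaf i c \<Longrightarrow>
        (\<exists>k'<N. {k, k'} \<in> X) \<longleftrightarrow> r (fst (g ! i)) = c"
    and n: "n \<le> length g"
  shows "extractt q (enc_edges (N) X) gt (enc_nat n) =
    enc_assignment n (\<lambda>i. snd (g ! i) ! r (fst (g ! i)))"
proof -
  have "bitt q ((tl_tree ^^ (q * i)) (enc_list (count_row Nl) (elems (enc_edges (N) X)))) ((tl_tree ^^ i) gt)
      \<longleftrightarrow> snd (g ! i) ! r (fst (g ! i))" if i: "i < n" for i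
  proof -
    let ?D = "enc_list (count_row Nl) (elems (enc_edges (N) X))"
    have i': "i < length g"
      using i n by simp
    have e: "hd_tree ((tl_tree ^^ i) gt) = enc_entry (g ! i)"
      using i' by (subst hd_tree_tl_funpow) simp_all
    have v: "hd_tree ((tl_tree ^^ c) (enc_list enc_bool (snd (g ! i)))) = enc_bool (snd (g ! i) ! c)" if "c < q" for c
      using that i' tables[of "g ! i"] by (subst hd_tree_tl_funpow) simp_all
    have D: "hd_tree ((tl_tree ^^ c) ((tl_tree ^^ (q * i)) ?D)) \<noteq> Nl \<longleftrightarrow> r (fst (g ! i)) = c" if c: "c < q" for c
    proof -
      note L = verts_nth_Leaf[OF i' c]
      have "(tl_tree ^^ c) ((tl_tree ^^ (q * i)) ?D) = (tl_tree ^^ (q * i + c)) ?D"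
        by (simp add: funpow_add add.commute)
      moreover have "hd_tree ((tl_tree ^^ (q * i + c)) ?D) =
        count_row Nl (enc_list (\<lambda>v. enc_bool ({q * i + c, v} \<in> X)) [0..<N])"
        using L(1) by (subst hd_tree_tl_funpow) (simp_all add: enc_edges_def)
      ultimately have "hd_tree ((tl_tree ^^ c) ((tl_tree ^^ (q * i)) ?D)) \<noteq> Nl \<longleftrightarrow>
        (\<exists>v<N. {q * i + c, v} \<in> X)"
        using count_row_edges_nonNl[of "\<lambda>v. {q * i + c, v} \<in> X" "[0..<N]"] by auto
      also have "\<dots> \<longleftrightarrow> r (fst (g ! i)) = c"
        using X[OF L] .
      finally show ?thesis .
    qed
    have "r (fst (g ! i)) < q"
      using r blk[OF i'] by blast
    then show ?thesis
      unfolding bitt_def e enc_entry_def tl_tree.simps by (metis D v enc_bool_eq_Nl)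
  qed
  then show ?thesis
    unfolding extractt_eq enc_assignment_def len_enc_nat
    by (intro enc_list_cong map_cong refl) simp
qed

end

section \<open>Functions given by a single expression\<close>

definition const_time :: "(tree \<Rightarrow> tree) \<Rightarrow> bool" where
  "const_time f \<longleftrightarrow> (\<exists>e. evars e \<subseteq> {0} \<and> (\<forall>x. evale e (\<lambda>_. x) = f x))"

lemma const_time_id: "const_time (\<lambda>x. x)"
  unfolding const_time_def by (intro exI[of _ "Var 0"]) simp

lemma const_time_hd: "const_time f \<Longrightarrow> const_time (\<lambda>x. hd_tree (f x))"
  unfolding const_time_def by (metis evale.simps(4) evars.simps(4))

lemma const_time_tl: "const_time f \<Longrightarrow> const_time (\<lambda>x. tl_tree (f x))"
  unfolding const_time_def by (metis evale.simps(5) evars.simps(5))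

lemma const_time_Pr:
  assumes "const_time f" "const_time g"
  shows "const_time (\<lambda>x. Pr (f x) (g x))"
proof -
  obtain d e where "evars d \<subseteq> {0}" "\<And>x. evale d (\<lambda>_. x) = f x" "evars e \<subseteq> {0}" "\<And>x. evale e (\<lambda>_. x) = g x"
    using assms unfolding const_time_def by blast
  then show ?thesis
    unfolding const_time_def by (intro exI[of _ "Join d e"]) simp
qed

lemma const_time_const: "const_time (\<lambda>_. a)"
proof (induction a)
  case Nl
  show ?case
    unfolding const_time_def by (intro exI[of _ Empty]) simp
qed (rule const_time_Pr)

lemma const_time_tl_funpow: "const_time f \<Longrightarrow> const_time (\<lambda>x. (tl_tree ^^ k) (f x))"
  by (induction k) (auto intro: const_time_tl)

lemma const_time_foldr:
  "(\<And>i. i \<in> set is \<Longrightarrow> const_time (F i)) \<Longrightarrow> const_time a \<Longrightarrow> const_time (\<lambda>x. foldr (\<lambda>i. Pr (F i x)) is (a x))"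
  by (induction "is") (auto intro: const_time_Pr)

lemmas const_time_intros = const_time_id const_time_hd const_time_tl const_time_Pr const_time_const const_time_tl_funpow const_time_foldr

text \<open>An expression is evaluated in a number of steps that does not depend on its argument,
  and it needs no scratch variables, whence the arbitrary \<open>m\<close>.\<close>

lemma const_time_runs:
  assumes "const_time f"
  obtains c k where "\<And>m x. 0 < m \<Longrightarrow> runs c m x k (f x)"
proof -
  obtain e where e: "evars e \<subseteq> {0}" "\<And>x. evale e (\<lambda>_. x) = f x"
    using assms unfolding const_time_def by blast
  then show thesis
    using runs_Assign[OF e(1)] by (intro that[of "Assign 0 e" "cost e + 1"]) simp
qed

section \<open>The search program\<close>

text \<open>A leaf of the search is the tree \<open>Pr (Pr g h) (Pr b inp)\<close> of entries, hub
  numbers, best solution so far and input formula.\<close>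

definition redf :: "nat \<Rightarrow> tree \<Rightarrow> tree" where
  "redf q z = reducet q (hd_tree (hd_tree z)) (tl_tree (hd_tree z)) (tl_tree (tl_tree (tl_tree z)))"

text \<open>A solution consists of the unary count of true matrix entries, which is twice the number
  of deleted edges, and the encoded assignment; \<open>Nl\<close> means that none has been found
  yet.\<close>

definition bettert :: "tree \<Rightarrow> tree \<Rightarrow> tree" where
  "bettert b c = (if b = Nl \<or> len (hd_tree c) < len (hd_tree b) then c else b)"

definition newt :: "nat \<Rightarrow> tree \<Rightarrow> tree \<Rightarrow> tree \<Rightarrow> tree" where
  "newt q y g k = Pr (count_matrix y) (extractt q y g k)"

definition postf :: "nat \<Rightarrow> tree \<Rightarrow> tree" where
  "postf q w = Pr (bettert (hd_tree (tl_tree (hd_tree w)))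
      (newt q (tl_tree w) (hd_tree (hd_tree (hd_tree w))) (hd_tree (tl_tree (tl_tree (hd_tree w))))))
     (tl_tree (tl_tree (hd_tree w)))"

lemma polytime_redf: "polytime (redf q)"
  unfolding redf_def by (intro polytime_reducet polytime_intros)

lemma polytime_newt: "polytime y \<Longrightarrow> polytime g \<Longrightarrow> polytime k \<Longrightarrow> polytime (\<lambda>x. newt q (y x) (g x) (k x))"
  unfolding newt_def by (intro polytime_extractt polytime_intros)

lemma polytime_bettert: "polytime b \<Longrightarrow> polytime c \<Longrightarrow> polytime (\<lambda>x. bettert (b x) (c x))"
  unfolding bettert_def by (intro polytime_intros)

lemma polytime_postf: "polytime (postf q)"
  unfolding postf_def by (intro polytime_bettert polytime_newt polytime_intros)

text \<open>The answer of \<open>A\<close> has to be combined with the data of the leaf, but the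
  call overwrites variable 0. Pairing the identity program with the call keeps both.\<close>

lemma leaf_program:
  obtains c m t where "0 < m" "poly_bd size t"
    "\<And>z u y. computes A (redf q z) u y \<Longrightarrow> runs c m z (t z + u + t (Pr z y)) (postf q (Pr z y))"
proof -
  obtain c1 m1 t1 where c1: "\<And>x. runs c1 m1 x (t1 x) (redf q x)" "poly_bd size t1"
    using polytime_redf by (meson polytimeE)
  obtain c2 m2 k where c2: "\<And>x t y. computes A x t y \<Longrightarrow> runs c2 m2 x (t + k) y"
    using runs_subroutine by metis
  obtain c3 m3 t3 where c3: "\<And>x. runs c3 m3 x (t3 x) (postf q x)" "poly_bd size t3"
    using polytime_postf by (meson polytimeE)
  define mm where "mm = max m1 (max m2 m3)"
  have mm: "0 < mm"
    using runs_pos[OF c1(1)] by (simp add: mm_def)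
  let ?t = "\<lambda>x. t1 x + t3 x + k + 16"
  show thesis
  proof (rule that[of "mm + 2" ?t "Seq (pair_com mm (Assign 0 (Var 0)) (Seq c1 c2)) c3"])
    show "poly_bd size ?t"
      by (intro poly_bd_intros c1 c3)
    fix z u y
    assume comp: "computes A (redf q z) u y"
    have "runs (Assign 0 (Var 0)) mm z 2 z"
      using runs_Assign[of "Var 0" mm z] mm by (simp add: numeral_2_eq_2)
    moreover have "runs (Seq c1 c2) mm z (t1 z + (u + k)) y"
      by (rule runs_Seq[OF runs_mono[OF c1(1)] runs_mono[OF c2[OF comp]]]) (auto simp: mm_def)
    ultimately have "runs (pair_com mm (Assign 0 (Var 0)) (Seq c1 c2)) (mm + 2) z (2 + (t1 z + (u + k)) + 14) (Pr z y)"
      by (rule runs_pair)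
    moreover have "runs c3 (mm + 2) (Pr z y) (t3 (Pr z y)) (postf q (Pr z y))"
      by (rule runs_mono[OF c3(1)]) (auto simp: mm_def)
    ultimately have "runs (Seq (pair_com mm (Assign 0 (Var 0)) (Seq c1 c2)) c3) (mm + 2) z
        ((2 + (t1 z + (u + k)) + 14) + t3 (Pr z y)) (postf q (Pr z y))"
      by (rule runs_Seq)
    then show "runs (Seq (pair_com mm (Assign 0 (Var 0)) (Seq c1 c2)) c3) (mm + 2) z
        (?t z + u + ?t (Pr z y)) (postf q (Pr z y))"
      by (rule runs_mono) auto
  qed simp
qed

text \<open>A node of the search tree consists of the number \<open>r\<close> of variables still to be placed in blocks, the
  entries of the variables already placed, and the hub numbers of their blocks. The next block takes the
  number \<open>r\<close> itself as its hub number.\<close>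

definition childt :: "nat \<Rightarrow> tree list \<Rightarrow> tree \<Rightarrow> tree" where
  "childt \<beta> tb nd = Pr ((tl_tree ^^ \<beta>) (hd_tree nd))
     (Pr (foldr (\<lambda>t. Pr (Pr (hd_tree nd) t)) tb (hd_tree (tl_tree nd))) (Pr (hd_tree nd) (tl_tree (tl_tree nd))))"

definition pusht :: "nat \<Rightarrow> tree list list \<Rightarrow> tree \<Rightarrow> tree" where
  "pusht \<beta> tabs x = Pr (foldr (\<lambda>tb. Pr (childt \<beta> tb (hd_tree (hd_tree x)))) tabs (tl_tree (hd_tree x))) (tl_tree x)"

definition splitt :: "tree \<Rightarrow> tree" where
  "splitt x = Pr (tl_tree (hd_tree x)) (Pr (tl_tree (hd_tree (hd_tree x))) (tl_tree x))"

lemma const_time_pusht: "const_time (pusht \<beta> tabs)"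
  unfolding pusht_def childt_def by (intro const_time_intros)

lemma const_time_splitt: "const_time splitt"
  unfolding splitt_def by (intro const_time_intros)

text \<open>The loop is described by what it does with the top of the stack: stop on the empty
  stack, replace an inner node by its children, evaluate a leaf. The last two rules prefix a given
  run from the successor state, so the later induction follows the search tree and never inspects
  the loop.\<close>

lemma dfs_program:
  obtains W m K t where "0 < m" "poly_bd size t"
    "\<And>x. hd_tree x = Nl \<Longrightarrow> runs W m x K x"
    "\<And>x u z. hd_tree x \<noteq> Nl \<Longrightarrow> hd_tree (hd_tree (hd_tree x)) \<noteq> Nl \<Longrightarrow>
      runs W m (pusht \<beta> tabs x) u z \<Longrightarrow> runs W m x (u + K) z"
    "\<And>x u z v y. hd_tree x \<noteq> Nl \<Longrightarrow> hd_tree (hd_tree (hd_tree x)) = Nl \<Longrightarrow>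
      computes A (redf q (tl_tree (splitt x))) v y \<Longrightarrow>
      runs W m (Pr (hd_tree (splitt x)) (postf q (Pr (tl_tree (splitt x)) y))) u z \<Longrightarrow>
      runs W m x (u + (K + t (tl_tree (splitt x)) + v + t (Pr (tl_tree (splitt x)) y))) z"
proof -
  obtain cl m t where cl: "0 < m" "poly_bd size t"
    "\<And>z u y. computes A (redf q z) u y \<Longrightarrow> runs cl m z (t z + u + t (Pr z y)) (postf q (Pr z y))"
    by (rule leaf_program[where A = A and q = q]) (rule that)
  obtain cp kp where cp: "\<And>m x. 0 < m \<Longrightarrow> runs cp m x kp (pusht \<beta> tabs x)"
    by (rule const_time_runs[OF const_time_pusht[of \<beta> tabs]]) (rule that)
  obtain cs ks where cs: "\<And>m x. 0 < m \<Longrightarrow> runs cs m x ks (splitt x)"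
    by (rule const_time_runs[OF const_time_splitt]) (rule that)
  define leaf where "leaf = Seq cs (pair_com m (Assign 0 (Head (Var 0))) (Seq (Assign 0 (Tail (Var 0))) cl))"
  define test where "test = Head (Head (Head (Var 0)))"
  define body where "body = Cond test cp leaf"
  define W where "W = While (Head (Var 0)) body"
  define K where "K = kp + ks + 40"
  have e: "evars (Head (Var 0)) \<subseteq> {0}" "evars test \<subseteq> {0}"
    by (simp_all add: test_def)
  show thesis
  proof (rule that[of "m + 2" t W K])
    show "poly_bd size t"
      by fact
    show "runs W (m + 2) x K x" if "hd_tree x = Nl" for x
      unfolding W_def
      by (rule runs_mono[OF runs_While_stop[OF e(1), of x "m + 2"]]) (use that in \<open>auto simp: K_def\<close>)
    show "runs W (m + 2) x (u + K) z" if "hd_tree x \<noteq> Nl" "hd_tree (hd_tree (hd_tree x)) \<noteq> Nl"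
      "runs W (m + 2) (pusht \<beta> tabs x) u z" for x u z
    proof -
      have "runs body (m + 2) x (cost test + 1 + kp) (pusht \<beta> tabs x)"
        unfolding body_def using that by (intro runs_Cond[OF e(2)] cp) (auto simp: test_def)
      from runs_While_step[OF e(1) _ this that(3)[unfolded W_def]] that(1)
      have "runs W (m + 2) x (cost (Head (Var 0)) + 1 + (cost test + 1 + kp) + u) z"
        unfolding W_def by simp
      then show ?thesis
        by (rule runs_mono) (auto simp: K_def test_def)
    qed
    fix x u z v y
    let ?z = "tl_tree (splitt x)"
    assume a: "hd_tree x \<noteq> Nl" "hd_tree (hd_tree (hd_tree x)) = Nl"
      and comp: "computes A (redf q ?z) v y"
      and r: "runs W (m + 2) (Pr (hd_tree (splitt x)) (postf q (Pr ?z y))) u z"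
    have "runs (Assign 0 (Head (Var 0))) m (splitt x) 3 (hd_tree (splitt x))"
      using runs_Assign[of "Head (Var 0)" m "splitt x"] cl(1) by (simp add: eval_nat_numeral)
    moreover have "runs (Seq (Assign 0 (Tail (Var 0))) cl) m (splitt x) (3 + (t ?z + v + t (Pr ?z y))) (postf q (Pr ?z y))"
      using runs_Assign[of "Tail (Var 0)" m "splitt x"] cl(1)
      by (intro runs_Seq[OF _ cl(3)[OF comp]]) (simp add: eval_nat_numeral)
    ultimately have "runs (pair_com m (Assign 0 (Head (Var 0))) (Seq (Assign 0 (Tail (Var 0))) cl)) (m + 2) (splitt x)
        (3 + (3 + (t ?z + v + t (Pr ?z y))) + 14) (Pr (hd_tree (splitt x)) (postf q (Pr ?z y)))"
      by (rule runs_pair)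
    from runs_Seq[OF cs this]
    have "runs leaf (m + 2) x (ks + (3 + (3 + (t ?z + v + t (Pr ?z y))) + 14))
        (Pr (hd_tree (splitt x)) (postf q (Pr ?z y)))"
      unfolding leaf_def by simp
    then have "runs body (m + 2) x (cost test + 1 + (ks + (3 + (3 + (t ?z + v + t (Pr ?z y))) + 14)))
        (Pr (hd_tree (splitt x)) (postf q (Pr ?z y)))"
      unfolding body_def using a by (intro runs_Cond[OF e(2)]) (auto simp: test_def)
    from runs_While_step[OF e(1) _ this r[unfolded W_def]] a
    have "runs W (m + 2) x (cost (Head (Var 0)) + 1 +
        (cost test + 1 + (ks + (3 + (3 + (t ?z + v + t (Pr ?z y))) + 14))) + u) z"
      unfolding W_def by simp
    then show "runs W (m + 2) x (u + (K + t ?z + v + t (Pr ?z y))) z"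
      by (rule runs_mono) (auto simp: K_def test_def)
  qed simp
qed

section \<open>Sizes of the encodings\<close>

lemma size_enc_list:
  "(\<And>x. x \<in> set xs \<Longrightarrow> size (f x) \<le> K) \<Longrightarrow> size (enc_list f xs) \<le> length xs * (K + 1)"
proof (induction xs)
  case (Cons x xs)
  then have "size (f x) \<le> K" "size (enc_list f xs) \<le> length xs * (K + 1)"
    by auto
  then show ?case
    by simp
qed simp

lemma size_enc_nat [simp]: "size (enc_nat k) = k"
proof -
  have "size (enc_list (\<lambda>_. Nl) xs) = length xs" for xs :: "nat list"
    by (induction xs) auto
  then show ?thesis
    by (simp add: enc_nat_def)
qed

lemma size_enc_bool: "size (enc_bool b) \<le> 1"
  by (simp add: enc_bool_def)

lemma size_enc_edges: "size (enc_edges N X) \<le> N * (2 * N + 1)"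
proof -
  have "size (enc_list (\<lambda>v. enc_bool ({u, v} \<in> X)) [0..<N]) \<le> 2 * N" for u
    using size_enc_list[of "[0..<N]" "\<lambda>v. enc_bool ({u, v} \<in> X)" 1] size_enc_bool by simp
  then show ?thesis
    unfolding enc_edges_def
    using size_enc_list[of "[0..<N]" "\<lambda>u. enc_list (\<lambda>v. enc_bool ({u, v} \<in> X)) [0..<N]" "2 * N"] by simp
qed

lemma size_enc_assignment: "size (enc_assignment n \<alpha>) \<le> 2 * n"
  unfolding enc_assignment_def
  using size_enc_list[of "[0..<n]" "\<lambda>i. enc_bool (\<alpha> i)" 1] size_enc_bool by simp

lemma size_count_matrix: "size (count_matrix l) \<le> size l"
proof -
  have "size (foldl count_row a (elems l)) \<le> size a + size l" for a
  proof (induction l arbitrary: a)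
    case (Pr y l)
    from Pr(2)[of "count_row a y"] size_count_row[of a y] show ?case
      by simp
  qed simp
  then show ?thesis
    by (metis add_0 count_matrix_def tree.size(3))
qed

section \<open>Invariants of the search\<close>

locale search =
  fixes q \<beta> M n :: nat and tab :: "nat \<Rightarrow> nat \<Rightarrow> bool list"
    and cs :: "literal list list" and F :: "literal set set"
  assumes q2: "2 \<le> q" and \<beta>: "0 < \<beta>"
    and tab_surj: "\<And>v. length v = \<beta> \<Longrightarrow> \<exists>d<M. \<exists>s<q. tab d s = v"
    and cnf: "is_3cnf n F" "lists_cnf cs F"
begin

text \<open>The search starts with \<open>n + 1\<close> variables, so that there is a block even for \<open>n = 0\<close>.\<close>

definition steps :: "nat \<Rightarrow> nat" where
  "steps r = (r + \<beta> - 1) div \<beta>"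

definition p :: nat where
  "p = steps (Suc n)"

lemma steps_0: "steps 0 = 0"
  using \<beta> by (simp add: steps_def)

text \<open>In a last, incomplete block \<open>r - \<beta>\<close> is truncated to 0, which leaves
  no further steps.\<close>

lemma steps_pos:
  assumes "0 < r"
  shows "steps r = Suc (steps (r - \<beta>))"
proof (cases "\<beta> \<le> r")
  case True
  then have eq: "r + \<beta> - 1 = (r - \<beta> + \<beta> - 1) + \<beta>"
    using \<beta> by simp
  have "steps r = (r - \<beta> + \<beta> - 1) div \<beta> + 1"
    unfolding steps_def eq by (rule div_add_self2) (use \<beta> in simp)
  then show ?thesis
    by (simp only: steps_def Suc_eq_plus1)
next
  case False
  then have "(r + \<beta> - 1) div \<beta> = Suc 0"
    using assms by (intro div_nat_eqI) auto
  then show ?thesis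
    using False steps_0 by (simp add: steps_def)
qed

lemma p_bounds: "Suc n \<le> \<beta> * p" "\<beta> * p \<le> n + \<beta>"
proof -
  have p: "p = (n + \<beta>) div \<beta>"
    by (simp add: p_def steps_def)
  have "n + \<beta> = \<beta> * p + (n + \<beta>) mod \<beta>"
    unfolding p by (simp only: mult_div_mod_eq)
  with mod_less_divisor[OF \<beta>, of "n + \<beta>"] show "Suc n \<le> \<beta> * p" "\<beta> * p \<le> n + \<beta>"
    by linarith+
qed

definition entries :: "nat \<Rightarrow> nat \<Rightarrow> entry list" where
  "entries r d = map (\<lambda>j. (r, map (\<lambda>s. tab d s ! j) [0..<q])) [0..<\<beta>]"

text \<open>The next hub number is \<open>r\<close> itself, so all numbers in use have to exceed
  \<open>r\<close>; this makes it fresh and keeps 0 out at the leaves.\<close>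

definition valid :: "nat \<Rightarrow> entry list \<Rightarrow> nat list \<Rightarrow> bool" where
  "valid r g h \<longleftrightarrow> r \<le> Suc n \<and> distinct h \<and> (\<forall>x\<in>set h. r < x \<and> x \<le> Suc n) \<and>
     (\<forall>e\<in>set g. fst e \<in> set h \<and> length (snd e) = q) \<and> length g = \<beta> * length h \<and> length h + steps r = p"

lemma valid_child:
  assumes "valid r g h" "0 < r"
  shows "valid (r - \<beta>) (entries r d @ g) (r # h)"
  using assms steps_pos[OF assms(2)] \<beta> unfolding valid_def entries_def by fastforce

text \<open>Entries are prepended, so at a node with \<open>r\<close> variables left the list \<open>g\<close> describes the variables from
  \<open>\<beta> * steps r\<close> on.\<close>

definition covers :: "nat \<Rightarrow> entry list \<Rightarrow> nat list \<Rightarrow> (nat \<Rightarrow> bool) \<Rightarrow> bool" where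
  "covers r g h \<alpha> \<longleftrightarrow> (\<exists>\<rho>. (\<forall>x\<in>set h. \<rho> x < q) \<and>
     (\<forall>i<length g. \<alpha> (\<beta> * steps r + i) = snd (g ! i) ! \<rho> (fst (g ! i))))"

text \<open>The values of \<open>\<alpha>\<close> on the new block form a list of length
  \<open>\<beta>\<close>, which occurs in some table \<open>d\<close> at some position
  \<open>s\<close>. That table gives the child, and \<open>s\<close> the colour of the new hub
  vertex.\<close>

lemma covers_child:
  assumes v: "valid r g h" and r: "0 < r" and c: "covers r g h \<alpha>"
  shows "\<exists>d<M. covers (r - \<beta>) (entries r d @ g) (r # h) \<alpha>"
proof -
  obtain \<rho> where \<rho>: "\<And>x. x \<in> set h \<Longrightarrow> \<rho> x < q"
    "\<And>i. i < length g \<Longrightarrow> \<alpha> (\<beta> * steps r + i) = snd (g ! i) ! \<rho> (fst (g ! i))"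
    using c by (auto simp: covers_def)
  let ?k = "steps (r - \<beta>)"
  obtain d s where ds: "d < M" "s < q" "tab d s = map (\<lambda>j. \<alpha> (\<beta> * ?k + j)) [0..<\<beta>]"
    using tab_surj[of "map (\<lambda>j. \<alpha> (\<beta> * ?k + j)) [0..<\<beta>]"] by auto
  have rh: "r \<notin> set h"
    using v by (auto simp: valid_def)
  have "covers (r - \<beta>) (entries r d @ g) (r # h) \<alpha>"
    unfolding covers_def
  proof (intro exI[of _ "\<rho>(r := s)"] conjI ballI allI impI)
    fix x assume "x \<in> set (r # h)"
    then show "(\<rho>(r := s)) x < q"
      using \<rho>(1) ds(2) by auto
  next
    fix i assume i: "i < length (entries r d @ g)"
    have le: "length (entries r d) = \<beta>"
      by (simp add: entries_def)
    show "\<alpha> (\<beta> * ?k + i) = snd ((entries r d @ g) ! i) ! (\<rho>(r := s)) (fst ((entries r d @ g) ! i))"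
    proof (cases "i < \<beta>")
      case True
      then have "(entries r d @ g) ! i = (r, map (\<lambda>s. tab d s ! i) [0..<q])"
        by (simp add: nth_append le) (simp add: entries_def)
      then show ?thesis
        using ds True by simp
    next
      case False
      then obtain j where j: "i = \<beta> + j" "j < length g"
        using i le by (metis add_diff_inverse_nat length_append nat_add_left_cancel_less)
      then have nth: "(entries r d @ g) ! i = g ! j"
        by (simp add: nth_append le)
      have "fst (g ! j) \<noteq> r"
        using v j rh by (metis nth_mem valid_def)
      moreover have "\<beta> * ?k + i = \<beta> * steps r + j"
        using steps_pos[OF r] j by simp
      ultimately show ?thesis
        using \<rho>(2)[OF j(2)] nth by simp
    qed
  qed
  then show ?thesis
    using ds(1) by blast
qed

definition num_violated :: "(nat \<Rightarrow> bool) \<Rightarrow> nat" where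
  "num_violated \<alpha> = card (violated F \<alpha>)"

definition num_verts :: nat where
  "num_verts = \<beta> * p * q + p + length cs * (q ^ 3 * 8)"

text \<open>The same for all leaves, so solutions of different leaves are compared by their edge
  counts alone.\<close>

definition base :: nat where
  "base = \<beta> * p + length cs * (q ^ 3 * 4)"

text \<open>\<open>Z\<close> collects the assignments accounted for by the leaves visited so far.
  The size bound keeps the time for the next leaf polynomial.\<close>

definition good :: "tree \<Rightarrow> (nat \<Rightarrow> bool) set \<Rightarrow> bool" where
  "good b Z \<longleftrightarrow> size b \<le> num_verts * (2 * num_verts + 1) + 2 * n + 1 \<and>
     (b = Nl \<and> Z = {} \<or> b \<noteq> Nl \<and> (\<exists>\<alpha>. tl_tree b = enc_assignment n \<alpha> \<and>
        len (hd_tree b) = 2 * (base + num_violated \<alpha>) \<and> (\<forall>\<alpha>'\<in>Z. num_violated \<alpha> \<le> num_violated \<alpha>')))"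

lemma cs_props:
  assumes "C \<in> set cs"
  shows "length C \<le> 3" "(i, b) \<in> set C \<Longrightarrow> i < n"
proof -
  have "set C \<in> F" "distinct C"
    using assms cnf(2) by (auto simp: lists_cnf_def)
  then have "set C \<subseteq> {..<n} \<times> UNIV" "card (set C) \<le> 3"
    using cnf(1) by (auto simp: is_3cnf_def)
  then show "length C \<le> 3" "(i, b) \<in> set C \<Longrightarrow> i < n"
    using \<open>distinct C\<close> by (auto simp: distinct_card)
qed

text \<open>Clauses are distinct as sets, so counting positions in \<open>cs\<close> counts elements
  of \<open>F\<close>.\<close>

lemma num_violated_eq: "num_violated \<alpha> = (\<Sum>j<length cs. of_bool (\<forall>(i, b)\<in>set (cs ! j). \<alpha> i \<noteq> b))"
proof -
  let ?P = "\<lambda>C. \<forall>(i, b)\<in>C. \<alpha> i \<noteq> b"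
  have "violated F \<alpha> = set (filter ?P (map set cs))"
    using cnf(2) by (auto simp: violated_def lists_cnf_def)
  moreover have "distinct (filter ?P (map set cs))"
    using cnf(2) by (simp add: lists_cnf_def)
  ultimately have "num_violated \<alpha> = length (filter ?P (map set cs))"
    unfolding num_violated_def by (simp only: distinct_card)
  also have "\<dots> = card {j. j < length (map set cs) \<and> ?P (map set cs ! j)}"
    by (rule length_filter_conv_card)
  also have "{j. j < length (map set cs) \<and> ?P (map set cs ! j)} = {..<length cs} \<inter> {j. ?P (set (cs ! j))}"
    by auto
  also have "card \<dots> = (\<Sum>j<length cs. of_bool (?P (set (cs ! j))))"
    by simp
  finally show ?thesis .
qed

abbreviation (input) inp :: tree where
  "inp \<equiv> enc_cnf n cs"

abbreviation (input) zt :: "entry list \<Rightarrow> nat list \<Rightarrow> tree \<Rightarrow> tree" where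
  "zt g h b \<equiv> Pr (Pr (enc_list enc_entry g) (enc_list enc_nat h)) (Pr b inp)"

lemma enc_cnf_eq: "enc_cnf n cs = Pr (enc_nat n) (enc_list enc_clause cs)"
  by (simp add: enc_cnf_def enc_clause_def[abs_def])

lemma valid_0_length: "valid 0 g h \<Longrightarrow> length h = p \<and> length g = \<beta> * p \<and> n < length g"
  using p_bounds(1) by (auto simp: valid_def steps_0)

lemma leaf_encoding:
  assumes v: "valid 0 g h"
  shows "led_encoding q h g cs"
proof
  note len = valid_0_length[OF v]
  show "2 \<le> q" by (rule q2)
  show "distinct h" "0 \<notin> set h"
    using v by (auto simp: valid_def)
  show "0 < length g"
    using len by linarith
  show "fst (g ! i) \<in> set h" if "i < length g" for i
    using v that by (simp add: valid_def)
  show "i < length g" if "C \<in> set cs" "(i, b) \<in> set C" for C i b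
    using cs_props(2)[OF that] len by simp
  show "length C \<le> 3" if "C \<in> set cs" for C
    using cs_props(1)[OF that] .
  show "length (snd e) = q" if "e \<in> set g" for e
    using v that by (simp add: valid_def)
qed

text \<open>On the placed variables, the assignments covered at a leaf are those read off some
  colouring of its hub, and \<open>viol\<close> counts what they violate. An optimal deletion set is
  therefore as good as all of them at once; the better of it and \<open>b\<close> is kept.\<close>

lemma leaf_step:
  assumes A: "solves_LED_with_hub A q 8 3 T" and v: "valid 0 g h" and b: "good b Z"
  shows "\<exists>u y b'. computes A (redf q (zt g h b)) u y \<and> real u \<le> T p num_verts \<and> size y \<le> num_verts * (2 * num_verts + 1) \<and>
    postf q (Pr (zt g h b) y) = Pr b' inp \<and> good b' (Z \<union> {\<alpha>. covers 0 g h \<alpha>})"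
proof -
  interpret L: led_encoding q h g cs
    using v by (rule leaf_encoding)
  note len = valid_0_length[OF v]
  have N: "length L.verts = num_verts"
    unfolding L.length_verts using len by (simp add: num_verts_def)
  have red: "redf q (zt g h b) = enc_LED q num_verts L.edges L.lists L.hub"
    unfolding redf_def by (simp add: enc_cnf_eq L.reducet_eq N)
  have "\<exists>u y. computes A (enc_LED q num_verts L.edges L.lists L.hub) u y \<and> real u \<le> T (card L.hub) num_verts \<and>
      ((\<exists>X. LED_feasible {..<num_verts} L.edges L.lists X) \<longrightarrow>
        (\<exists>X. LED_optimal {..<num_verts} L.edges L.lists X \<and> y = enc_edges num_verts X))"
    using L.simple_graph_edges L.lists_subset L.is_hub_hub unfolding N
    by (intro A[unfolded solves_LED_with_hub_def, rule_format] conjI allI impI)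
  then obtain u y X where uy: "computes A (enc_LED q num_verts L.edges L.lists L.hub) u y" "real u \<le> T p num_verts"
    and X: "LED_optimal {..<num_verts} L.edges L.lists X" "y = enc_edges num_verts X"
    using L.ex_feasible L.card_hub len unfolding N by auto
  obtain r where r: "\<And>x. x \<in> set h \<Longrightarrow> r x < q"
    "\<And>k i c. k < num_verts \<Longrightarrow> L.verts ! k = Leaf i c \<Longrightarrow> (\<exists>k'<num_verts. {k, k'} \<in> X) \<longleftrightarrow> r (fst (g ! i)) = c"
    "(\<Sum>i<num_verts. \<Sum>k<num_verts. of_bool ({i, k} \<in> X)) = 2 * (L.base_cost + L.viol r)"
    "\<forall>r'. (\<forall>x\<in>set h. r' x < q) \<longrightarrow> L.viol r \<le> L.viol r'"
    by (rule L.optimal_deletion[unfolded N, OF X(1)]) (rule that)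
  \<comment> \<open>Holds for any colours and any assignment agreeing with them below
    \<open>n\<close>; it serves both the optimum and its competitors.\<close>
  have viol: "L.viol \<rho> = num_violated \<alpha>" if \<alpha>: "\<And>i. i < n \<Longrightarrow> \<alpha> i = snd (g ! i) ! \<rho> (fst (g ! i))" for \<rho> \<alpha>
    unfolding L.viol_def num_violated_eq
  proof (intro sum.cong refl)
    fix j assume "j \<in> {..<length cs}"
    then have C: "cs ! j \<in> set cs"
      by simp
    have "L.falsified \<rho> (cs ! j) \<longleftrightarrow> (\<forall>l<length (cs ! j). \<alpha> (fst (cs ! j ! l)) \<noteq> snd (cs ! j ! l))"
    proof -
      have "L.lit_false (cs ! j) l (\<rho> (L.lit_hub (cs ! j) l)) \<longleftrightarrow> \<alpha> (fst (cs ! j ! l)) \<noteq> snd (cs ! j ! l)"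
        if "l < length (cs ! j)" for l
      proof -
        have "fst (cs ! j ! l) < n"
          using cs_props(2)[OF C, of "fst (cs ! j ! l)" "snd (cs ! j ! l)"] that by simp
        then show ?thesis
          using that \<alpha> by (simp add: L.lit_false_def L.lit_hub_def)
      qed
      moreover have "L.lit_false (cs ! j) l s" if "\<not> l < length (cs ! j)" for l s
        using that by (simp add: L.lit_false_def)
      ultimately show ?thesis
        unfolding L.falsified_def using order_less_le_trans[OF _ cs_props(1)[OF C]] by blast
    qed
    also have "\<dots> \<longleftrightarrow> (\<forall>(i, b)\<in>set (cs ! j). \<alpha> i \<noteq> b)"
      by (simp add: all_set_conv_all_nth case_prod_beta)
    finally show "of_bool (L.falsified \<rho> (cs ! j)) = (of_bool (\<forall>(i, b)\<in>set (cs ! j). \<alpha> i \<noteq> b) :: nat)"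
      by simp
  qed
  define \<alpha> where "\<alpha> i = snd (g ! i) ! r (fst (g ! i))" for i
  have viol_r: "L.viol r = num_violated \<alpha>"
    by (rule viol) (simp add: \<alpha>_def)
  have ext: "extractt q y (enc_list enc_entry g) (enc_nat n) = enc_assignment n \<alpha>"
    unfolding X(2) \<alpha>_def using L.extractt_edges[of r X n, unfolded N] r len by simp
  have cnt: "len (count_matrix y) = 2 * (base + num_violated \<alpha>)"
    unfolding X(2) len_count_edges r(3) viol_r L.base_cost_def base_def using len by simp
  have min: "num_violated \<alpha> \<le> num_violated \<alpha>'" if c: "covers 0 g h \<alpha>'" for \<alpha>'
  proof -
    obtain \<rho> where \<rho>: "\<And>x. x \<in> set h \<Longrightarrow> \<rho> x < q"
      "\<And>i. i < length g \<Longrightarrow> \<alpha>' i = snd (g ! i) ! \<rho> (fst (g ! i))"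
      using c by (auto simp: covers_def steps_0)
    have "L.viol \<rho> = num_violated \<alpha>'"
      using \<rho>(2) len by (intro viol) simp
    moreover have "L.viol r \<le> L.viol \<rho>"
      using \<rho>(1) r(4) by simp
    ultimately show ?thesis
      by (simp add: viol_r)
  qed
  define w where "w = newt q y (enc_list enc_entry g) (enc_nat n)"
  have w: "w = Pr (count_matrix y) (enc_assignment n \<alpha>)"
    by (simp add: w_def newt_def ext)
  have sy: "size y \<le> num_verts * (2 * num_verts + 1)"
    unfolding X(2) by (rule size_enc_edges)
  have sw: "size w \<le> num_verts * (2 * num_verts + 1) + 2 * n + 1"
    using sy size_count_matrix[of y] size_enc_assignment[of n \<alpha>] by (simp add: w)
  have "postf q (Pr (zt g h b) y) = Pr (bettert b w) inp"
    unfolding postf_def by (simp add: enc_cnf_eq w_def)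
  moreover have "good (bettert b w) (Z \<union> {\<alpha>. covers 0 g h \<alpha>})"
  proof (cases "b = Nl \<or> len (hd_tree w) < len (hd_tree b)")
    case True
    have "num_violated \<alpha> \<le> num_violated \<alpha>'" if Z: "\<alpha>' \<in> Z" for \<alpha>'
    proof -
      obtain \<alpha>0 where \<alpha>0: "b \<noteq> Nl" "len (hd_tree b) = 2 * (base + num_violated \<alpha>0)" "num_violated \<alpha>0 \<le> num_violated \<alpha>'"
        using b Z unfolding good_def by blast
      then show ?thesis
        using True cnt by (simp add: w)
    qed
    then show ?thesis
      using True sw cnt min unfolding good_def bettert_def by (auto simp: w)
  next
    case False
    then obtain \<alpha>0 where \<alpha>0: "tl_tree b = enc_assignment n \<alpha>0" "len (hd_tree b) = 2 * (base + num_violated \<alpha>0)"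
      "\<And>\<alpha>'. \<alpha>' \<in> Z \<Longrightarrow> num_violated \<alpha>0 \<le> num_violated \<alpha>'"
      using b unfolding good_def by blast
    have "num_violated \<alpha>0 \<le> num_violated \<alpha>"
      using False \<alpha>0(2) cnt by (simp add: w)
    then have "num_violated \<alpha>0 \<le> num_violated \<alpha>'" if "\<alpha>' \<in> Z \<union> {\<alpha>. covers 0 g h \<alpha>}" for \<alpha>'
      using that \<alpha>0(3) min by (auto intro: order_trans)
    then show ?thesis
      using False b \<alpha>0 unfolding good_def bettert_def by auto
  qed
  ultimately show ?thesis
    using uy red sy by (intro exI[of _ u] exI[of _ y] exI[of _ "bettert b w"]) simp
qed

end

text \<open>The tables are transposed: each variable of the block gets the list of its values, as
  the entries need it.\<close>

definition table_trees :: "nat \<Rightarrow> nat \<Rightarrow> nat \<Rightarrow> (nat \<Rightarrow> nat \<Rightarrow> bool list) \<Rightarrow> tree list list" where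
  "table_trees q \<beta> M tab =
     map (\<lambda>d. map (\<lambda>j. enc_list enc_bool (map (\<lambda>s. tab d s ! j) [0..<q])) [0..<\<beta>]) [0..<M]"

fun dfs_cost :: "nat \<Rightarrow> nat \<Rightarrow> nat \<Rightarrow> nat \<Rightarrow> nat" where
  "dfs_cost K M T 0 = T"
| "dfs_cost K M T (Suc k) = K + M * dfs_cost K M T k"

text \<open>An inner node costs \<open>K\<close>, and with \<open>1 \<le> M\<close> no level has
  more than \<open>M ^ k\<close> nodes.\<close>

lemma dfs_cost_le:
  assumes "1 \<le> M"
  shows "dfs_cost K M T k \<le> M ^ k * (T + K * k)"
proof (induction k)
  case (Suc k)
  have "dfs_cost K M T (Suc k) \<le> K + M * (M ^ k * (T + K * k))"
    using Suc by simp
  moreover have "K \<le> M ^ Suc k * K"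
    using assms by simp
  ultimately have "dfs_cost K M T (Suc k) \<le> M ^ Suc k * K + M * (M ^ k * (T + K * k))"
    by linarith
  then show ?case
    by (simp add: algebra_simps)
qed simp

lemma tl_funpow_enc_nat: "(tl_tree ^^ k) (enc_nat r) = enc_nat (r - k)"
  unfolding enc_nat_def tl_funpow_enc_list by (rule enc_list_cong) (simp add: map_replicate_const)

section \<open>Correctness and cost of the depth-first search\<close>

context search
begin

definition node :: "nat \<Rightarrow> entry list \<Rightarrow> nat list \<Rightarrow> tree" where
  "node r g h = Pr (enc_nat r) (Pr (enc_list enc_entry g) (enc_list enc_nat h))"

definition state :: "tree \<Rightarrow> tree \<Rightarrow> tree" where
  "state S b = Pr S (Pr b inp)"

abbreviation child :: "nat \<Rightarrow> entry list \<Rightarrow> nat list \<Rightarrow> nat \<Rightarrow> tree" where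
  "child r g h d \<equiv> node (r - \<beta>) (entries r d @ g) (r # h)"

abbreviation child_covers :: "nat \<Rightarrow> entry list \<Rightarrow> nat list \<Rightarrow> nat \<Rightarrow> (nat \<Rightarrow> bool) \<Rightarrow> bool" where
  "child_covers r g h d \<equiv> covers (r - \<beta>) (entries r d @ g) (r # h)"

lemma childt_node:
  "childt \<beta> (map (\<lambda>j. enc_list enc_bool (map (\<lambda>s. tab d s ! j) [0..<q])) [0..<\<beta>]) (node r g h) = child r g h d"
proof -
  have "foldr (\<lambda>t. Pr (Pr (enc_nat r) t)) (map (\<lambda>j. enc_list enc_bool (f j)) xs) (enc_list enc_entry g) =
    enc_list enc_entry (map (\<lambda>j. (r, f j)) xs @ g)" for f and xs :: "nat list"
    by (induction xs) (auto simp: enc_entry_def)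
  then show ?thesis
    unfolding childt_def node_def entries_def by (simp add: tl_funpow_enc_nat)
qed

lemma pusht_state:
  "pusht \<beta> (table_trees q \<beta> M tab) (state (Pr (node r g h) S) b) =
    state (foldr (\<lambda>d. Pr (child r g h d)) [0..<M] S) b"
  unfolding pusht_def state_def table_trees_def by (simp add: foldr_map comp_def childt_node)

definition leaf_size :: nat where
  "leaf_size = \<beta> * p * (n + 2 * q + 3) + p * (n + 2) + (num_verts * (2 * num_verts + 1) + 2 * n + 1) +
     (n + length cs * (3 * (n + 3) + 1) + 1) + 3"

lemma size_zt:
  assumes v: "valid 0 g h" and b: "good b Z"
  shows "size (zt g h b) \<le> leaf_size"
proof -
  note len = valid_0_length[OF v]
  have "size (enc_entry e) \<le> n + 2 * q + 2" if "e \<in> set g" for e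
  proof -
    have "fst e \<le> Suc n" "length (snd e) = q"
      using v that by (auto simp: valid_def)
    then show ?thesis
      using size_enc_list[of "snd e" enc_bool 1] size_enc_bool by (simp add: enc_entry_def)
  qed
  then have g: "size (enc_list enc_entry g) \<le> \<beta> * p * (n + 2 * q + 3)"
    using size_enc_list[of g enc_entry "n + 2 * q + 2"] len by (simp add: numeral_eq_Suc)
  have "size (enc_nat x) \<le> n + 1" if "x \<in> set h" for x
    using v that by (auto simp: valid_def)
  then have h: "size (enc_list enc_nat h) \<le> p * (n + 2)"
    using size_enc_list[of h enc_nat "n + 1"] len by simp
  have "size (enc_clause C) \<le> 3 * (n + 3)" if C: "C \<in> set cs" for C
  proof -
    have "size (Pr (enc_nat i) (enc_bool b)) \<le> n + 2" if "(i, b) \<in> set C" for i b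
      using cs_props(2)[OF C that] size_enc_bool[of b] by simp
    then have "size (enc_clause C) \<le> length C * (n + 2 + 1)"
      unfolding enc_clause_def by (intro size_enc_list) auto
    also have "\<dots> \<le> 3 * (n + 3)"
      using cs_props(1)[OF C] by (intro mult_mono) auto
    finally show ?thesis .
  qed
  then have c: "size (enc_list enc_clause cs) \<le> length cs * (3 * (n + 3) + 1)"
    by (rule size_enc_list)
  have "size b \<le> num_verts * (2 * num_verts + 1) + 2 * n + 1"
    using b by (simp add: good_def)
  then show ?thesis
    using g h c by (simp add: leaf_size_def enc_cnf_eq)
qed

text \<open>Stated for an arbitrary stack \<open>S\<close> below the node and in continuation form:
  a run from \<open>S\<close> with the improved solution \<open>b'\<close> is prolonged to one from
  the node. In the induction, \<open>S\<close> takes in the siblings still to be visited.\<close>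

lemma dfs:
  assumes A: "solves_LED_with_hub A q 8 3 T" and TA: "T p num_verts \<le> real TA"
    and t: "\<And>z. t z \<le> (size z + 2) ^ dt"
    and push: "\<And>x u z. hd_tree x \<noteq> Nl \<Longrightarrow> hd_tree (hd_tree (hd_tree x)) \<noteq> Nl \<Longrightarrow>
      runs W m (pusht \<beta> (table_trees q \<beta> M tab) x) u z \<Longrightarrow> runs W m x (u + K) z"
    and leaf: "\<And>x u z v y. hd_tree x \<noteq> Nl \<Longrightarrow> hd_tree (hd_tree (hd_tree x)) = Nl \<Longrightarrow>
      computes A (redf q (tl_tree (splitt x))) v y \<Longrightarrow>
      runs W m (Pr (hd_tree (splitt x)) (postf q (Pr (tl_tree (splitt x)) y))) u z \<Longrightarrow>
      runs W m x (u + (K + t (tl_tree (splitt x)) + v + t (Pr (tl_tree (splitt x)) y))) z"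
  defines "TL \<equiv> K + (leaf_size + 2) ^ dt + TA + (leaf_size + num_verts * (2 * num_verts + 1) + 3) ^ dt"
  shows "valid r g h \<Longrightarrow> good b Z \<Longrightarrow>
    \<exists>b'. good b' (Z \<union> {\<alpha>. covers r g h \<alpha>}) \<and>
      (\<forall>u z. runs W m (state S b') u z \<longrightarrow>
        runs W m (state (Pr (node r g h) S) b) (u + dfs_cost K M TL (steps r)) z)"
proof (induction r arbitrary: g h b Z S rule: less_induct)
  case (less r)
  let ?x = "state (Pr (node r g h) S) b"
  show ?case
  proof (cases "r = 0")
    case True
    note v = less.prems(1)[unfolded True]
    obtain u y b' where uy: "computes A (redf q (zt g h b)) u y" "real u \<le> T p num_verts"
      "size y \<le> num_verts * (2 * num_verts + 1)" "postf q (Pr (zt g h b) y) = Pr b' inp"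
      "good b' (Z \<union> {\<alpha>. covers 0 g h \<alpha>})"
      using leaf_step[OF A v less.prems(2)] by blast
    have split: "splitt ?x = Pr S (zt g h b)"
      by (simp add: splitt_def state_def node_def)
    have sz: "size (zt g h b) \<le> leaf_size"
      using v less.prems(2) by (rule size_zt)
    have time: "K + t (zt g h b) + u + t (Pr (zt g h b) y) \<le> TL"
    proof -
      have "t (zt g h b) \<le> (leaf_size + 2) ^ dt"
        using t[of "zt g h b"] power_mono[of "size (zt g h b) + 2" "leaf_size + 2" dt] sz by linarith
      moreover have "t (Pr (zt g h b) y) \<le> (leaf_size + num_verts * (2 * num_verts + 1) + 3) ^ dt"
      proof -
        have "size (Pr (zt g h b) y) + 2 \<le> leaf_size + num_verts * (2 * num_verts + 1) + 3"
          using sz uy(3) by simp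
        from power_mono[OF this, of dt] t[of "Pr (zt g h b) y"] show ?thesis
          by linarith
      qed
      moreover have "u \<le> TA"
        using uy(2) TA by linarith
      ultimately show ?thesis
        unfolding TL_def by linarith
    qed
    have "runs W m ?x (v + dfs_cost K M TL (steps r)) z" if "runs W m (state S b') v z" for v z
    proof -
      have "runs W m ?x (v + (K + t (tl_tree (splitt ?x)) + u + t (Pr (tl_tree (splitt ?x)) y))) z"
      proof (rule leaf)
        show "hd_tree ?x \<noteq> Nl" "hd_tree (hd_tree (hd_tree ?x)) = Nl"
          using True by (simp_all add: state_def node_def)
        show "computes A (redf q (tl_tree (splitt ?x))) u y"
          using uy(1) by (simp add: split)
        show "runs W m (Pr (hd_tree (splitt ?x)) (postf q (Pr (tl_tree (splitt ?x)) y))) v z"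
          using that uy(4) unfolding split by (simp add: state_def)
      qed
      then show ?thesis
        unfolding split by (rule runs_mono) (use time True in \<open>simp_all add: steps_0\<close>)
    qed
    then show ?thesis
      using uy(5) True by blast
  next
    case False
    let ?k = "steps (r - \<beta>)"
    let ?c = "dfs_cost K M TL ?k"
    have r: "0 < r" "r - \<beta> < r"
      using False \<beta> by auto
    note v = valid_child[OF less.prems(1) r(1)]
    \<comment> \<open>The children are processed in the order of the stack, each passing its
      solution on to the next.\<close>
    have children: "good b Z \<Longrightarrow> \<exists>b'. good b' (Z \<union> {\<alpha>. \<exists>d\<in>set ds. child_covers r g h d \<alpha>}) \<and>
      (\<forall>u z. runs W m (state S b') u z \<longrightarrow>
        runs W m (state (foldr (\<lambda>d. Pr (child r g h d)) ds S) b) (u + length ds * ?c) z)" for ds b Z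
    proof (induction ds arbitrary: b Z)
      case Nil
      then show ?case by auto
    next
      case (Cons d ds)
      let ?S = "foldr (\<lambda>d. Pr (child r g h d)) ds S"
      obtain b1 where b1: "good b1 (Z \<union> {\<alpha>. child_covers r g h d \<alpha>})"
        "\<And>u z. runs W m (state ?S b1) u z \<Longrightarrow> runs W m (state (Pr (child r g h d) ?S) b) (u + ?c) z"
        using less.IH[OF r(2) v[of d] Cons.prems, of ?S] by blast
      obtain b2 where b2: "good b2 (Z \<union> {\<alpha>. child_covers r g h d \<alpha>} \<union>
          {\<alpha>. \<exists>d\<in>set ds. child_covers r g h d \<alpha>})"
        "\<And>u z. runs W m (state S b2) u z \<Longrightarrow> runs W m (state ?S b1) (u + length ds * ?c) z"
        using Cons.IH[OF b1(1)] by blast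
      have "Z \<union> {\<alpha>. child_covers r g h d \<alpha>} \<union>
          {\<alpha>. \<exists>d\<in>set ds. child_covers r g h d \<alpha>} =
        Z \<union> {\<alpha>. \<exists>d\<in>set (d # ds). child_covers r g h d \<alpha>}"
        by auto
      moreover have "runs W m (state (foldr (\<lambda>d. Pr (child r g h d)) (d # ds) S) b) (u + length (d # ds) * ?c) z"
        if "runs W m (state S b2) u z" for u z
        using b1(2)[OF b2(2)[OF that]] by (simp add: algebra_simps)
      ultimately show ?case
        using b2(1) by auto
    qed
    obtain b' where b': "good b' (Z \<union> {\<alpha>. \<exists>d\<in>set [0..<M]. child_covers r g h d \<alpha>})"
      "\<And>u z. runs W m (state S b') u z \<Longrightarrow>
        runs W m (state (foldr (\<lambda>d. Pr (child r g h d)) [0..<M] S) b) (u + length [0..<M] * ?c) z"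
      using children[OF less.prems(2), of "[0..<M]"] by blast
    \<comment> \<open>\<open>good\<close> passes to smaller sets, and by \<open>covers_child\<close>
      every covered assignment is covered at some child.\<close>
    have "good b' (Z \<union> {\<alpha>. covers r g h \<alpha>})"
    proof -
      have "Z \<union> {\<alpha>. covers r g h \<alpha>} \<subseteq> Z \<union> {\<alpha>. \<exists>d\<in>set [0..<M]. child_covers r g h d \<alpha>}"
        using covers_child[OF less.prems(1) r(1)] by fastforce
      then show ?thesis
        using b'(1) unfolding good_def by blast
    qed
    moreover have "runs W m ?x (u + dfs_cost K M TL (steps r)) z" if "runs W m (state S b') u z" for u z
    proof -
      have "runs W m ?x (u + length [0..<M] * ?c + K) z"
      proof (rule push)
        show "hd_tree ?x \<noteq> Nl" "hd_tree (hd_tree (hd_tree ?x)) \<noteq> Nl"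
          using r by (simp_all add: state_def node_def)
        show "runs W m (pusht \<beta> (table_trees q \<beta> M tab) ?x) (u + length [0..<M] * ?c) z"
          unfolding pusht_state using b'(2)[OF that] .
      qed
      then show ?thesis
        by (rule runs_mono) (simp_all add: steps_pos[OF r(1)])
    qed
    ultimately show ?thesis
      by blast
  qed
qed

lemma good_UNIV:
  assumes "good b UNIV"
  shows "\<exists>\<alpha>. max_sat_optimal F \<alpha> \<and> tl_tree b = enc_assignment n \<alpha>"
  using assms unfolding good_def max_sat_optimal_def is_arg_min_def num_violated_def by (auto simp: not_less)

lemma good_Nl: "good Nl {}"
  by (simp add: good_def)

lemma valid_root: "valid (Suc n) [] []"
  by (simp add: valid_def p_def)

text \<open>Nothing has been placed at the root, so the condition is vacuous and the search accounts
  for all assignments.\<close>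

lemma covers_root: "covers (Suc n) [] [] \<alpha>"
  by (simp add: covers_def)

end

section \<open>Running time\<close>

lemma exec_time_pos: "exec c s t s' \<Longrightarrow> 0 < t"
  by (induction rule: exec.induct) auto

text \<open>A run takes at least one step, but on a single vertex with a hub of size 1 a nonpositive
  base would allow none. Positivity is what makes powers of bases comparable later.\<close>

lemma hub_base_pos:
  assumes "solves_LED_with_hub A q \<sigma> \<delta> (\<lambda>p n. x ^ p * (real c * real (n + 1) ^ d))" "1 \<le> q"
  shows "0 < x"
proof -
  have "simple_graph {..<1::nat} {}" "\<forall>v<1::nat. (\<lambda>_. {1}) v \<subseteq> {1..q}" "is_hub \<sigma> \<delta> {..<1::nat} {} {0}"
    using assms(2) by (auto simp: simple_graph_def is_hub_def components_def quotient_def)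
  then obtain t y where t: "computes A (enc_LED q 1 {} (\<lambda>_. {1}) {0}) t y"
    "real t \<le> x ^ card {0::nat} * (real c * real (1 + 1) ^ d)"
    using assms(1) unfolding solves_LED_with_hub_def by meson
  have "0 < t"
    using t(1) by (auto simp: computes_def dest: exec_time_pos)
  then have "0 < x * (real c * 2 ^ d)"
    using t(2) by (simp del: mult_pos_pos)
  then show ?thesis
    by (metis mult_nonneg_nonneg mult_nonpos_nonneg not_less of_nat_0_le_iff zero_le_numeral zero_le_power)
qed

definition clause_bound :: "nat \<Rightarrow> nat" where
  "clause_bound n = (2 * n + 1) ^ 3"

definition vertex_bound :: "nat \<Rightarrow> nat \<Rightarrow> nat \<Rightarrow> nat" where
  "vertex_bound q \<beta> n = (n + \<beta>) * q + (n + 1) + clause_bound n * (q ^ 3 * 8)"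

definition input_bound :: "nat \<Rightarrow> nat \<Rightarrow> nat \<Rightarrow> nat" where
  "input_bound q \<beta> n = (n + \<beta>) * (n + 2 * q + 3) + (n + 1) * (n + 2) + (vertex_bound q \<beta> n * (2 * vertex_bound q \<beta> n + 1) + 2 * n + 1) +
     (n + clause_bound n * (3 * (n + 3) + 1) + 1) + 3"

definition leaf_bound :: "nat \<Rightarrow> nat \<Rightarrow> nat \<Rightarrow> nat \<Rightarrow> nat \<Rightarrow> nat" where
  "leaf_bound q \<beta> K dt n = K + (input_bound q \<beta> n + 2) ^ dt +
     (input_bound q \<beta> n + vertex_bound q \<beta> n * (2 * vertex_bound q \<beta> n + 1) + 3) ^ dt"

lemma poly_bd_vertex_bound: "poly_bd (\<lambda>n. n) (vertex_bound q \<beta>)"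
  unfolding vertex_bound_def clause_bound_def by (intro poly_bd_intros)

lemma poly_bd_input_bound: "poly_bd (\<lambda>n. n) (input_bound q \<beta>)"
  unfolding input_bound_def clause_bound_def by (intro poly_bd_intros poly_bd_vertex_bound)

context search
begin

lemma p_le: "p \<le> Suc n"
proof (rule ccontr)
  assume "\<not> p \<le> Suc n"
  then have "\<beta> * (n + 2) \<le> \<beta> * p"
    by (intro mult_le_mono2) simp
  moreover have "1 * n \<le> \<beta> * n"
    using \<beta> by (intro mult_le_mono1) simp
  ultimately show False
    using p_bounds(2) \<beta> by (simp add: algebra_simps)
qed

text \<open>Clauses are counted as lists of at most three out of \<open>2 * n\<close>
  literals.\<close>

lemma length_cs: "length cs \<le> clause_bound n"
proof -
  let ?A = "{..<n} \<times> (UNIV :: bool set)"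
  have "distinct cs"
    using cnf(2) by (simp add: lists_cnf_def distinct_map)
  then have "length cs = card (set cs)"
    by (simp add: distinct_card)
  also have "\<dots> \<le> card {xs. set xs \<subseteq> ?A \<and> length xs \<le> 3}"
    using cs_props by (intro card_mono finite_lists_length_le) auto
  also have "\<dots> = (\<Sum>i\<le>3. (2 * n) ^ i)"
    by (subst card_lists_length_le) (simp_all add: card_cartesian_product mult.commute)
  also have "\<dots> \<le> (2 * n + 1) ^ 3"
    by (simp add: eval_nat_numeral algebra_simps)
  finally show ?thesis
    by (simp add: clause_bound_def)
qed

lemma num_verts_le: "num_verts \<le> vertex_bound q \<beta> n"
  unfolding num_verts_def vertex_bound_def using p_bounds(2) p_le length_cs by (intro add_mono mult_mono) auto

lemma leaf_size_le: "leaf_size \<le> input_bound q \<beta> n"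
  unfolding leaf_size_def input_bound_def using p_bounds(2) p_le length_cs num_verts_le by (intro add_mono mult_mono) auto

end

lemma enc_nat_Suc: "enc_nat (Suc n) = Pr Nl (enc_nat n)"
proof -
  have "enc_nat (Suc n) = enc_list (\<lambda>_. Nl) (0 # [0..<n])"
    unfolding enc_nat_def by (rule enc_list_cong) (simp add: map_replicate_const replicate_append_same)
  then show ?thesis
    by (simp add: enc_nat_def)
qed

lemma runs_computes:
  assumes "runs c m x t y"
  shows "\<exists>t'\<le>t. computes c x t' y"
proof -
  have "\<exists>t'\<le>t. exec c ((\<lambda>_. Nl)(0 := x)) t' ((\<lambda>_. Nl)(0 := x, 0 := y))"
    by (rule runsD[OF assms]) auto
  then show ?thesis
    unfolding computes_def by (metis fun_upd_same)
qed

text \<open>The program is fixed by \<open>q\<close>, \<open>\<beta>\<close>, the tables and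
  \<open>A\<close>; only the time bound depends on the formula. \<open>TA\<close> is a natural
  number because \<open>dfs_cost\<close> counts steps.\<close>

lemma max_3sat_program:
  fixes tab :: "nat \<Rightarrow> nat \<Rightarrow> bool list"
  assumes q: "2 \<le> q" and \<beta>: "0 < \<beta>"
    and surj: "\<forall>v. length v = \<beta> \<longrightarrow> (\<exists>d<M. \<exists>s<q. tab d s = v)"
    and A: "solves_LED_with_hub A q 8 3 T"
  obtains c K dt where
    "\<And>n F cs TA. is_3cnf n F \<Longrightarrow> lists_cnf cs F \<Longrightarrow> T (search.p \<beta> n) (search.num_verts q \<beta> n cs) \<le> real TA \<Longrightarrow>
      \<exists>t \<alpha>. t \<le> 2 * K + M ^ search.p \<beta> n * (TA + leaf_bound q \<beta> K dt n + K * search.p \<beta> n) \<and>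
        computes c (enc_cnf n cs) t (enc_assignment n \<alpha>) \<and> max_sat_optimal F \<alpha>"
proof -
  obtain W m K t where W: "0 < m" "poly_bd size t"
    "\<And>x. hd_tree x = Nl \<Longrightarrow> runs W m x K x"
    "\<And>x u z. hd_tree x \<noteq> Nl \<Longrightarrow> hd_tree (hd_tree (hd_tree x)) \<noteq> Nl \<Longrightarrow>
      runs W m (pusht \<beta> (table_trees q \<beta> M tab) x) u z \<Longrightarrow> runs W m x (u + K) z"
    "\<And>x u z v y. hd_tree x \<noteq> Nl \<Longrightarrow> hd_tree (hd_tree (hd_tree x)) = Nl \<Longrightarrow>
      computes A (redf q (tl_tree (splitt x))) v y \<Longrightarrow>
      runs W m (Pr (hd_tree (splitt x)) (postf q (Pr (tl_tree (splitt x)) y))) u z \<Longrightarrow>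
      runs W m x (u + (K + t (tl_tree (splitt x)) + v + t (Pr (tl_tree (splitt x)) y))) z"
    by (rule dfs_program[where A = A and q = q and \<beta> = \<beta> and tabs = "table_trees q \<beta> M tab"]) (rule that)
  obtain dt where dt: "\<And>z. t z \<le> (size z + 2) ^ dt"
    using W(2) by (rule poly_bdE) (rule that)
  \<comment> \<open>Initial state: the stack holds only the root, and no solution is known. The
    additional \<open>Nl\<close> in front of the unary \<open>n\<close> turns it into
    \<open>Suc n\<close>.\<close>
  have "const_time (\<lambda>x. Pr (Pr (Pr (Pr Nl (hd_tree x)) (Pr Nl Nl)) Nl) (Pr Nl x))"
    by (intro const_time_intros)
  then obtain ci ki where ci: "\<And>m x. 0 < m \<Longrightarrow> runs ci m x ki (Pr (Pr (Pr (Pr Nl (hd_tree x)) (Pr Nl Nl)) Nl) (Pr Nl x))"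
    by (rule const_time_runs) (rule that)
  \<comment> \<open>In the final state the stack is empty; the answer is the second component of the
    best solution.\<close>
  have "const_time (\<lambda>x. tl_tree (hd_tree (tl_tree x)))"
    by (intro const_time_intros)
  then obtain cf kf where cf: "\<And>m x. 0 < m \<Longrightarrow> runs cf m x kf (tl_tree (hd_tree (tl_tree x)))"
    by (rule const_time_runs) (rule that)
  define K' where "K' = K + ki + kf"
  have M: "1 \<le> M"
    using surj[rule_format, of "replicate \<beta> True"] by auto
  show thesis
  proof (rule that[of K' dt "Seq ci (Seq W cf)"])
    fix n F cs TA
    assume cnf: "is_3cnf n F" "lists_cnf cs F" and TA: "T (search.p \<beta> n) (search.num_verts q \<beta> n cs) \<le> real TA"
    interpret S: search q \<beta> M n tab cs F
      using q \<beta> surj cnf by unfold_locales auto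
    let ?TL = "K + (S.leaf_size + 2) ^ dt + TA + (S.leaf_size + S.num_verts * (2 * S.num_verts + 1) + 3) ^ dt"
    obtain b where b: "S.good b ({} \<union> {\<alpha>. S.covers (Suc n) [] [] \<alpha>})"
      "\<And>u z. runs W m (S.state Nl b) u z \<Longrightarrow>
        runs W m (S.state (Pr (S.node (Suc n) [] []) Nl) Nl) (u + dfs_cost K M ?TL (S.steps (Suc n))) z"
      using S.dfs[OF A TA dt W(4,5) S.valid_root S.good_Nl, of Nl] by blast
    have "S.good b UNIV"
      using b(1) by (simp add: S.covers_root)
    then obtain \<alpha> where \<alpha>: "max_sat_optimal F \<alpha>" "tl_tree b = enc_assignment n \<alpha>"
      using S.good_UNIV by blast
    have init: "Pr (Pr (Pr (Pr Nl (hd_tree (enc_cnf n cs))) (Pr Nl Nl)) Nl) (Pr Nl (enc_cnf n cs)) =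
      S.state (Pr (S.node (Suc n) [] []) Nl) Nl"
      by (simp add: S.state_def S.node_def enc_nat_Suc S.enc_cnf_eq)
    have "runs W m (S.state Nl b) K (S.state Nl b)"
      by (rule W(3)) (simp add: S.state_def)
    from b(2)[OF this] have "runs W m (S.state (Pr (S.node (Suc n) [] []) Nl) Nl) (K + dfs_cost K M ?TL S.p) (S.state Nl b)"
      by (simp add: S.p_def)
    moreover have "runs cf m (S.state Nl b) kf (enc_assignment n \<alpha>)"
      using cf[OF W(1), of "S.state Nl b"] \<alpha>(2) by (simp add: S.state_def)
    ultimately have "runs (Seq W cf) m (S.state (Pr (S.node (Suc n) [] []) Nl) Nl)
        (K + dfs_cost K M ?TL S.p + kf) (enc_assignment n \<alpha>)"
      by (rule runs_Seq)
    from runs_Seq[OF ci[OF W(1), of "enc_cnf n cs", unfolded init] this]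
    have "runs (Seq ci (Seq W cf)) m (enc_cnf n cs) (ki + (K + dfs_cost K M ?TL S.p + kf)) (enc_assignment n \<alpha>)" .
    from runs_computes[OF this] obtain t' where t': "t' \<le> ki + (K + dfs_cost K M ?TL S.p + kf)"
      "computes (Seq ci (Seq W cf)) (enc_cnf n cs) t' (enc_assignment n \<alpha>)"
      by blast
    have "dfs_cost K M ?TL S.p \<le> M ^ S.p * (?TL + K * S.p)"
      using M by (rule dfs_cost_le)
    also have "\<dots> \<le> M ^ S.p * (TA + leaf_bound q \<beta> K' dt n + K' * S.p)"
    proof (rule mult_le_mono2)
      have "(S.leaf_size + 2) ^ dt \<le> (input_bound q \<beta> n + 2) ^ dt"
        using S.leaf_size_le by (intro power_mono) auto
      moreover have "(S.leaf_size + S.num_verts * (2 * S.num_verts + 1) + 3) ^ dt \<le> (input_bound q \<beta> n + vertex_bound q \<beta> n * (2 * vertex_bound q \<beta> n + 1) + 3) ^ dt"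
        using S.leaf_size_le S.num_verts_le by (intro power_mono add_mono mult_mono) auto
      moreover have "K * S.p \<le> K' * S.p"
        by (rule mult_le_mono1) (simp add: K'_def)
      moreover have "K \<le> K'"
        by (simp add: K'_def)
      ultimately show "?TL + K * S.p \<le> TA + leaf_bound q \<beta> K' dt n + K' * S.p"
        unfolding leaf_bound_def by linarith
    qed
    finally have "t' \<le> 2 * K' + M ^ S.p * (TA + leaf_bound q \<beta> K' dt n + K' * S.p)"
      using t'(1) by (simp add: K'_def)
    then show "\<exists>t \<alpha>. t \<le> 2 * K' + M ^ S.p * (TA + leaf_bound q \<beta> K' dt n + K' * S.p) \<and>
        computes (Seq ci (Seq W cf)) (enc_cnf n cs) t (enc_assignment n \<alpha>) \<and> max_sat_optimal F \<alpha>"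
      using t'(2) \<alpha>(1) by blast
  qed
qed

text \<open>Since \<open>M\<close> is at most \<open>2 ^ \<beta> / q + 1\<close>, the product
  \<open>M * b\<close> is at most \<open>2 ^ \<beta> * b / q + b\<close>. This is below
  \<open>2 ^ \<beta>\<close> as soon as \<open>b / (1 - b / q) < 2 ^ \<beta>\<close>, which can be
  reached because \<open>b < q\<close>.\<close>

lemma ex_tables:
  assumes "2 \<le> q" "1 \<le> b" "b < real q"
  obtains \<beta> M tab where "0 < \<beta>" "real M * b < 2 ^ \<beta>" "1 \<le> M"
    "\<forall>v :: bool list. length v = \<beta> \<longrightarrow> (\<exists>d<M. \<exists>s<q. tab d s = v)"
proof -
  obtain \<beta>0 where \<beta>0: "b / (1 - b / q) < 2 ^ \<beta>0"
    using real_arch_pow[of 2 "b / (1 - b / q)"] by auto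
  \<comment> \<open>The successor makes blocks nonempty.\<close>
  define \<beta> where "\<beta> = Suc \<beta>0"
  define M where "M = 2 ^ \<beta> div q + 1"
  define vs where "vs = List.n_lists \<beta> [False, True]"
  \<comment> \<open>The last table may run past the end of \<open>vs\<close>. Its surplus values are
    arbitrary, but any bits describe some assignment.\<close>
  define tab where "tab d s = vs ! (d * q + s)" for d s
  have "b / (1 - b / q) < 2 ^ \<beta>"
    using \<beta>0 by (rule order_less_le_trans) (simp add: \<beta>_def)
  moreover have pos: "0 < 1 - b / q"
    using assms by simp
  ultimately have "b < 2 ^ \<beta> * (1 - b / q)"
    by (simp add: pos_divide_less_eq)
  moreover have "real M \<le> 2 ^ \<beta> / q + 1"
    using of_nat_div_le_of_nat[of "2 ^ \<beta>" q, where 'a = real] by (simp add: M_def)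
  then have "real M * b \<le> (2 ^ \<beta> / q + 1) * b"
    using assms by (intro mult_right_mono) auto
  ultimately have "real M * b < 2 ^ \<beta>"
    by (simp add: algebra_simps)
  moreover have "\<exists>d<M. \<exists>s<q. tab d s = v" if "length v = \<beta>" for v
  proof -
    have "v \<in> set vs"
      using that by (auto simp: vs_def set_n_lists)
    then obtain i where i: "i < length vs" "vs ! i = v"
      by (metis in_set_conv_nth)
    have "length vs = 2 ^ \<beta>"
      by (simp add: vs_def length_n_lists numeral_2_eq_2)
    then have "i div q < M"
      using i(1) by (simp add: M_def less_Suc_eq_le div_le_mono)
    moreover have "i mod q < q"
      using assms by simp
    moreover have "tab (i div q) (i mod q) = v"
      using i(2) by (simp add: tab_def)
    ultimately show ?thesis
      by blast
  qed
  ultimately show thesis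
    by (intro that[of \<beta> M tab]) (auto simp: \<beta>_def M_def)
qed

theorem theorem2p5:
  fixes q :: nat
  assumes "q \<ge> 2"
  shows "\<exists>\<sigma>::nat. \<forall>\<epsilon>::real. \<epsilon> > 0 \<longrightarrow>
    (\<exists>A (c::nat) (d::nat).
       solves_LED_with_hub A q \<sigma> 3 (\<lambda>p n. (real q - \<epsilon>) ^ p * (real c * real (n + 1) ^ d))) \<longrightarrow>
    \<not> M3SH"
proof (intro exI[of _ 8] allI impI)
  fix \<epsilon> :: real
  assume \<epsilon>: "0 < \<epsilon>" and "\<exists>A (c::nat) (d::nat).
    solves_LED_with_hub A q 8 3 (\<lambda>p n. (real q - \<epsilon>) ^ p * (real c * real (n + 1) ^ d))"
  then obtain A c d where
    A: "solves_LED_with_hub A q 8 3 (\<lambda>p n. (real q - \<epsilon>) ^ p * (real c * real (n + 1) ^ d))"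
    by blast
  have pos: "0 < real q - \<epsilon>"
    using hub_base_pos[OF A] assms by simp
  \<comment> \<open>With \<open>1 \<le> b\<close> the additive terms can be absorbed into the factor
    \<open>b ^ p\<close>.\<close>
  define b where "b = max 1 (real q - \<epsilon>)"
  have b: "1 \<le> b" "b < real q" "real q - \<epsilon> \<le> b"
    using \<epsilon> assms by (auto simp: b_def)
  obtain \<beta> M and tab :: "nat \<Rightarrow> nat \<Rightarrow> bool list" where \<beta>: "0 < \<beta>" "real M * b < 2 ^ \<beta>" "1 \<le> M"
    and tab: "\<forall>v. length v = \<beta> \<longrightarrow> (\<exists>d<M. \<exists>s<q. tab d s = v)"
    by (rule ex_tables[OF assms b(1,2)]) (rule that)
  obtain P K dt where P: "\<And>n F cs TA. is_3cnf n F \<Longrightarrow> lists_cnf cs F \<Longrightarrow>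
      (real q - \<epsilon>) ^ search.p \<beta> n * (real c * real (search.num_verts q \<beta> n cs + 1) ^ d) \<le> real TA \<Longrightarrow>
      \<exists>t \<alpha>. t \<le> 2 * K + M ^ search.p \<beta> n * (TA + leaf_bound q \<beta> K dt n + K * search.p \<beta> n) \<and>
        computes P (enc_cnf n cs) t (enc_assignment n \<alpha>) \<and> max_sat_optimal F \<alpha>"
    by (rule max_3sat_program[OF assms \<beta>(1) tab A]) (rule that)
  define R where "R n = leaf_bound q \<beta> K dt n" for n
  \<comment> \<open>Everything apart from the exponential factor, gathered so that one polynomial
    bound suffices.\<close>
  define H where "H n = 2 * K + (c * (vertex_bound q \<beta> n + 1) ^ d + 1 + R n + K * (n + 1))" for n
  have "poly_bd (\<lambda>n. n) H"
    unfolding H_def R_def leaf_bound_def by (intro poly_bd_intros poly_bd_vertex_bound poly_bd_input_bound)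
  then obtain e where e: "\<And>n. H n \<le> (n + 2) ^ e"
    by (rule poly_bdE) (rule that)
  \<comment> \<open>\<open>M * b\<close> is the price per block of \<open>\<beta>\<close> variables,
    so its root is the price per variable; it is below 2 by the choice of
    \<open>\<beta>\<close>.\<close>
  define Y where "Y = root \<beta> (real M * b)"
  have Mb: "1 \<le> real M * b"
    using \<beta>(3) b(1) mult_mono[of 1 "real M" 1 b] by simp
  have Y: "1 \<le> Y" "Y ^ \<beta> = real M * b" "Y < 2"
  proof -
    show "1 \<le> Y"
      unfolding Y_def using \<beta>(1) Mb by simp
    show Yp: "Y ^ \<beta> = real M * b"
      unfolding Y_def using \<beta>(1) Mb by (intro real_root_pow_pos2) auto
    show "Y < 2"
      using \<beta>(2) Yp power_less_imp_less_base[of Y \<beta> 2] by simp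
  qed
  \<comment> \<open>\<open>\<beta> * p\<close> may exceed \<open>n\<close> by up to
    \<open>\<beta>\<close>, which gives the factor \<open>Y ^ \<beta>\<close>; the power of 2 turns
    \<open>n + 2\<close> into \<open>n + 1\<close>.\<close>
  define C where "C = nat \<lceil>Y ^ \<beta>\<rceil> * 2 ^ e"
  \<comment> \<open>\<open>2 - Y\<close> is the improvement over base 2 that refutes
    \<open>M3SH\<close>.\<close>
  have "solves_max_3sat P (\<lambda>n. (2 - (2 - Y)) ^ n * (real C * real (n + 1) ^ e))"
    unfolding solves_max_3sat_def
  proof (intro allI impI, elim conjE)
    fix n F cs
    assume cnf: "is_3cnf n F" "lists_cnf cs F"
    interpret S: search q \<beta> M n tab cs F
      using assms \<beta> tab cnf by unfold_locales auto
    define TA where "TA = nat \<lceil>b ^ S.p * (real c * real (S.num_verts + 1) ^ d)\<rceil>"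
    have "(real q - \<epsilon>) ^ S.p * (real c * real (S.num_verts + 1) ^ d) \<le> b ^ S.p * (real c * real (S.num_verts + 1) ^ d)"
      using pos b by (intro mult_right_mono power_mono) auto
    also have "\<dots> \<le> real TA"
      unfolding TA_def by linarith
    finally have "(real q - \<epsilon>) ^ S.p * (real c * real (S.num_verts + 1) ^ d) \<le> real TA" .
    from P[OF cnf this] obtain t \<alpha> where
      t: "t \<le> 2 * K + M ^ S.p * (TA + R n + K * S.p)"
      and comp: "computes P (enc_cnf n cs) t (enc_assignment n \<alpha>)" "max_sat_optimal F \<alpha>"
      unfolding R_def by blast
    have bp: "1 \<le> b ^ S.p" and Mp: "1 \<le> real M ^ S.p"
      using b(1) \<beta>(3) by (simp_all add: one_le_power)
    have "real TA \<le> b ^ S.p * (real c * real (S.num_verts + 1) ^ d) + 1"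
      unfolding TA_def using b(1) by (simp add: of_nat_ceiling)
    also have "\<dots> \<le> b ^ S.p * (real c * real (vertex_bound q \<beta> n + 1) ^ d) + b ^ S.p * 1"
      using b(1) bp S.num_verts_le by (intro add_mono mult_left_mono power_mono) auto
    finally have TA: "real TA \<le> b ^ S.p * (real c * real (vertex_bound q \<beta> n + 1) ^ d + 1)"
      by (simp add: algebra_simps)
    have "real (R n + K * S.p) \<le> b ^ S.p * real (R n + K * (n + 1))"
    proof -
      have "real (R n + K * S.p) \<le> 1 * real (R n + K * (n + 1))"
        using S.p_le mult_le_mono2[of S.p "n + 1" K] unfolding mult_1 of_nat_le_iff by simp
      also have "\<dots> \<le> b ^ S.p * real (R n + K * (n + 1))"
        using bp by (intro mult_right_mono) auto
      finally show ?thesis .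
    qed
    with TA have "real (TA + R n + K * S.p) \<le>
      b ^ S.p * (real c * real (vertex_bound q \<beta> n + 1) ^ d + 1 + real (R n + K * (n + 1)))"
      by (simp add: algebra_simps)
    then have "real M ^ S.p * real (TA + R n + K * S.p) \<le>
      real M ^ S.p * (b ^ S.p * (real c * real (vertex_bound q \<beta> n + 1) ^ d + 1 + real (R n + K * (n + 1))))"
      by (rule mult_left_mono) simp
    also have "\<dots> = (real M * b) ^ S.p * (real c * real (vertex_bound q \<beta> n + 1) ^ d + 1 + real (R n + K * (n + 1)))"
      by (simp add: power_mult_distrib)
    finally have main: "real M ^ S.p * real (TA + R n + K * S.p) \<le>
      (real M * b) ^ S.p * (real c * real (vertex_bound q \<beta> n + 1) ^ d + 1 + real (R n + K * (n + 1)))" .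
    have "real (2 * K) \<le> (real M * b) ^ S.p * real (2 * K)"
      using Mb mult_right_mono[of 1 "(real M * b) ^ S.p" "real (2 * K)"] by (simp add: one_le_power)
    moreover have "real t \<le> real (2 * K) + real M ^ S.p * real (TA + R n + K * S.p)"
      using t by (metis of_nat_add of_nat_le_iff of_nat_mult of_nat_power)
    ultimately have "real t \<le> (real M * b) ^ S.p * real (H n)"
      using main by (simp add: H_def algebra_simps)
    also have "(real M * b) ^ S.p = Y ^ (\<beta> * S.p)"
      by (simp add: power_mult Y(2))
    also have "Y ^ (\<beta> * S.p) * real (H n) \<le> Y ^ (n + \<beta>) * real ((n + 2) ^ e)"
      using Y(1) S.p_bounds(2) e[of n] by (intro mult_mono power_increasing) (auto simp del: of_nat_power)
    also have "\<dots> \<le> Y ^ n * (real C * real (n + 1) ^ e)"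
    proof -
      have "Y ^ \<beta> \<le> real (nat \<lceil>Y ^ \<beta>\<rceil>)"
        by linarith
      moreover have "real ((n + 2) ^ e) \<le> 2 ^ e * real (n + 1) ^ e"
      proof -
        have "real ((n + 2) ^ e) \<le> (2 * real (n + 1)) ^ e"
          unfolding of_nat_power by (intro power_mono) auto
        then show ?thesis
          by (simp only: power_mult_distrib)
      qed
      ultimately have "Y ^ \<beta> * real ((n + 2) ^ e) \<le> real (nat \<lceil>Y ^ \<beta>\<rceil>) * (2 ^ e * real (n + 1) ^ e)"
        by (intro mult_mono) auto
      then have "Y ^ n * (Y ^ \<beta> * real ((n + 2) ^ e)) \<le> Y ^ n * (real C * real (n + 1) ^ e)"
        using Y(1) by (intro mult_left_mono) (auto simp: C_def mult.assoc)
      then show ?thesis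
        by (simp add: power_add mult.assoc)
    qed
    finally have "real t \<le> (2 - (2 - Y)) ^ n * (real C * real (n + 1) ^ e)"
      by simp
    then show "\<exists>t y. computes P (enc_cnf n cs) t y \<and>
        real t \<le> (2 - (2 - Y)) ^ n * (real C * real (n + 1) ^ e) \<and>
        (\<exists>\<alpha>. max_sat_optimal F \<alpha> \<and> y = enc_assignment n \<alpha>)"
      using comp by blast
  qed
  moreover have "0 < 2 - Y"
    using Y(3) by simp
  ultimately show "\<not> M3SH"
    unfolding M3SH_def by blast
qed

end
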